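(* Given positive integers $n,d,m$ with $n>1$, there exists a finite set of points $Z\subset\mathbb{P}^n$ admitting an unexpected hypersurface of degree $d$ with a general point of multiplicity $m$ if and only if one of the following conditions holds: (i) $n=2$ and $d>m>2$; or (ii) $n\ge 3$ and $d\ge m\ge 2$.
   Context: $\mathbb{K}$ is an algebraically closed field of characteristic $0$, $\mathbb{P}^n=\mathbb{P}^n_{\mathbb{K}}$, and $R=\mathbb{K}[x_0,\ldots,x_n]$ is its homogeneous coordinate ring. For a finite set $Z$ of (distinct) points, $I_Z\subset R$ is the ideal generated by all forms vanishing at every point of $Z$; for a point $P$, $I_P$ is the ideal generated by all forms vanishing at $P$. For a homogeneous ideal $I$, $[I]_d$ is the $\mathbb{K}$-vector space of forms of degree $d$ in $I$. We say that $Z$ admits an unexpected hypersurface of degree $d$ with a general point of multiplicity $m$ if, for a general point $P\in\mathbb{P}^n$ (i.e. for all $P$ in some nonempty Zariski open subset of $\mathbb{P}^n$), $$\dim_{\mathbb{K}} [I_Z\cap (I_P)^m]_d > \max\left\{0,\ \dim_{\mathbb{K}} [I_Z]_d-\binom{m-1+n}{n}\right\}.$$ *)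

theory Defs
  imports
    "HOL-Library.Poly_Mapping"
    "HOL-Computational_Algebra.Polynomial"
    "HOL-Algebra.Ideal_Product"
begin

section \<open>The homogeneous coordinate ring\<close>

text \<open>
  Polynomials over \<open>'k\<close> in variables indexed by \<open>nat\<close>: finitely supported maps from exponent
  vectors to coefficients, with the convolution product of \<^theory>\<open>HOL-Library.Poly_Mapping\<close>.
  The ring \<open>K[x_0, ..., x_n]\<close> consists of those using only variables with index at most \<open>n\<close>.
\<close>

type_synonym 'k mpoly = "(nat \<Rightarrow>\<^sub>0 nat) \<Rightarrow>\<^sub>0 'k"

definition coord_ring :: "nat \<Rightarrow> ('k::comm_ring_1 mpoly) ring" where
  "coord_ring n = \<lparr> carrier = {p. \<forall>t\<in>Poly_Mapping.keys p. Poly_Mapping.keys t \<subseteq> {..n}},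
                    mult = (*), one = 1, zero = 0, add = (+) \<rparr>"

definition total_degree :: "(nat \<Rightarrow>\<^sub>0 nat) \<Rightarrow> nat" where
  "total_degree t = (\<Sum>i\<in>Poly_Mapping.keys t. Poly_Mapping.lookup t i)"

text \<open>The zero polynomial is a form of every degree.\<close>

definition forms :: "nat \<Rightarrow> nat \<Rightarrow> 'k::comm_ring_1 mpoly set" where
  "forms n d = {p \<in> carrier (coord_ring n). \<forall>t\<in>Poly_Mapping.keys p. total_degree t = d}"

definition mpoly_eval :: "(nat \<Rightarrow> 'k) \<Rightarrow> 'k::comm_ring_1 mpoly \<Rightarrow> 'k" where
  "mpoly_eval v p = (\<Sum>t\<in>Poly_Mapping.keys p. Poly_Mapping.lookup p t * (\<Prod>i\<in>Poly_Mapping.keys t. v i ^ Poly_Mapping.lookup t i))"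

definition mpoly_scale :: "'k \<Rightarrow> 'k::comm_ring_1 mpoly \<Rightarrow> 'k mpoly" where
  "mpoly_scale c p = Poly_Mapping.single 0 c * p"

abbreviation mpoly_dim :: "'k::field mpoly set \<Rightarrow> nat" where
  "mpoly_dim \<equiv> vector_space.dim mpoly_scale"


section \<open>Projective space\<close>

text \<open>A point of projective space is the class of all its homogeneous coordinate vectors.\<close>

definition homog_coords :: "nat \<Rightarrow> (nat \<Rightarrow> 'k::field) set" where
  "homog_coords n = {v. (\<forall>i>n. v i = 0) \<and> (\<exists>i. v i \<noteq> 0)}"

definition proportional :: "nat \<Rightarrow> ((nat \<Rightarrow> 'k::field) \<times> (nat \<Rightarrow> 'k)) set" where
  "proportional n = {(v, w). v \<in> homog_coords n \<and> w \<in> homog_coords n \<and>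
                              (\<exists>c. c \<noteq> 0 \<and> w = (\<lambda>i. c * v i))}"

definition proj_space :: "nat \<Rightarrow> (nat \<Rightarrow> 'k::field) set set" where
  "proj_space n = homog_coords n // proportional n"

text \<open>
  Only meant for forms; for these, vanishing does not depend on the coordinate vector,
  see \<open>vanishes_at_iff\<close> below.
\<close>

definition vanishes_at :: "'k::field mpoly \<Rightarrow> (nat \<Rightarrow> 'k) set \<Rightarrow> bool" where
  "vanishes_at f P \<longleftrightarrow> (\<forall>v\<in>P. mpoly_eval v f = 0)"

definition zariski_open :: "nat \<Rightarrow> (nat \<Rightarrow> 'k::field) set set \<Rightarrow> bool" where
  "zariski_open n U \<longleftrightarrow> (\<exists>F \<subseteq> (\<Union>e. forms n e).
      U = proj_space n - {P \<in> proj_space n. \<forall>f\<in>F. vanishes_at f P})"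

definition for_general_point :: "nat \<Rightarrow> ((nat \<Rightarrow> 'k::field) set \<Rightarrow> bool) \<Rightarrow> bool" where
  "for_general_point n Q \<longleftrightarrow> (\<exists>U. zariski_open n U \<and> U \<noteq> {} \<and> (\<forall>P\<in>U. Q P))"


section \<open>Ideals of points and unexpected hypersurfaces\<close>

definition point_ideal :: "nat \<Rightarrow> (nat \<Rightarrow> 'k::field) set set \<Rightarrow> 'k mpoly set" where
  "point_ideal n Z = genideal (coord_ring n) {f \<in> (\<Union>e. forms n e). \<forall>P\<in>Z. vanishes_at f P}"

definition ideal_power :: "nat \<Rightarrow> 'k::field mpoly set \<Rightarrow> nat \<Rightarrow> 'k mpoly set" where
  "ideal_power n I m = I [^]\<^bsub>ideals_set (coord_ring n)\<^esub> m"

definition graded_part :: "nat \<Rightarrow> nat \<Rightarrow> 'k::field mpoly set \<Rightarrow> 'k mpoly set" where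
  "graded_part n d I = I \<inter> forms n d"

definition admits_unexpected :: "nat \<Rightarrow> nat \<Rightarrow> nat \<Rightarrow> (nat \<Rightarrow> 'k::field) set set \<Rightarrow> bool" where
  "admits_unexpected n d m Z \<longleftrightarrow> for_general_point n (\<lambda>P.
      int (mpoly_dim (graded_part n d (point_ideal n Z \<inter> ideal_power n (point_ideal n {P}) m)))
        > max 0 (int (mpoly_dim (graded_part n d (point_ideal n Z)))
                   - int ((m - 1 + n) choose n)))"


section \<open>Well-definedness\<close>

lemma vector_space_mpoly_scale: "vector_space (mpoly_scale :: 'k::field \<Rightarrow> _)"
proof
  fix a b :: 'k and x y :: "'k mpoly"
  show "mpoly_scale a (x + y) = mpoly_scale a x + mpoly_scale a y"
    by (simp add: mpoly_scale_def algebra_simps)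
  show "mpoly_scale (a + b) x = mpoly_scale a x + mpoly_scale b x"
    by (simp add: mpoly_scale_def single_add algebra_simps)
  show "mpoly_scale a (mpoly_scale b x) = mpoly_scale (a * b) x"
    by (simp add: mpoly_scale_def mult_single flip: mult.assoc)
  show "mpoly_scale 1 x = x"
    by (simp add: mpoly_scale_def)
qed

lemma cring_coord_ring: "cring (coord_ring n :: ('k::comm_ring_1 mpoly) ring)"
proof (rule cringI)
  let ?C = "carrier (coord_ring n :: 'k mpoly ring)"
  have zero: "0 \<in> ?C" and one: "1 \<in> ?C"
    by (auto simp: coord_ring_def)
  have add: "p + q \<in> ?C" if "p \<in> ?C" "q \<in> ?C" for p q
    using that Poly_Mapping.keys_add[of p q] by (fastforce simp: coord_ring_def)
  have minus: "- p \<in> ?C" if "p \<in> ?C" for p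
    using that by (simp add: coord_ring_def)
  have mult: "p * q \<in> ?C" if "p \<in> ?C" "q \<in> ?C" for p q
  proof -
    have "Poly_Mapping.keys t \<subseteq> {..n}" if t: "t \<in> Poly_Mapping.keys (p * q)" for t
    proof -
      obtain a b where ab: "t = a + b" "a \<in> Poly_Mapping.keys p" "b \<in> Poly_Mapping.keys q"
        using t keys_mult[of p q] by blast
      have "Poly_Mapping.keys a \<subseteq> {..n}" "Poly_Mapping.keys b \<subseteq> {..n}"
        using ab \<open>p \<in> ?C\<close> \<open>q \<in> ?C\<close> by (auto simp: coord_ring_def)
      then show ?thesis
        using ab(1) Poly_Mapping.keys_add[of a b] by blast
    qed
    then show ?thesis by (simp add: coord_ring_def)
  qed
  have ops: "x \<oplus>\<^bsub>coord_ring n\<^esub> y = x + y" "x \<otimes>\<^bsub>coord_ring n\<^esub> y = x * y"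
    "\<zero>\<^bsub>coord_ring n\<^esub> = 0" "\<one>\<^bsub>coord_ring n\<^esub> = 1" for x y :: "'k mpoly"
    by (simp_all add: coord_ring_def)
  show "abelian_group (coord_ring n :: 'k mpoly ring)"
  proof (rule abelian_groupI, unfold ops)
    fix x assume "x \<in> ?C"
    then show "\<exists>y\<in>?C. y + x = 0"
      using minus[of x] by (intro bexI[of _ "- x"]) simp_all
  qed (use zero add in \<open>simp_all add: add_ac\<close>)
  show "comm_monoid (coord_ring n :: 'k mpoly ring)"
    by (rule comm_monoidI, unfold ops) (use one mult in \<open>simp_all add: mult_ac\<close>)
qed (simp add: coord_ring_def distrib_right)

lemma equiv_proportional: "equiv (homog_coords n) (proportional n :: ((nat \<Rightarrow> 'k::field) \<times> _) set)"
proof (rule equivI)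
  show "proportional n \<subseteq> homog_coords n \<times> (homog_coords n :: (nat \<Rightarrow> 'k) set)"
    by (auto simp: proportional_def)
  show "refl_on (homog_coords n) (proportional n :: ((nat \<Rightarrow> 'k) \<times> _) set)"
    by (auto simp: refl_on_def proportional_def intro: exI[of _ 1])
  show "sym (proportional n :: ((nat \<Rightarrow> 'k) \<times> _) set)"
  proof (rule symI)
    fix v w :: "nat \<Rightarrow> 'k"
    assume vw: "(v, w) \<in> proportional n"
    then obtain c where "c \<noteq> 0" "w = (\<lambda>i. c * v i)" by (auto simp: proportional_def)
    then have "inverse c \<noteq> 0 \<and> v = (\<lambda>i. inverse c * w i)" by auto
    with vw show "(w, v) \<in> proportional n" unfolding proportional_def by blast
  qed
  show "trans (proportional n :: ((nat \<Rightarrow> 'k) \<times> _) set)"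
  proof (rule transI)
    fix u v w :: "nat \<Rightarrow> 'k"
    assume uv: "(u, v) \<in> proportional n" and vw: "(v, w) \<in> proportional n"
    obtain a where a: "a \<noteq> 0" "v = (\<lambda>i. a * u i)" using uv by (auto simp: proportional_def)
    obtain b where b: "b \<noteq> 0" "w = (\<lambda>i. b * v i)" using vw by (auto simp: proportional_def)
    have "b * a \<noteq> 0 \<and> w = (\<lambda>i. (b * a) * u i)" using a b by (auto simp: mult.assoc)
    with uv vw show "(u, w) \<in> proportional n" unfolding proportional_def by blast
  qed
qed

lemma mpoly_eval_form_scale:
  assumes "f \<in> forms n e"
  shows "mpoly_eval (\<lambda>i. c * v i) f = c ^ e * mpoly_eval v f"
proof -
  have "(\<Prod>i\<in>Poly_Mapping.keys t. (c * v i) ^ Poly_Mapping.lookup t i) = c ^ e * (\<Prod>i\<in>Poly_Mapping.keys t. v i ^ Poly_Mapping.lookup t i)"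
    if "t \<in> Poly_Mapping.keys f" for t
  proof -
    have "(\<Sum>i\<in>Poly_Mapping.keys t. Poly_Mapping.lookup t i) = e"
      using assms that by (auto simp: forms_def total_degree_def)
    then show ?thesis
      by (simp add: power_mult_distrib prod.distrib flip: power_sum)
  qed
  then show ?thesis
    by (simp add: mpoly_eval_def sum_distrib_left mult_ac cong: sum.cong)
qed

lemma vanishes_at_iff:
  assumes "f \<in> forms n e" "v \<in> homog_coords n"
  shows "vanishes_at f (proportional n `` {v}) \<longleftrightarrow> mpoly_eval v f = 0"
proof
  have "v \<in> proportional n `` {v}"
    using equiv_class_self[OF equiv_proportional assms(2)] .
  then show "vanishes_at f (proportional n `` {v}) \<Longrightarrow> mpoly_eval v f = 0"
    by (simp add: vanishes_at_def)
  show "mpoly_eval v f = 0 \<Longrightarrow> vanishes_at f (proportional n `` {v})"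
    using mpoly_eval_form_scale[OF assms(1)] by (auto simp: vanishes_at_def proportional_def)
qed

end

theory Submission
  imports Defs "HOL-Computational_Algebra.Formal_Power_Series"
begin

text \<open>
  Existence. If \<open>[I_Z]_d\<close> has dimension at most \<open>binom(m - 1 + n, n)\<close>, a single hypersurface with a
  general \<open>m\<close>-fold point suffices; adding enough points of a hyperplane missing \<open>Z\<close> multiplies
  \<open>[I_Z]_d\<close> by a linear form, so the degree can be raised freely. For \<open>n \<ge> 3\<close> and \<open>d = m\<close>, take \<open>Z\<close> on
  codimension-two subspaces: the hyperplanes joining them to \<open>P\<close> form a cone with vertex \<open>P\<close>. For
  \<open>n = 2\<close> and \<open>d = m + 1 = t + 2\<close>, take the points \<open>e_i\<close> and \<open>e_i - z e_j\<close> with \<open>z^t = 1\<close>; the derivation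
  \<open>\<Sum> x_i^(t+1) \<partial>_i\<close> of the dual arrangement yields the curve
  \<open>F(x) = \<Sum> x_i (P \<times> x)_i^(t+1)\<close>, where \<open>P \<times> x\<close> vanishes at \<open>x = P\<close>.

  Non-existence. The cases \<open>d < m\<close> and \<open>m = 1\<close> are immediate. A plane curve of degree \<open>m\<close> with an
  \<open>m\<close>-fold point is a union of lines through it, and is determined by a binary form. For a double
  point in the plane, suppose \<open>dim [I_Z]_d \<ge> 3\<close> and all Jacobian determinants of \<open>V = [I_Z]_d\<close> vanish.
  Then a vector field \<open>D\<close> satisfies \<open>D f = \<tau> f\<close> on \<open>V\<close>, some nonzero \<open>F \<in> V\<close> is singular at \<open>P\<close>, hence
  singular along the integral curve of \<open>D\<close> through \<open>P\<close>, and therefore \<open>F = b^2 w\<close> with \<open>b\<close> not constant.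
  As \<open>Z\<close> is reduced, \<open>k = b w\<close> vanishes on \<open>Z\<close>; but \<open>k x_0, k x_1, k x_2\<close> have a nonzero Jacobian
  determinant, and the complementary powers of the coordinate at infinity bring them into \<open>V\<close>.
\<close>

text \<open>Three members of V with nonzero Jacobian determinant at P show that a double point at P
  imposes three independent conditions. The double-point case thus asks when this rank drops
  everywhere, that is, when V maps the plane to a curve. The fibres of that map are replaced by the
  formal integral curve of D. The curve need not be algebraic a priori, but evaluation along it is a
  ring homomorphism from K[x,y] to power series. Its kernel is prime, contains F, and is not the
  ideal of a point because D does not vanish at P; hence it is principal, and its generator is the b
  of the overview. In both constructions the dimension is bounded by a set of monomials whose
  coefficients determine every form vanishing on the points. For the cone this set has at most
  binom(m - 1 + n, n) elements because n - 1 monomials are traded for n - 1 others. For the plane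
  arrangement it has at most binom(t + 1, 2) + 3 elements, and 3 \<le> t + 1 is what requires m >
  2.\<close>

unbundle fps_syntax

section \<open>Differential tools for double points of plane curves\<close>

subsection \<open>Bivariate polynomials\<close>

text \<open>A polynomial in \<open>x\<close> and \<open>y\<close> is a polynomial in \<open>y\<close> over the polynomials in \<open>x\<close>: \<open>pderiv\<close> is
  \<open>\<partial>/\<partial>y\<close> and \<open>pderiv_inner\<close> is \<open>\<partial>/\<partial>x\<close>.\<close>

definition pderiv_inner :: "'a::idom poly poly \<Rightarrow> 'a poly poly" where
  "pderiv_inner p = map_poly pderiv p"

lemma coeff_pderiv_inner [simp]: "coeff (pderiv_inner p) n = pderiv (coeff p n)"
  by (simp add: pderiv_inner_def coeff_map_poly)

lemma pderiv_inner_add: "pderiv_inner (p + q) = pderiv_inner p + pderiv_inner q"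
  by (rule poly_eqI) (simp add: pderiv_add)

lemma pderiv_inner_mult: "pderiv_inner (p * q) = pderiv_inner p * q + p * pderiv_inner q"
proof (rule poly_eqI)
  fix n
  have "coeff (pderiv_inner (p * q)) n = pderiv (\<Sum>i\<le>n. coeff p i * coeff q (n - i))"
    by (simp add: coeff_mult)
  also have "\<dots> = (\<Sum>i\<le>n. coeff p i * pderiv (coeff q (n - i)) + pderiv (coeff p i) * coeff q (n - i))"
    by (simp only: higher_pderiv_sum [where n = "Suc 0", simplified] pderiv_mult mult.commute)
  also have "\<dots> = coeff (pderiv_inner p * q + p * pderiv_inner q) n"
    by (simp add: coeff_mult sum.distrib)
  finally show "coeff (pderiv_inner (p * q)) n = coeff (pderiv_inner p * q + p * pderiv_inner q) n" .
qed

lemma pderiv_of_nat_mult: "pderiv (of_nat k * c) = of_nat k * pderiv (c :: 'a::idom poly)"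
  by (simp add: pderiv_mult)

lemma pderiv_inner_pderiv: "pderiv_inner (pderiv p) = pderiv (pderiv_inner p)"
  by (rule poly_eqI) (simp only: coeff_pderiv_inner coeff_pderiv pderiv_of_nat_mult)

definition poly2 :: "'a::comm_ring_1 poly poly \<Rightarrow> 'a \<Rightarrow> 'a \<Rightarrow> 'a" where
  "poly2 p a b = poly (poly p [:b:]) a"

lemma poly2_simps [simp]:
  "poly2 (p + q) a b = poly2 p a b + poly2 q a b"
  "poly2 (p - q) a b = poly2 p a b - poly2 q a b"
  "poly2 (- p) a b = - poly2 p a b"
  "poly2 (p * q) a b = poly2 p a b * poly2 q a b"
  "poly2 0 a b = 0" "poly2 1 a b = 1"
  "poly2 [:c:] a b = poly c a"
  "poly2 [:c, d:] a b = poly c a + poly d a * b"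
  "poly2 (p ^ n) a b = poly2 p a b ^ n"
  by (simp_all add: poly2_def mult.commute)

lemma poly2_eq_poly_map_poly:
  "poly2 p a b = poly (map_poly (\<lambda>c. poly c a) p) b"
  by (induct p) (simp_all add: poly2_def map_poly_pCons algebra_simps)

text \<open>A first coordinate can be chosen at which the leading coefficient in y survives; a
  nonzero univariate polynomial in y remains.\<close>

lemma poly2_nonzero:
  fixes p :: "'a::{idom,ring_char_0} poly poly"
  assumes "p \<noteq> 0"
  shows "\<exists>a b. poly2 p a b \<noteq> 0"
proof -
  have "\<exists>a. poly (lead_coeff p) a \<noteq> 0"
    using assms poly_all_0_iff_0[of "lead_coeff p"] by auto
  then obtain a where a: "poly (lead_coeff p) a \<noteq> 0" ..
  have "coeff (map_poly (\<lambda>c. poly c a) p) (degree p) \<noteq> 0"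
    using a by (simp add: coeff_map_poly)
  then have "map_poly (\<lambda>c. poly c a) p \<noteq> 0" by force
  then obtain b where "poly (map_poly (\<lambda>c. poly c a) p) b \<noteq> 0"
    using poly_all_0_iff_0 by blast
  then show ?thesis using poly2_eq_poly_map_poly by metis
qed

subsection \<open>Wronskians\<close>

text \<open>The leading coefficients of the two sides differ only by the factors
  \<open>degree f\<close> and \<open>degree g\<close>, which characteristic 0 keeps apart.\<close>

lemma wronskian_lead_coeff:
  fixes f g :: "'a::{idom,ring_char_0} poly"
  assumes "pderiv f * g = f * pderiv g" "f \<noteq> 0" "g \<noteq> 0"
  shows "degree f = degree g"
proof (cases "degree f = 0 \<or> degree g = 0")
  case True
  then show ?thesis
  proof
    assume "degree f = 0"
    then have "pderiv f = 0" by (simp add: pderiv_eq_0_iff)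
    then have "pderiv g = 0" using assms by simp
    then show ?thesis using \<open>degree f = 0\<close> by (simp add: pderiv_eq_0_iff)
  next
    assume "degree g = 0"
    then have "pderiv g = 0" by (simp add: pderiv_eq_0_iff)
    then have "pderiv f = 0" using assms by simp
    then show ?thesis using \<open>degree g = 0\<close> by (simp add: pderiv_eq_0_iff)
  qed
next
  case False
  then have f': "pderiv f \<noteq> 0" and g': "pderiv g \<noteq> 0" by (auto simp: pderiv_eq_0_iff)
  have lf: "lead_coeff (pderiv f) = of_nat (degree f) * lead_coeff f"
    and lg: "lead_coeff (pderiv g) = of_nat (degree g) * lead_coeff g"
    using False by (simp_all add: degree_pderiv coeff_pderiv)
  have "lead_coeff (pderiv f * g) = lead_coeff (f * pderiv g)" using assms by simp
  then have "lead_coeff f * lead_coeff g * of_nat (degree f) = lead_coeff f * lead_coeff g * of_nat (degree g)"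
    unfolding lead_coeff_mult lf lg by (simp add: mult_ac)
  then show ?thesis using assms by simp
qed

text \<open>The quotient f/g has derivative 0. To avoid quotients, a multiple of \<open>g\<close> is
  subtracted so that the term of degree \<open>degree g\<close> disappears; the difference satisfies
  the same relation, so the degree comparison forces it to be 0.\<close>

lemma wronskian_zero_imp_smult:
  fixes f g :: "'a::field_char_0 poly"
  assumes "pderiv f * g = f * pderiv g" "g \<noteq> 0"
  shows "\<exists>c. f = smult c g"
proof -
  define c where "c = coeff f (degree g) / lead_coeff g"
  define h where "h = f - smult c g"
  have "pderiv h * g = h * pderiv g"
    using assms(1) by (simp add: h_def pderiv_diff pderiv_smult algebra_simps)
  moreover have "coeff h (degree g) = 0"
    using assms(2) by (simp add: h_def c_def)
  ultimately have "h = 0"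
    using wronskian_lead_coeff[of h g] assms(2) by (metis leading_coeff_0_iff)
  then show ?thesis by (auto simp: h_def)
qed

text \<open>The y-relation says that f/g depends on x alone and so equals the quotient of the
  leading coefficients; the x-relation, read off at the top power of y, makes this quotient
  constant.\<close>

lemma wronskian2_zero_imp_smult:
  fixes f g :: "'a::field_char_0 poly poly"
  assumes y: "pderiv f * g = f * pderiv g" and x: "pderiv_inner f * g = f * pderiv_inner g" and "g \<noteq> 0"
  shows "\<exists>c. f = smult [:c:] g"
proof (cases "f = 0")
  case True
  then show ?thesis by (intro exI[of _ 0]) simp
next
  case False
  have deg: "degree f = degree g" using wronskian_lead_coeff[OF y False \<open>g \<noteq> 0\<close>] .
  \<comment> \<open>Degree bounds rather than equalities, since \<open>pderiv_inner\<close> can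
    annihilate the leading coefficient.\<close>
  have top: "coeff (p * q) (degree g + degree g) = coeff p (degree g) * coeff q (degree g)"
    if "degree p \<le> degree g" "degree q \<le> degree g" for p q :: "'a poly poly"
  proof -
    have "coeff (p * q) (degree g + degree g) = (\<Sum>i\<le>degree g + degree g. coeff p i * coeff q (degree g + degree g - i))"
      by (simp add: coeff_mult)
    also have "\<dots> = (\<Sum>i\<in>{degree g}. coeff p i * coeff q (degree g + degree g - i))"
    proof (rule sum.mono_neutral_right)
      show "\<forall>i\<in>{..degree g + degree g} - {degree g}. coeff p i * coeff q (degree g + degree g - i) = 0"
      proof
        fix i assume i: "i \<in> {..degree g + degree g} - {degree g}"
        show "coeff p i * coeff q (degree g + degree g - i) = 0"
        proof (cases "i > degree g")
          case True
          then show ?thesis using that by (simp add: coeff_eq_0)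
        next
          case False
          with i have "degree g + degree g - i > degree g" by auto
          then show ?thesis using that by (simp add: coeff_eq_0)
        qed
      qed
    qed auto
    finally show ?thesis by simp
  qed
  have le: "degree (pderiv_inner f) \<le> degree g" "degree (pderiv_inner g) \<le> degree g"
    using deg by (auto intro!: degree_le simp: coeff_eq_0)
  have "pderiv (lead_coeff f) * lead_coeff g = lead_coeff f * pderiv (lead_coeff g)"
    using arg_cong[OF x, of "\<lambda>p. coeff p (degree g + degree g)"] le deg by (simp add: top)
  then obtain c where c: "lead_coeff f = smult c (lead_coeff g)"
    using wronskian_zero_imp_smult[of "lead_coeff f" "lead_coeff g"] \<open>g \<noteq> 0\<close> by auto
  define h where "h = f - smult [:c:] g"
  have "pderiv h * g = h * pderiv g"
    using y by (simp add: h_def pderiv_diff pderiv_smult algebra_simps)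
  moreover have "coeff h (degree g) = 0"
    using c deg by (simp add: h_def)
  ultimately have "h = 0"
    using wronskian_lead_coeff[of h g] \<open>g \<noteq> 0\<close> by (metis leading_coeff_0_iff)
  then show ?thesis by (auto simp: h_def)
qed

subsection \<open>Exponential of a derivation\<close>

text \<open>If \<open>e\<close> is evaluation at a point, then \<open>exp_deriv D e p\<close> is the Taylor series of \<open>p\<close> along the
  integral curve of the vector field \<open>D\<close> through that point.\<close>

definition exp_deriv :: "('r \<Rightarrow> 'r) \<Rightarrow> ('r \<Rightarrow> 'k) \<Rightarrow> 'r \<Rightarrow> 'k::field_char_0 fps" where
  "exp_deriv D e p = Abs_fps (\<lambda>k. e ((D ^^ k) p) / fact k)"

lemma exp_deriv_nth_0 [simp]: "exp_deriv D e p $ 0 = e p"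
  by (simp add: exp_deriv_def)

lemma fps_deriv_exp_deriv: "fps_deriv (exp_deriv D e p) = exp_deriv D e (D p)"
proof (rule fps_ext)
  fix k
  have "e ((D ^^ k) (D p)) = e ((D ^^ Suc k) p)" by (simp only: funpow_Suc_right o_apply)
  then show "fps_deriv (exp_deriv D e p) $ k = exp_deriv D e (D p) $ k"
    by (simp add: exp_deriv_def del: of_nat_Suc funpow.simps)
qed

lemma exp_deriv_add:
  assumes "\<And>p q. D (p + q) = D p + D q" "\<And>p q. e (p + q) = e p + e q"
  shows "exp_deriv D e (p + q) = exp_deriv D e p + exp_deriv D e q"
proof -
  have "(D ^^ k) (p + q) = (D ^^ k) p + (D ^^ k) q" for k
    by (induct k) (simp_all add: assms)
  then show ?thesis by (simp add: fps_eq_iff exp_deriv_def assms add_divide_distrib)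
qed

text \<open>The higher Leibniz rule is avoided: both sides have the same constant term, and their
  derivatives agree in degree k by the induction hypothesis for the pairs \<open>D p\<close>,
  \<open>q\<close> and \<open>p\<close>, \<open>D q\<close>.\<close>

lemma exp_deriv_mult:
  fixes D :: "'r::comm_ring_1 \<Rightarrow> 'r" and e :: "'r \<Rightarrow> 'k::field_char_0"
  assumes D: "\<And>p q. D (p + q) = D p + D q" "\<And>p q. D (p * q) = D p * q + p * D q"
    and e: "\<And>p q. e (p + q) = e p + e q" "\<And>p q. e (p * q) = e p * e q"
  shows "exp_deriv D e (p * q) = exp_deriv D e p * exp_deriv D e q"
proof (rule fps_ext)
  fix k
  let ?E = "exp_deriv D e"
  show "?E (p * q) $ k = (?E p * ?E q) $ k"
  proof (induct k arbitrary: p q)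
    case 0
    then show ?case by (simp add: e)
  next
    case (Suc k)
    have "of_nat (Suc k) * ?E (p * q) $ Suc k = fps_deriv (?E (p * q)) $ k"
      by simp
    also have "\<dots> = ?E (D p * q) $ k + ?E (p * D q) $ k"
      by (simp add: fps_deriv_exp_deriv D exp_deriv_add[OF D(1) e(1)])
    also have "\<dots> = (?E p * fps_deriv (?E q) + fps_deriv (?E p) * ?E q) $ k"
      unfolding Suc fps_deriv_exp_deriv by (simp add: add.commute)
    also have "\<dots> = fps_deriv (?E p * ?E q) $ k"
      by (simp only: fps_deriv_mult)
    also have "\<dots> = of_nat (Suc k) * (?E p * ?E q) $ Suc k"
      by (simp only: fps_deriv_nth Suc_eq_plus1)
    finally show ?case by (metis mult_cancel_left of_nat_neq_0)
  qed
qed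

text \<open>Coefficient l + 1 of each series is determined by the coefficients up to l of all of
  them, so zero initial values propagate.\<close>

lemma fps_linear_ode_unique:
  fixes u :: "'i \<Rightarrow> 'k::field_char_0 fps"
  assumes ode: "\<And>i. i \<in> I \<Longrightarrow> fps_deriv (u i) = (\<Sum>j\<in>I. A i j * u j)"
    and init: "\<And>i. i \<in> I \<Longrightarrow> u i $ 0 = 0"
    and "i \<in> I"
  shows "u i = 0"
proof -
  have "\<forall>i\<in>I. u i $ k = 0" for k
  proof (induct k rule: less_induct)
    case (less k)
    show ?case
    proof (cases k)
      case 0
      then show ?thesis using init by simp
    next
      case (Suc l)
      show ?thesis
      proof
        fix i assume i: "i \<in> I"
        have "of_nat (Suc l) * u i $ Suc l = fps_deriv (u i) $ l" by simp
        also have "\<dots> = 0"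
          using less Suc by (simp add: ode[OF i] fps_sum_nth fps_mult_nth)
        finally show "u i $ k = 0" using Suc by (simp del: of_nat_Suc)
      qed
    qed
  qed
  then show ?thesis using \<open>i \<in> I\<close> by (auto simp: fps_eq_iff)
qed

subsection \<open>Prime ideals of plane curves\<close>

text \<open>\<open>[:[:- c, 1:]:]\<close> is x - c, constant in y; divisibility by it is tested by
  substituting x = c in every coefficient.\<close>

lemma linear_dvd_coeffs_iff:
  fixes p :: "'a::idom poly poly"
  shows "[:[:- c, 1:]:] dvd p \<longleftrightarrow> map_poly (\<lambda>q. poly q c) p = 0"
  by (simp add: const_poly_dvd_iff poly_eq_0_iff_dvd [symmetric] poly_eq_iff coeff_map_poly)

lemma map_poly_eval_mult:
  fixes p q :: "'a::comm_ring_1 poly poly"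
  shows "map_poly (\<lambda>q. poly q c) (p * q) = map_poly (\<lambda>q. poly q c) p * map_poly (\<lambda>q. poly q c) q"
  by (rule poly_eqI) (simp add: coeff_map_poly coeff_mult poly_sum)

lemma alg_closed_linear_factor:
  fixes s :: "'a::alg_closed_field poly"
  assumes "degree s > 0"
  obtains c s' where "s = [:- c, 1:] * s'" "degree s' < degree s" "s' \<noteq> 0"
proof -
  obtain c where "poly s c = 0" using alg_closed_imp_poly_has_root[OF assms] ..
  then obtain s' where s': "s = [:- c, 1:] * s'" by (auto simp: poly_eq_0_iff_dvd)
  with assms have "s' \<noteq> 0" by auto
  then have "degree s = degree [:- c, 1:] + degree s'" unfolding s' by (intro degree_mult_eq) auto
  with s' \<open>s' \<noteq> 0\<close> show ?thesis by (intro that[of c s']) auto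
qed

text \<open>A form of Gauss's lemma: \<open>s\<close> splits into factors x - c, and each of them
  can be cancelled because it does not divide \<open>b\<close>.\<close>

lemma dvd_of_dvd_smult:
  fixes b p :: "'a::alg_closed_field poly poly"
  assumes "s \<noteq> 0" "b dvd smult s p" "\<And>c. \<not> [:[:- c, 1:]:] dvd b"
  shows "b dvd p"
  using assms(1,2)
proof (induct "degree s" arbitrary: s rule: less_induct)
  case less
  show ?case
  proof (cases "degree s = 0")
    case True
    then obtain c where "s = [:c:]" by (rule degree_eq_zeroE)
    then have "smult [:inverse c:] (smult s p) = p" using less.prems by (simp add: one_pCons [symmetric])
    then show ?thesis using dvd_smult[OF less.prems(2), of "[:inverse c:]"] by simp
  next
    case False
    then obtain c s' where s': "s = [:- c, 1:] * s'" "degree s' < degree s" "s' \<noteq> 0"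
      using alg_closed_linear_factor[of s] by (metis gr0I)
    obtain q where q: "smult s p = b * q" using less.prems by (auto elim: dvdE)
    have "map_poly (\<lambda>q. poly q c) (smult s p) = 0"
      by (rule poly_eqI) (simp add: coeff_map_poly s')
    then have "map_poly (\<lambda>q. poly q c) q = 0"
      using assms(3)[of c] unfolding q map_poly_eval_mult by (simp add: linear_dvd_coeffs_iff)
    then obtain q' where q': "q = [:[:- c, 1:]:] * q'"
      by (auto simp: linear_dvd_coeffs_iff [symmetric])
    have "smult [:- c, 1:] (smult s' p) = smult [:- c, 1:] (b * q')"
      using q unfolding s' q' by (simp add: smult_smult)
    then have "smult s' p = b * q'"
      by (metis one_neq_zero pCons_eq_0_iff smult_cancel)
    then show ?thesis using less.hyps s' by (metis dvd_triv_left)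
  qed
qed

text \<open>Models evaluation along a curve germ. The kernel is prime because the target is a
  domain; \<open>nonconst\<close> says that it never contains both x - c and y - d, so it is not the
  ideal of a point.\<close>

locale plane_curve_hom =
  fixes E :: "'k::{alg_closed_field,field_char_0} poly poly \<Rightarrow> 'r::idom"
  assumes add: "E (p + q) = E p + E q" and mult: "E (p * q) = E p * E q" and one: "E 1 = 1"
    and nonconst: "E [:[:- c, 1:]:] \<noteq> 0 \<or> E [:[:- d:], 1:] \<noteq> 0"
begin

lemma zero: "E 0 = 0" using add[of 0 0] by (metis add_0 add_cancel_right_left)

lemma minus: "E (p - q) = E p - E q" using add[of "p - q" q] by (simp add: algebra_simps)

lemma const: "c \<noteq> 0 \<Longrightarrow> E [:[:c:]:] \<noteq> 0"
proof
  assume "c \<noteq> 0" "E [:[:c:]:] = 0"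
  moreover have "E ([:[:c:]:] * [:[:inverse c:]:]) = E [:[:c:]:] * E [:[:inverse c:]:]" by (rule mult)
  ultimately show False using one by (simp add: one_pCons)
qed

text \<open>\<open>map_poly (\<lambda>c. [:c:]) s\<close> is s(y), which splits into factors y - d
  outside the prime kernel.\<close>

lemma outer_kernel:
  assumes "\<And>d. E [:[:- d:], 1:] \<noteq> 0" and "s \<noteq> 0"
  shows "E (map_poly (\<lambda>c. [:c:]) s) \<noteq> 0"
  using assms(2)
proof (induct "degree s" arbitrary: s rule: less_induct)
  case less
  show ?case
  proof (cases "degree s = 0")
    case True
    then obtain c where "s = [:c:]" by (rule degree_eq_zeroE)
    then show ?thesis using less.prems const by (simp add: map_poly_pCons)
  next
    case False
    then obtain c s' where s': "s = [:- c, 1:] * s'" "degree s' < degree s" "s' \<noteq> 0"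
      using alg_closed_linear_factor[of s] by (metis gr0I)
    have "map_poly (\<lambda>c. [:c:]) s = [:[:- c:], 1:] * map_poly (\<lambda>c. [:c:]) s'"
      by (rule poly_eqI) (simp add: s' coeff_map_poly coeff_pCons split: nat.split)
    then have "E (map_poly (\<lambda>c. [:c:]) s) = E [:[:- c:], 1:] * E (map_poly (\<lambda>c. [:c:]) s')"
      by (simp only: mult)
    then show ?thesis using less.hyps[of s'] s' assms(1)[of c] by simp
  qed
qed

lemma inner_kernel:
  assumes "\<And>c. E [:[:- c, 1:]:] \<noteq> 0" and "s \<noteq> 0"
  shows "E [:s:] \<noteq> 0"
  using assms(2)
proof (induct "degree s" arbitrary: s rule: less_induct)
  case less
  show ?case
  proof (cases "degree s = 0")
    case True
    then obtain c where "s = [:c:]" by (rule degree_eq_zeroE)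
    then show ?thesis using less.prems const by simp
  next
    case False
    then obtain c s' where s': "s = [:- c, 1:] * s'" "degree s' < degree s" "s' \<noteq> 0"
      using alg_closed_linear_factor[of s] by (metis gr0I)
    have "[:s:] = [:[:- c, 1:]:] * [:s':]" by (simp add: s')
    then have "E [:s:] = E [:[:- c, 1:]:] * E [:s':]" by (simp only: mult)
    then show ?thesis using less.hyps[of s'] s' assms(1)[of c] by simp
  qed
qed

text \<open>A nonzero prime of K[x,y] that is not the ideal of a point is principal. If it contains
  some x - c, then modulo x - c only polynomials in y remain. Otherwise it contains no nonzero
  polynomial in x, and pseudo-division by an element of least y-degree works up to a factor in
  x.\<close>

lemma kernel_principal:
  assumes "E F = 0" "F \<noteq> 0"
  shows "\<exists>b. E b = 0 \<and> (\<forall>p. E p = 0 \<longrightarrow> b dvd p) \<and> (E (pderiv b) \<noteq> 0 \<or> E (pderiv_inner b) \<noteq> 0)"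
proof (cases "\<exists>c. E [:[:- c, 1:]:] = 0")
  case True
  then obtain c where c: "E [:[:- c, 1:]:] = 0" ..
  then have y: "E [:[:- d:], 1:] \<noteq> 0" for d using nonconst by blast
  have "[:[:- c, 1:]:] dvd p" if p: "E p = 0" for p
  proof -
    define s where "s = map_poly (\<lambda>q. poly q c) p"
    have "map_poly (\<lambda>q. poly q c) (p - map_poly (\<lambda>c. [:c:]) s) = 0"
      by (rule poly_eqI) (simp add: s_def coeff_map_poly)
    then have "[:[:- c, 1:]:] dvd p - map_poly (\<lambda>c. [:c:]) s"
      by (simp add: linear_dvd_coeffs_iff)
    then obtain r where "p - map_poly (\<lambda>c. [:c:]) s = [:[:- c, 1:]:] * r" by (rule dvdE)
    then have "E (p - map_poly (\<lambda>c. [:c:]) s) = 0" by (simp only: mult c mult_zero_left)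
    then have "s = 0" using p outer_kernel[OF y, of s] by (auto simp: minus)
    then show ?thesis by (simp add: linear_dvd_coeffs_iff s_def)
  qed
  moreover have "pderiv_inner [:[:- c, 1:]:] = 1"
    by (rule poly_eqI) (simp add: coeff_pCons pderiv_pCons one_pCons split: nat.split)
  ultimately show ?thesis using c one by (intro exI[of _ "[:[:- c, 1:]:]"]) simp
next
  case False
  then have x: "E [:[:- c, 1:]:] \<noteq> 0" for c by blast
  obtain b0 where b0: "E b0 = 0 \<and> b0 \<noteq> 0"
    and deg: "\<And>p. E p = 0 \<and> p \<noteq> 0 \<Longrightarrow> degree b0 \<le> degree p"
    using ex_has_least_nat[of "\<lambda>p. E p = 0 \<and> p \<noteq> 0" F degree] assms by blast
  \<comment> \<open>Least y-degree alone still allows factors depending on x only; the second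
    minimization, over the degree of the leading coefficient, excludes them.\<close>
  obtain b where b: "E b = 0 \<and> b \<noteq> 0 \<and> degree b = degree b0"
    and lead: "\<And>p. E p = 0 \<and> p \<noteq> 0 \<and> degree p = degree b0 \<Longrightarrow>
      degree (lead_coeff b) \<le> degree (lead_coeff p)"
    using ex_has_least_nat[of "\<lambda>p. E p = 0 \<and> p \<noteq> 0 \<and> degree p = degree b0" b0
        "\<lambda>p. degree (lead_coeff p)"] b0 by blast
  have primitive: "\<not> [:[:- c, 1:]:] dvd b" for c
  proof
    assume "[:[:- c, 1:]:] dvd b"
    then obtain b' where b': "b = [:[:- c, 1:]:] * b'" by (auto elim: dvdE)
    moreover have "E ([:[:- c, 1:]:] * b') = E [:[:- c, 1:]:] * E b'" by (rule mult)
    ultimately have "E b' = 0" "b' \<noteq> 0" using b x by auto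
    moreover have "degree b' = degree b0" using b by (simp add: b')
    ultimately have "degree (lead_coeff b) \<le> degree (lead_coeff b')" using lead by blast
    moreover have "lead_coeff b = [:- c, 1:] * lead_coeff b'" by (simp add: b')
    then have "degree (lead_coeff b) = degree [:- c, 1:] + degree (lead_coeff b')"
      using \<open>b' \<noteq> 0\<close> by (metis degree_mult_eq leading_coeff_0_iff one_neq_zero pCons_eq_0_iff)
    ultimately show False by simp
  qed
  have "b dvd p" if p: "E p = 0" for p
  proof -
    obtain q r where qr: "pseudo_divmod p b = (q, r)" by fastforce
    then have div: "smult (lead_coeff b ^ (Suc (degree p) - degree b)) p = b * q + r"
      and r: "r = 0 \<or> degree r < degree b"
      using pseudo_divmod[of b p q r] b by auto
    define s where "s = lead_coeff b ^ (Suc (degree p) - degree b)"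
    have "E (smult s p) = 0" using p mult[of "[:s:]" p] by simp
    then have "E r = 0" using arg_cong[OF div, of E] b by (simp add: s_def add mult)
    then have "r = 0" using r deg[of r] b by (metis leD)
    then have "b dvd smult s p" using div by (simp add: s_def)
    moreover have "s \<noteq> 0" using b unfolding s_def by (metis leading_coeff_0_iff power_not_zero)
    ultimately show ?thesis using dvd_of_dvd_smult[of s b p] primitive by simp
  qed
  \<comment> \<open>In characteristic 0 the derivative is nonzero and of smaller y-degree, so
    minimality keeps it out of the kernel.\<close>
  moreover have "E (pderiv b) \<noteq> 0"
  proof
    assume E: "E (pderiv b) = 0"
    have "degree b \<noteq> 0"
    proof
      assume "degree b = 0"
      then obtain s where "b = [:s:]" by (rule degree_eq_zeroE)
      then show False using inner_kernel[OF x, of s] b by simp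
    qed
    then have "pderiv b \<noteq> 0" "degree (pderiv b) < degree b"
      by (simp_all add: pderiv_eq_0_iff degree_pderiv)
    then show False using deg[of "pderiv b"] E b by simp
  qed
  ultimately show ?thesis using b by blast
qed

text \<open>For F = b k with E b = 0 the product rule leaves the image of each partial derivative of
  b times E k. One of these images is nonzero, so k lies in the kernel as well.\<close>

lemma singular_imp_square:
  assumes "F \<noteq> 0" "E F = 0" "E (pderiv F) = 0" "E (pderiv_inner F) = 0"
  shows "\<exists>b k. F = b * k \<and> b dvd k \<and> E b = 0"
proof -
  obtain b where b: "E b = 0" "\<And>p. E p = 0 \<Longrightarrow> b dvd p" "E (pderiv b) \<noteq> 0 \<or> E (pderiv_inner b) \<noteq> 0"
    using kernel_principal[OF assms(2,1)] by blast
  obtain k where k: "F = b * k" using b(2)[OF assms(2)] by (auto elim: dvdE)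
  have "E (pderiv b) * E k = 0" "E (pderiv_inner b) * E k = 0"
    using assms(3,4) b(1) by (auto simp: k pderiv_mult pderiv_inner_mult add mult)
  then have "E k = 0" using b(3) by auto
  then show ?thesis using k b by blast
qed

end

subsection \<open>Jacobian determinants\<close>

lemma pderiv_inner_pCons [simp]: "pderiv_inner (pCons a p) = pCons (pderiv a) (pderiv_inner p)"
  by (rule poly_eqI) (simp add: coeff_pCons split: nat.split)

lemma pderiv_inner_0 [simp]: "pderiv_inner 0 = 0"
  by (simp add: poly_eq_iff)

lemma pderiv_inner_1 [simp]: "pderiv_inner 1 = 0"
  by (simp only: one_pCons pderiv_inner_pCons) simp

text \<open>The determinant with rows (f, f_x, f_y), (g, g_x, g_y), (h, h_x, h_y). Where it is
  nonzero, no nontrivial combination of f, g, h vanishes together with both partial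
  derivatives.\<close>

definition jacobian3 :: "'k::idom poly poly \<Rightarrow> 'k poly poly \<Rightarrow> 'k poly poly \<Rightarrow> 'k poly poly" where
  "jacobian3 f g h = f * (pderiv_inner g * pderiv h - pderiv g * pderiv_inner h)
     - pderiv_inner f * (g * pderiv h - pderiv g * h)
     + pderiv f * (g * pderiv_inner h - pderiv_inner g * h)"

text \<open>Multiplication by \<open>k\<close> acts on the triples (f, f_x, f_y) by a triangular
  matrix with diagonal \<open>k\<close>, and the triples of 1, x, y have determinant 1.\<close>

lemma jacobian3_multiples:
  fixes k :: "'k::idom poly poly"
  shows "jacobian3 k ([:[:0, 1:]:] * k) ([:0, 1:] * k) = k ^ 3"
proof -
  have x: "pderiv [:[:0, 1:] :: 'k poly:] = 0" "pderiv_inner [:[:0, 1:] :: 'k poly:] = 1"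
    by (simp_all add: pderiv_pCons one_pCons)
  have y: "pderiv [:0, 1 :: 'k poly:] = 1" "pderiv_inner [:0, 1 :: 'k poly:] = 0"
    by (simp_all add: pderiv_pCons one_pCons)
  define X where "X = [:[:0, 1 :: 'k:]:]"
  define Y where "Y = [:0, 1 :: 'k poly:]"
  show ?thesis
    unfolding jacobian3_def pderiv_mult pderiv_inner_mult X_def[symmetric] Y_def[symmetric]
      x[folded X_def] y[folded Y_def]
    by (simp add: power3_eq_cube algebra_simps)
qed

text \<open>Up to sign, the weights are the cross product of columns 0 and 1: orthogonal to both,
  and giving the determinant when paired with column 2. In the application column 0 holds the values
  and column 1 the derivative whose minor is nonzero.\<close>

lemma minors_orthogonal:
  fixes f0 f1 f2 g0 g1 g2 h0 h1 h2 :: "'a::comm_ring_1"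
  shows "(g1 * h0 - g0 * h1) * f0 + (h1 * f0 - h0 * f1) * g0 + (f1 * g0 - f0 * g1) * h0 = 0"
    and "(g1 * h0 - g0 * h1) * f1 + (h1 * f0 - h0 * f1) * g1 + (f1 * g0 - f0 * g1) * h1 = 0"
    and "(g1 * h0 - g0 * h1) * f2 + (h1 * f0 - h0 * f1) * g2 + (f1 * g0 - f0 * g1) * h2
      = f0 * (g2 * h1 - g1 * h2) - f2 * (g0 * h1 - g1 * h0) + f1 * (g0 * h2 - g2 * h0)"
  by (simp_all add: algebra_simps)

text \<open>The zero of \<open>b\<close> in the conclusion serves to make \<open>b\<close>
  non-constant.\<close>

lemma jacobian_zero_imp_square:
  fixes f g h :: "'k::{alg_closed_field,field_char_0} poly poly"
  assumes J: "jacobian3 f g h = 0"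
    and indep: "\<And>\<alpha> \<beta> \<gamma>. [:[:\<alpha>:]:] * f + [:[:\<beta>:]:] * g + [:[:\<gamma>:]:] * h = 0 \<Longrightarrow> \<alpha> = 0 \<and> \<beta> = 0 \<and> \<gamma> = 0"
  shows "\<exists>\<alpha> \<beta> \<gamma> b k x y. [:[:\<alpha>:]:] * f + [:[:\<beta>:]:] * g + [:[:\<gamma>:]:] * h = b * k \<and> b * k \<noteq> 0 \<and>
    b dvd k \<and> poly2 b x y = 0"
proof -
  \<comment> \<open>Cofactors of the row of h: the determinant is a h_x + b h_y - t h. The same
    expansion with f or g repeated is 0, so \<open>D f = t * f\<close> and
    \<open>D g = t * g\<close> hold identically, and \<open>D h = t * h\<close> expresses the
    hypothesis.\<close>
  define a where "a = pderiv f * g - f * pderiv g"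
  define b where "b = - (pderiv_inner f * g - f * pderiv_inner g)"
  define t where "t = pderiv f * pderiv_inner g - pderiv_inner f * pderiv g"
  have "g \<noteq> 0" using indep[of 0 1 0] by auto
  have "a \<noteq> 0 \<or> b \<noteq> 0"
  proof (rule ccontr)
    assume "\<not> (a \<noteq> 0 \<or> b \<noteq> 0)"
    then obtain c where "f = smult [:c:] g"
      using wronskian2_zero_imp_smult[of f g] \<open>g \<noteq> 0\<close> by (auto simp: a_def b_def)
    then show False using indep[of 1 "- c" 0] by (simp add: one_pCons [symmetric] smult_add_left [symmetric])
  qed
  \<comment> \<open>The vector field does not vanish here, so its integral curve through this point
    is not constant.\<close>
  then obtain x y where P: "poly2 a x y \<noteq> 0 \<or> poly2 b x y \<noteq> 0"
    using poly2_nonzero by blast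
  define D where "D p = a * pderiv_inner p + b * pderiv p" for p
  define E where "E = exp_deriv D (\<lambda>p. poly2 p x y)"
  have D_add: "D (p + q) = D p + D q" for p q
    by (simp add: D_def pderiv_add pderiv_inner_add algebra_simps)
  have D_mult: "D (p * q) = D p * q + p * D q" for p q
    by (simp add: D_def pderiv_mult pderiv_inner_mult algebra_simps)
  have E_add: "E (p + q) = E p + E q" for p q
    unfolding E_def by (rule exp_deriv_add) (simp_all add: D_add)
  have E_mult: "E (p * q) = E p * E q" for p q
    unfolding E_def by (rule exp_deriv_mult) (simp_all add: D_add D_mult)
  have E_0: "E p $ 0 = poly2 p x y" for p by (simp add: E_def)
  have E_deriv: "fps_deriv (E p) = E (D p)" for p by (simp add: E_def fps_deriv_exp_deriv)
  have D_const: "D [:[:c:]:] = 0" for c by (simp add: D_def pderiv_pCons )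
  interpret plane_curve_hom E
  proof
    have "D 1 = 0" using D_const[of 1] by (simp add: one_pCons)
    then have "(D ^^ Suc k) 1 = 0" for k
    proof (induct k)
      case (Suc k)
      then show ?case using D_add[of 0 0] by simp
    qed simp
    then show "E 1 = 1"
      by (auto simp: fps_eq_iff E_def exp_deriv_def gr0_conv_Suc)
    show "E [:[:- c, 1:]:] \<noteq> 0 \<or> E [:[:- d:], 1:] \<noteq> 0" for c d
    proof (rule ccontr)
      assume "\<not> ?thesis"
      then have "E (D [:[:- c, 1:]:]) $ 0 = 0" "E (D [:[:- d:], 1:]) $ 0 = 0"
        by (auto simp flip: E_deriv)
      moreover have "D [:[:- c, 1:]:] = a" "D [:[:- d:], 1:] = b"
        by (simp_all add: D_def pderiv_pCons one_pCons [symmetric])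
      ultimately show False using P by (simp add: E_0)
    qed
  qed (fact E_add E_mult)+
  have Df: "D f = t * f" by (simp add: D_def a_def b_def t_def algebra_simps)
  have Dg: "D g = t * g" by (simp add: D_def a_def b_def t_def algebra_simps)
  have Dh: "D h = t * h"
  proof -
    have "D h - t * h = jacobian3 f g h"
      by (simp add: D_def a_def b_def t_def jacobian3_def algebra_simps)
    then show ?thesis using J by simp
  qed
  \<comment> \<open>The singular matrix at the point has a kernel vector made of minors. Its last
    entry \<gamma> is the value of a or of - b there, hence nonzero, and independence then gives F
    \<noteq> 0.\<close>
  obtain \<alpha> \<beta> \<gamma> where nz: "\<gamma> \<noteq> 0"
    and sing: "\<alpha> * poly2 f x y + \<beta> * poly2 g x y + \<gamma> * poly2 h x y = 0"
      "\<alpha> * poly2 (pderiv f) x y + \<beta> * poly2 (pderiv g) x y + \<gamma> * poly2 (pderiv h) x y = 0"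
      "\<alpha> * poly2 (pderiv_inner f) x y + \<beta> * poly2 (pderiv_inner g) x y + \<gamma> * poly2 (pderiv_inner h) x y = 0"
  proof -
    let ?v = "\<lambda>p. poly2 p x y" and ?y = "\<lambda>p. poly2 (pderiv p) x y" and ?x = "\<lambda>p. poly2 (pderiv_inner p) x y"
    have J': "?v f * (?x g * ?y h - ?y g * ?x h) - ?x f * (?v g * ?y h - ?y g * ?v h)
        + ?y f * (?v g * ?x h - ?x g * ?v h) = 0"
      using arg_cong[OF J, of "\<lambda>p. poly2 p x y"] by (simp add: jacobian3_def)
    show ?thesis
    proof (cases "poly2 a x y = 0")
      case False
      have "?y f * ?v g - ?v f * ?y g \<noteq> 0" using False by (simp add: a_def)
      moreover have "(?y g * ?v h - ?v g * ?y h) * ?x f + (?y h * ?v f - ?v h * ?y f) * ?x g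
          + (?y f * ?v g - ?v f * ?y g) * ?x h = 0"
        unfolding minors_orthogonal(3) by (rule J')
      ultimately show ?thesis using that minors_orthogonal(1,2) by blast
    next
      case True
      then have "?x f * ?v g - ?v f * ?x g \<noteq> 0" using P by (simp add: b_def)
      moreover have "(?x g * ?v h - ?v g * ?x h) * ?y f + (?x h * ?v f - ?v h * ?x f) * ?y g
          + (?x f * ?v g - ?v f * ?x g) * ?y h = 0"
        unfolding minors_orthogonal(3) using J' by (simp add: algebra_simps)
      ultimately show ?thesis using that minors_orthogonal(1,2) by blast
    qed
  qed
  define F where "F = [:[:\<alpha>:]:] * f + [:[:\<beta>:]:] * g + [:[:\<gamma>:]:] * h"
  have "F \<noteq> 0" using nz indep[of \<alpha> \<beta> \<gamma>] by (auto simp: F_def)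
  have DF: "D F = t * F"
    unfolding F_def D_add D_mult D_const Df Dg Dh by (simp add: algebra_simps)
  have Fy: "pderiv F = [:[:\<alpha>:]:] * pderiv f + [:[:\<beta>:]:] * pderiv g + [:[:\<gamma>:]:] * pderiv h"
    by (simp add: F_def pderiv_add pderiv_smult)
  have const: "pderiv_inner [:[:c:]:] = 0" for c :: 'k
    by (simp add: pderiv_pCons)
  have Fx: "pderiv_inner F = [:[:\<alpha>:]:] * pderiv_inner f + [:[:\<beta>:]:] * pderiv_inner g + [:[:\<gamma>:]:] * pderiv_inner h"
    unfolding F_def pderiv_inner_add pderiv_inner_mult const by simp
  have van: "poly2 F x y = 0" "poly2 (pderiv_inner F) x y = 0" "poly2 (pderiv F) x y = 0"
    unfolding Fx Fy using sing by (simp_all add: F_def del: mult_pCons_left)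
  \<comment> \<open>Differentiating D F = t F shows that F and its partial derivatives satisfy a
    linear system along the curve, with matrix \<open>A\<close>; the entries involving a and b come
    from commuting the partial derivatives with D.\<close>
  define u where "u i = (if i = 0 then F else if i = 1 then pderiv_inner F else pderiv F)" for i :: nat
  define A where "A i j = (if i = 0 then (if j = 0 then E t else 0)
     else if i = 1 then (if j = 0 then E (pderiv_inner t) else if j = 1 then E t - E (pderiv_inner a) else - E (pderiv_inner b))
     else (if j = 0 then E (pderiv t) else if j = 1 then - E (pderiv a) else E t - E (pderiv b)))" for i j :: nat
  have Dx: "D (pderiv_inner F) = pderiv_inner t * F + (t - pderiv_inner a) * pderiv_inner F + (- pderiv_inner b) * pderiv F"
    using arg_cong[OF DF, of pderiv_inner]
    by (simp add: D_def pderiv_inner_add pderiv_inner_mult pderiv_inner_pderiv algebra_simps)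
  have Dy: "D (pderiv F) = pderiv t * F + (- pderiv a) * pderiv_inner F + (t - pderiv b) * pderiv F"
    using arg_cong[OF DF, of pderiv]
    by (simp add: D_def pderiv_add pderiv_mult pderiv_inner_pderiv algebra_simps)
  have E_uminus: "E (- p) = - E p" for p using minus[of 0 p] zero by simp
  have sum3: "(\<Sum>j\<in>{0,1,2::nat}. c j) = c 0 + c 1 + c 2" for c :: "nat \<Rightarrow> 'k fps" by simp
  have "E (u i) = 0" if "i \<in> {0, 1, 2}" for i
  proof (rule fps_linear_ode_unique[where I = "{0, 1, 2}" and u = "\<lambda>i. E (u i)" and A = A, OF _ _ that])
    fix i :: nat assume i: "i \<in> {0, 1, 2}"
    show "fps_deriv (E (u i)) = (\<Sum>j\<in>{0, 1, 2}. A i j * E (u j))"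
      unfolding E_deriv sum3 using i by (auto simp: u_def A_def DF Dx Dy E_add E_mult E_uminus minus)
    show "E (u i) $ 0 = 0"
      using i van by (auto simp: E_0 u_def)
  qed
  from this[of 0] this[of 1] this[of 2] have "E F = 0" "E (pderiv_inner F) = 0" "E (pderiv F) = 0"
    by (simp_all add: u_def)
  then obtain c k where "F = c * k" "c dvd k" "E c = 0"
    using singular_imp_square[OF \<open>F \<noteq> 0\<close>] by blast
  moreover have "poly2 c x y = 0" using \<open>E c = 0\<close> by (simp flip: E_0)
  ultimately show ?thesis using \<open>F \<noteq> 0\<close> unfolding F_def by metis
qed

subsection \<open>The total degree\<close>

lemma map_poly_hom_add:
  assumes "h 0 = 0" "\<And>a b. h (a + b) = h a + h b"
  shows "map_poly h (p + q) = map_poly h p + map_poly h q"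
  by (rule poly_eqI) (simp add: coeff_map_poly assms)

lemma map_poly_hom_mult:
  fixes h :: "'a::comm_ring_1 \<Rightarrow> 'b::comm_ring_1"
  assumes "h 0 = 0" "\<And>a b. h (a + b) = h a + h b" "\<And>a b. h (a * b) = h a * h b"
  shows "map_poly h (p * q) = map_poly h p * map_poly h q"
proof (rule poly_eqI)
  fix n
  have "h (\<Sum>i\<le>n. coeff p i * coeff q (n - i)) = (\<Sum>i\<le>n. h (coeff p i) * h (coeff q (n - i)))"
    using sum_comp_morphism[of h "\<lambda>i. coeff p i * coeff q (n - i)" "{..n}"] assms by (simp add: o_def)
  then show "coeff (map_poly h (p * q)) n = coeff (map_poly h p * map_poly h q) n"
    by (simp add: coeff_map_poly assms coeff_mult)
qed

text \<open>The substitution \<open>x \<mapsto> s\<close>, \<open>y \<mapsto> x * s\<close> turns the total degree into the degree in \<open>s\<close>.\<close>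

definition blowup :: "'a::idom poly poly \<Rightarrow> 'a poly poly" where
  "blowup p = poly (map_poly (map_poly (\<lambda>c. [:c:])) p) [:0, [:0, 1:]:]"

lemma blowup_add: "blowup (p + q) = blowup p + blowup q"
  by (simp add: blowup_def map_poly_hom_add)

lemma blowup_mult: "blowup (p * q) = blowup p * blowup q"
  by (simp add: blowup_def map_poly_hom_add map_poly_hom_mult)

lemma blowup_0 [simp]: "blowup 0 = 0" and blowup_1 [simp]: "blowup 1 = 1"
  and blowup_const [simp]: "blowup [:[:c:]:] = [:[:c:]:]"
  and blowup_x: "blowup [:[:0, 1:]:] = [:0, 1:]"
  and blowup_y: "blowup [:0, 1:] = [:0, [:0, 1:]:]"
  by (simp_all add: blowup_def map_poly_pCons one_pCons)

text \<open>The monomial x^i y^j becomes s^(i+j) x^j, so no two monomials collide.\<close>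

lemma coeff_blowup:
  "coeff (coeff (blowup p) k) j = (if j \<le> k then coeff (coeff p j) (k - j) else 0)"
proof -
  let ?q = "map_poly (map_poly (\<lambda>c. [:c:])) p"
  have mon: "[:0, [:0, 1 :: 'a:]:] ^ i = monom (monom 1 i) i" for i
  proof (induct i)
    case (Suc i)
    have "[:0, [:0, 1 :: 'a:]:] = monom (monom 1 1) 1" by (simp add: monom_altdef one_pCons)
    with Suc show ?case by (simp add: mult_monom)
  qed (simp add: one_pCons monom_0)
  have "blowup p = (\<Sum>i\<le>degree ?q. coeff ?q i * monom (monom 1 i) i)"
    unfolding blowup_def poly_altdef mon ..
  also have "\<dots> = (\<Sum>i\<le>degree ?q. monom (monom 1 i) i * map_poly (\<lambda>c. [:c:]) (coeff p i))"
    by (simp add: coeff_map_poly mult.commute)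
  finally have "coeff (coeff (blowup p) k) j =
      (\<Sum>i\<le>degree ?q. if i \<le> k \<and> i = j then coeff (coeff p i) (k - i) else 0)"
    by (auto simp: coeff_sum coeff_monom_mult coeff_map_poly monom_0 [symmetric] mult_monom
        intro!: sum.cong)
  also have "\<dots> = (if j \<le> k then coeff (coeff p j) (k - j) else 0)"
  proof (cases "j \<le> degree ?q")
    case False
    then have "coeff ?q j = 0" by (simp add: coeff_eq_0)
    then have "coeff (map_poly (\<lambda>c. [:c:]) (coeff p j)) i = 0" for i by (simp add: coeff_map_poly)
    then have "coeff (coeff p j) i = 0" for i by (simp add: coeff_map_poly)
    with False show ?thesis by (auto intro!: sum.neutral)
  qed (simp add: sum.delta if_if_eq_conj [symmetric] conj_commute cong: if_cong)
  finally show ?thesis .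
qed

text \<open>Read off after \<open>blowup\<close> so that additivity on products is inherited from
  \<open>degree\<close> over a domain.\<close>

definition tdeg :: "'a::idom poly poly \<Rightarrow> nat" where
  "tdeg p = degree (blowup p)"

lemma blowup_eq_0_iff [simp]: "blowup p = 0 \<longleftrightarrow> p = 0"
proof
  assume "blowup p = 0"
  then have "coeff (coeff p j) i = 0" for i j
    using coeff_blowup[of p "i + j" j] by simp
  then show "p = 0" by (simp add: poly_eq_iff)
qed simp

lemma tdeg_mult: "p \<noteq> 0 \<Longrightarrow> q \<noteq> 0 \<Longrightarrow> tdeg (p * q) = tdeg p + tdeg q"
  by (simp add: tdeg_def blowup_mult degree_mult_eq)

lemma coeff_gt_tdeg: "tdeg p < i + j \<Longrightarrow> coeff (coeff p j) i = 0"
  using coeff_blowup[of p "i + j" j] by (simp add: tdeg_def coeff_eq_0)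

lemma tdeg_eq_0_imp_const: "tdeg p = 0 \<Longrightarrow> \<exists>c. p = [:[:c:]:]"
proof (intro exI poly_eqI)
  fix i j assume "tdeg p = 0"
  then show "coeff (coeff p j) i = coeff (coeff [:[:coeff (coeff p 0) 0:]:] j) i"
    using coeff_gt_tdeg[of p i j] by (cases i; cases j) simp_all
qed

lemma jacobian3_nonzero_exists:
  fixes A :: "('k::{alg_closed_field,field_char_0} \<times> 'k) set" and d :: nat
  defines "V \<equiv> {p. tdeg p \<le> d \<and> (\<forall>(x, y)\<in>A. poly2 p x y = 0)}"
  assumes V: "f \<in> V" "g \<in> V" "h \<in> V"
    and indep: "\<And>\<alpha> \<beta> \<gamma>. [:[:\<alpha>:]:] * f + [:[:\<beta>:]:] * g + [:[:\<gamma>:]:] * h = 0 \<Longrightarrow> \<alpha> = 0 \<and> \<beta> = 0 \<and> \<gamma> = 0"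
  shows "\<exists>f\<in>V. \<exists>g\<in>V. \<exists>h\<in>V. jacobian3 f g h \<noteq> 0"
proof (cases "jacobian3 f g h = 0")
  case False
  then show ?thesis using V by blast
next
  case True
  obtain \<alpha> \<beta> \<gamma> b k x y where F: "[:[:\<alpha>:]:] * f + [:[:\<beta>:]:] * g + [:[:\<gamma>:]:] * h = b * k"
    "b * k \<noteq> 0" "b dvd k" "poly2 b x y = 0"
    using jacobian_zero_imp_square[OF True indep] by metis
  have add: "tdeg (p + q) \<le> d" if "tdeg p \<le> d" "tdeg q \<le> d" for p q :: "'k poly poly"
    using that by (simp add: tdeg_def blowup_add degree_add_le)
  have const: "tdeg ([:[:c:]:] * p) \<le> d" if "tdeg p \<le> d" for c :: 'k and p
    using that order_trans[OF degree_smult_le[of "[:c:]" "blowup p"]]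
    unfolding tdeg_def blowup_mult blowup_const by simp
  have deg: "tdeg (b * k) \<le> d"
    unfolding F(1) [symmetric] using V by (intro add const) (simp_all add: V_def)
  have van: "poly2 (b * k) u v = 0" if "(u, v) \<in> A" for u v
  proof -
    have "poly2 f u v = 0" "poly2 g u v = 0" "poly2 h u v = 0"
      using V that by (auto simp: V_def)
    then show ?thesis unfolding F(1) [symmetric] by (simp del: mult_pCons_left)
  qed
  have nz: "b \<noteq> 0" "k \<noteq> 0" using F by auto
  have "tdeg b \<noteq> 0"
  proof
    assume "tdeg b = 0"
    then obtain c where "b = [:[:c:]:]" using tdeg_eq_0_imp_const by blast
    then show False using F(4) nz by simp
  qed
  \<comment> \<open>The positive degree of \<open>b\<close> leaves room to multiply \<open>k\<close>
    by x or y within degree d.\<close>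
  then have deg_k: "tdeg k + 1 \<le> d" using deg nz by (simp add: tdeg_mult)
  have van_k: "poly2 k u v = 0" if "(u, v) \<in> A" for u v
    using van[OF that] F(3) by (auto elim!: dvdE)
  have "tdeg [:[:0, 1 :: 'k:]:] = 1" "tdeg [:0, 1 :: 'k poly:] = 1"
    by (simp_all add: tdeg_def blowup_x blowup_y)
  then have "k \<in> V" "[:[:0, 1:]:] * k \<in> V" "[:0, 1:] * k \<in> V"
    using deg_k van_k nz unfolding V_def by (auto simp: tdeg_mult simp del: mult_pCons_left)
  moreover have "jacobian3 k ([:[:0, 1:]:] * k) ([:0, 1:] * k) \<noteq> 0"
    unfolding jacobian3_multiples using nz by simp
  ultimately show ?thesis by blast
qed

section \<open>Linear algebra, and the given encoding of forms, points and ideals\<close>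

subsection \<open>Dimensions of subspaces\<close>

context vector_space
begin

text \<open>The finite spanning set \<open>B\<close> gives \<open>dim\<close> its meaning, since an
  infinite basis has cardinality 0.\<close>

lemma subspace_dim_less:
  assumes "V \<subseteq> span B" "finite B" "subspace W" "W \<subseteq> V" "v \<in> V" "v \<notin> W"
  shows "dim W < dim V"
proof -
  obtain C where C: "C \<subseteq> W" "independent C" "W \<subseteq> span C" "card C = dim W"
    by (rule basis_exists)
  have "span C \<subseteq> W" using C assms(3) by (simp add: span_minimal)
  then have ind: "independent (insert v C)"
    using assms(6) C(2) independent_insertI[of v C] by blast
  obtain E where E: "insert v C \<subseteq> E" "E \<subseteq> V" "independent E" "V \<subseteq> span E"
    using maximal_independent_subset_extend[of "insert v C" V] C(1) assms(4,5) ind by auto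
  have "finite E" using independent_span_bound[OF assms(2) E(3)] E(2) assms(1) by auto
  have "v \<notin> C" using assms(6) C(1) by auto
  then have "Suc (dim W) = card (insert v C)"
    using C(4) finite_subset[OF E(1) \<open>finite E\<close>] by simp
  also have "\<dots> \<le> card E" using E(1) \<open>finite E\<close> by (rule card_mono[rotated])
  also have "\<dots> = dim V" using basis_card_eq_dim[OF E(2,4,3)] .
  finally show ?thesis by simp
qed

lemma dim_le_of_subspace:
  assumes "V \<subseteq> span B" "finite B" "subspace W" "W \<subseteq> V"
  shows "dim W \<le> dim V"
proof (cases "W = V")
  case False
  then obtain v where "v \<in> V" "v \<notin> W" using assms(4) by blast
  then show ?thesis using subspace_dim_less[OF assms] by fastforce
qed simp

lemma dim_le_span_insert:
  assumes "V \<subseteq> span (insert v W)" "W \<subseteq> span B" "finite B"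
  shows "dim V \<le> dim W + 1"
proof -
  obtain C where C: "C \<subseteq> W" "independent C" "W \<subseteq> span C" "card C = dim W"
    by (rule basis_exists)
  have "finite C" using independent_span_bound[OF assms(3) C(2)] C(1) assms(2) by auto
  have "span (insert v W) \<subseteq> span (insert v C)"
    using C(3) span_mono[of C "insert v C"] by (intro span_minimal) (auto intro: span_base)
  then have "dim V \<le> card (insert v C)"
    using assms(1) \<open>finite C\<close> by (intro dim_le_card) auto
  also have "\<dots> \<le> dim W + 1" using C(4) card_insert_le_m1[of "Suc (card C)" C v] \<open>finite C\<close>
    by (simp add: card_insert_if)
  finally show ?thesis .
qed

text \<open>Each functional costs at most one dimension: a vector outside its kernel spans the space
  together with the kernel.\<close>

lemma dim_le_kernels:
  fixes \<phi> :: "'i \<Rightarrow> 'b \<Rightarrow> 'a"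
  assumes "finite I" "V \<subseteq> span B" "finite B" "subspace V"
    and add: "\<And>i x y. i \<in> I \<Longrightarrow> \<phi> i (x + y) = \<phi> i x + \<phi> i y"
    and scale: "\<And>i c x. i \<in> I \<Longrightarrow> \<phi> i (scale c x) = c * \<phi> i x"
  shows "subspace {v \<in> V. \<forall>i\<in>I. \<phi> i v = 0}" (is "?S I")
    and "dim V \<le> dim {v \<in> V. \<forall>i\<in>I. \<phi> i v = 0} + card I"
proof -
  have "subspace {v \<in> V. \<forall>i\<in>I. \<phi> i v = 0} \<and> dim V \<le> dim {v \<in> V. \<forall>i\<in>I. \<phi> i v = 0} + card I"
    using assms(1) add scale
  proof (induct I rule: finite_induct)
    case empty
    then show ?case using assms(4) by simp
  next
    case (insert i I)
    define W where "W = {v \<in> V. \<forall>i\<in>I. \<phi> i v = 0}"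
    define W' where "W' = {v \<in> V. \<forall>i\<in>insert i I. \<phi> i v = 0}"
    have W: "subspace W" "dim V \<le> dim W + card I"
      using insert by (auto simp: W_def)
    have i: "\<phi> i (x + y) = \<phi> i x + \<phi> i y" "\<phi> i (scale c x) = c * \<phi> i x" for x y c
      using insert by auto
    have zero: "\<phi> i 0 = 0" using i(1)[of 0 0] by (metis add_0 add_cancel_right_left)
    have W'_eq: "W' = {v \<in> W. \<phi> i v = 0}" by (auto simp: W_def W'_def)
    have sub: "subspace W'"
      using W(1) unfolding W'_eq subspace_def by (auto simp: i zero)
    have "dim W \<le> dim W' + 1"
    proof (cases "\<exists>w\<in>W. \<phi> i w \<noteq> 0")
      case False
      then have "W' = W" by (auto simp: W'_eq)
      then show ?thesis by simp
    next
      case True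
      then obtain w where w: "w \<in> W" "\<phi> i w \<noteq> 0" by blast
      have "v \<in> span (insert w W')" if v: "v \<in> W" for v
      proof -
        define c where "c = \<phi> i v / \<phi> i w"
        have "v - scale c w \<in> W" using W(1) v w by (simp add: subspace_diff subspace_scale)
        moreover have "\<phi> i (v - scale c w) = 0"
          using i(1)[of "v - scale c w" "scale c w"] w(2) by (simp add: i c_def)
        ultimately have "v - scale c w \<in> W'" by (simp add: W'_eq)
        then have "v - scale c w + scale c w \<in> span (insert w W')"
          by (intro span_add span_scale span_base) auto
        then show ?thesis by simp
      qed
      moreover have "W' \<subseteq> span B" using assms(2) by (auto simp: W'_def)
      ultimately show ?thesis using dim_le_span_insert[of W w W' B] assms(3) by blast
    qed
    then show ?case using W(2) sub insert(1,2) unfolding W'_def by simp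
  qed
  then show "?S I" "dim V \<le> dim {v \<in> V. \<forall>i\<in>I. \<phi> i v = 0} + card I" by auto
qed

lemma dim_le_card_functionals:
  fixes \<phi> :: "'i \<Rightarrow> 'b \<Rightarrow> 'a"
  assumes "finite I" "V \<subseteq> span B" "finite B" "subspace V"
    and "\<And>i x y. i \<in> I \<Longrightarrow> \<phi> i (x + y) = \<phi> i x + \<phi> i y"
    and "\<And>i c x. i \<in> I \<Longrightarrow> \<phi> i (scale c x) = c * \<phi> i x"
    and "\<And>v. v \<in> V \<Longrightarrow> \<forall>i\<in>I. \<phi> i v = 0 \<Longrightarrow> v = 0"
  shows "dim V \<le> card I"
proof -
  have "dim {v \<in> V. \<forall>i\<in>I. \<phi> i v = 0} \<le> card ({} :: 'b set)"
    using assms(7) by (intro dim_le_card) auto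
  moreover have "dim V \<le> dim {v \<in> V. \<forall>i\<in>I. \<phi> i v = 0} + card I"
    by (rule dim_le_kernels(2)) (use assms in auto)
  ultimately show ?thesis by simp
qed

text \<open>Stated for the span and not for \<open>V\<close>, so that a third vector can be adjoined
  to it.\<close>

lemma dim_add2_le:
  assumes "V \<subseteq> span B" "finite B" "subspace V" "subspace W" "W \<subseteq> V" "f \<in> V" "g \<in> V"
    and indep: "\<And>\<alpha> \<beta>. scale \<alpha> f + scale \<beta> g \<in> W \<Longrightarrow> \<alpha> = 0 \<and> \<beta> = 0"
  shows "dim W + 2 \<le> dim (span (insert g (insert f W)))"
proof -
  let ?W1 = "span (insert f W)" and ?W2 = "span (insert g (insert f W))"
  have sp: "span W = W" using assms(4) by (simp add: span_eq_iff)
  have le: "?W2 \<subseteq> V" using assms by (intro span_minimal) auto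
  have le2: "?W1 \<subseteq> ?W2" "W \<subseteq> ?W1" by (auto intro: span_mono[THEN subsetD] span_base)
  have g: "g \<notin> ?W1"
  proof
    assume "g \<in> ?W1"
    then obtain b where "g - scale b f \<in> W" unfolding span_insert[of f] sp by auto
    then have "scale (- b) f + scale 1 g \<in> W" by (simp add: algebra_simps)
    then show False using indep by (metis zero_neq_one)
  qed
  have f: "f \<notin> W"
  proof
    assume "f \<in> W"
    then have "scale 1 f + scale 0 g \<in> W" by simp
    then show False using indep by (metis zero_neq_one)
  qed
  have "dim W < dim ?W1"
    using le le2 assms(1,2,4) f by (intro subspace_dim_less[of _ B _ f]) (auto intro: span_base)
  moreover have "dim ?W1 < dim ?W2"
    using le le2 assms(1,2) g by (intro subspace_dim_less[of _ B _ g]) (auto intro: span_base)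
  ultimately show ?thesis by linarith
qed

lemma dim_add3_le:
  assumes "V \<subseteq> span B" "finite B" "subspace V" "subspace W" "W \<subseteq> V" "f \<in> V" "g \<in> V" "h \<in> V"
    and indep: "\<And>\<alpha> \<beta> \<gamma>. scale \<alpha> f + scale \<beta> g + scale \<gamma> h \<in> W \<Longrightarrow> \<alpha> = 0 \<and> \<beta> = 0 \<and> \<gamma> = 0"
  shows "dim W + 3 \<le> dim V"
proof -
  let ?W2 = "span (insert g (insert f W))"
  have sp: "span W = W" using assms(4) by (simp add: span_eq_iff)
  have le: "?W2 \<subseteq> V" using assms by (intro span_minimal) auto
  have "dim W + 2 \<le> dim ?W2"
  proof (rule dim_add2_le[OF assms(1-7)])
    fix \<alpha> \<beta> assume "scale \<alpha> f + scale \<beta> g \<in> W"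
    then show "\<alpha> = 0 \<and> \<beta> = 0" using indep[of \<alpha> \<beta> 0] by simp
  qed
  moreover have "h \<notin> ?W2"
  proof
    assume "h \<in> ?W2"
    then obtain a b where "h - scale a g - scale b f \<in> W"
      unfolding span_insert[of g] span_insert[of f] sp by auto
    then have "scale (- b) f + scale (- a) g + scale 1 h \<in> W" by (simp add: algebra_simps)
    then show False using indep by (metis zero_neq_one)
  qed
  then have "dim ?W2 < dim V"
    using le assms(1,2,8) by (intro subspace_dim_less[of _ B _ h]) auto
  ultimately show ?thesis by linarith
qed

end

hide_const (open) Poly_Mapping.degree

subsection \<open>Substitution\<close>

lemma poly_mapping_sum_single: "p = (\<Sum>t\<in>Poly_Mapping.keys p. Poly_Mapping.single t (Poly_Mapping.lookup p t))"
  by (rule poly_mapping_eqI) (auto simp: lookup_sum lookup_single when_def not_in_keys_iff_lookup_eq_zero)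

definition mono_eval :: "(nat \<Rightarrow> 'b::comm_ring_1) \<Rightarrow> (nat \<Rightarrow>\<^sub>0 nat) \<Rightarrow> 'b" where
  "mono_eval v t = (\<Prod>i\<in>Poly_Mapping.keys t. v i ^ Poly_Mapping.lookup t i)"

lemma mono_eval_superset:
  "finite A \<Longrightarrow> Poly_Mapping.keys t \<subseteq> A \<Longrightarrow> mono_eval v t = (\<Prod>i\<in>A. v i ^ Poly_Mapping.lookup t i)"
  unfolding mono_eval_def by (rule prod.mono_neutral_left) (auto simp: in_keys_iff)

lemma mono_eval_add: "mono_eval v (s + t) = mono_eval v s * mono_eval v t"
proof -
  let ?A = "Poly_Mapping.keys s \<union> Poly_Mapping.keys t"
  have "mono_eval v (s + t) = (\<Prod>i\<in>?A. v i ^ Poly_Mapping.lookup (s + t) i)"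
    by (rule mono_eval_superset) (use Poly_Mapping.keys_add[of s t] in auto)
  also have "\<dots> = mono_eval v s * mono_eval v t"
    by (simp add: mono_eval_superset[of ?A] lookup_add power_add prod.distrib)
  finally show ?thesis .
qed

lemma mono_eval_0 [simp]: "mono_eval v 0 = 1"
  by (simp add: mono_eval_def)

lemma mono_eval_single [simp]: "mono_eval v (Poly_Mapping.single i k) = v i ^ k"
  by (simp add: mono_eval_def)

lemma mono_eval_cong: "(\<And>i. i \<in> Poly_Mapping.keys t \<Longrightarrow> v i = w i) \<Longrightarrow> mono_eval v t = mono_eval w t"
  by (simp add: mono_eval_def)

text \<open>One substitution homomorphism serves several targets: the field for evaluation,
  \<open>'k poly\<close> for lines, \<open>'k mpoly\<close> for linear substitutions and
  \<open>'k poly poly\<close> for the affine chart.\<close>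

locale coeff_hom =
  fixes C :: "'a::comm_ring_1 \<Rightarrow> 'b::comm_ring_1"
  assumes C_add: "C (a + b) = C a + C b" and C_mult: "C (a * b) = C a * C b" and C_1: "C 1 = 1"
begin

lemma C_0: "C 0 = 0"
  using C_add[of 0 0] by (metis add_0 add_cancel_right_left)

definition subst :: "(nat \<Rightarrow> 'b) \<Rightarrow> 'a mpoly \<Rightarrow> 'b" where
  "subst v p = (\<Sum>t\<in>Poly_Mapping.keys p. C (Poly_Mapping.lookup p t) * mono_eval v t)"

lemma subst_superset:
  "finite A \<Longrightarrow> Poly_Mapping.keys p \<subseteq> A \<Longrightarrow> subst v p = (\<Sum>t\<in>A. C (Poly_Mapping.lookup p t) * mono_eval v t)"
  unfolding subst_def by (rule sum.mono_neutral_left) (auto simp: in_keys_iff C_0)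

lemma subst_0 [simp]: "subst v 0 = 0"
  by (simp add: subst_def)

lemma subst_add: "subst v (p + q) = subst v p + subst v q"
proof -
  let ?A = "Poly_Mapping.keys p \<union> Poly_Mapping.keys q"
  have "subst v (p + q) = (\<Sum>t\<in>?A. C (Poly_Mapping.lookup (p + q) t) * mono_eval v t)"
    by (rule subst_superset) (use Poly_Mapping.keys_add[of p q] in auto)
  also have "\<dots> = subst v p + subst v q"
    by (simp add: subst_superset[of ?A] lookup_add C_add distrib_right sum.distrib)
  finally show ?thesis .
qed

lemma subst_single [simp]: "subst v (Poly_Mapping.single t c) = C c * mono_eval v t"
  using C_0 by (cases "c = 0") (simp_all add: subst_def)

lemma subst_1 [simp]: "subst v 1 = 1"
  using subst_single[of v 0 1] by (simp add: C_1)

lemma subst_uminus: "subst v (- p) = - subst v p"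
  using subst_add[of v p "- p"] by (simp add: eq_neg_iff_add_eq_0 add.commute)

lemma subst_diff: "subst v (p - q) = subst v p - subst v q"
  using subst_add[of v p "- q"] by (simp add: subst_uminus)

lemma subst_sum: "subst v (sum f A) = (\<Sum>a\<in>A. subst v (f a))"
  by (induct A rule: infinite_finite_induct) (simp_all add: subst_add)

lemma subst_mult: "subst v (p * q) = subst v p * subst v q"
proof -
  have "p * q = (\<Sum>s\<in>Poly_Mapping.keys p. \<Sum>t\<in>Poly_Mapping.keys q.
      Poly_Mapping.single (s + t) (Poly_Mapping.lookup p s * Poly_Mapping.lookup q t))"
    by (subst poly_mapping_sum_single[of p], subst poly_mapping_sum_single[of q])
      (simp add: sum_product mult_single)
  then have "subst v (p * q) = (\<Sum>s\<in>Poly_Mapping.keys p. \<Sum>t\<in>Poly_Mapping.keys q.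
      C (Poly_Mapping.lookup p s * Poly_Mapping.lookup q t) * mono_eval v (s + t))"
    by (simp add: subst_sum)
  also have "\<dots> = subst v p * subst v q"
    by (simp add: subst_def sum_product C_mult mono_eval_add mult_ac)
  finally show ?thesis .
qed

lemma subst_prod: "subst v (prod f A) = (\<Prod>a\<in>A. subst v (f a))"
  by (induct A rule: infinite_finite_induct) (simp_all add: subst_mult)

lemma subst_power: "subst v (p ^ k) = subst v p ^ k"
  by (induct k) (simp_all add: subst_mult)

lemma subst_scale: "subst v (mpoly_scale c p) = C c * subst v p"
  by (simp add: mpoly_scale_def subst_mult)

text \<open>Substitution is natural in the target, so evaluating a restricted or dehomogenized form
  amounts to evaluating the form itself at a point.\<close>

lemma subst_comp:
  assumes "coeff_hom h" "coeff_hom C'" "\<And>c. h (C c) = C' c"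
  shows "h (subst v p) = coeff_hom.subst C' (\<lambda>i. h (v i)) p"
proof -
  interpret h: coeff_hom h by fact
  interpret C': coeff_hom C' by fact
  have sum: "h (sum f A) = (\<Sum>a\<in>A. h (f a))" for f :: "_ \<Rightarrow> 'b" and A :: "(nat \<Rightarrow>\<^sub>0 nat) set"
    by (induct A rule: infinite_finite_induct) (simp_all add: h.C_0 h.C_add)
  have pow: "h (x ^ k) = h x ^ k" for x k
    by (induct k) (simp_all add: h.C_1 h.C_mult)
  have prod: "h (prod f A) = (\<Prod>a\<in>A. h (f a))" for f :: "_ \<Rightarrow> 'b" and A :: "nat set"
    by (induct A rule: infinite_finite_induct) (simp_all add: h.C_1 h.C_mult)
  show ?thesis
    by (simp add: subst_def C'.subst_def sum h.C_mult assms(3) mono_eval_def prod pow)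
qed

lemma subst_cong:
  "p \<in> carrier (coord_ring n) \<Longrightarrow> (\<And>i. i \<le> n \<Longrightarrow> v i = w i) \<Longrightarrow> subst v p = subst w p"
  unfolding subst_def coord_ring_def
  by (intro sum.cong refl arg_cong2[where f = "(*)"] mono_eval_cong) auto

end

interpretation ev: coeff_hom "\<lambda>x :: 'k::comm_ring_1. x"
  by unfold_locales simp_all

lemma mpoly_eval_eq_subst: "mpoly_eval v p = ev.subst v p"
  by (simp add: mpoly_eval_def ev.subst_def mono_eval_def)

definition Var :: "nat \<Rightarrow> 'k::comm_ring_1 mpoly" where
  "Var i = Poly_Mapping.single (Poly_Mapping.single i 1) 1"

definition Const :: "'k \<Rightarrow> 'k::comm_ring_1 mpoly" where
  "Const c = Poly_Mapping.single 0 c"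

lemma (in coeff_hom) subst_Var [simp]: "subst v (Var i) = v i"
  by (simp add: Var_def C_1)

lemma (in coeff_hom) subst_Const [simp]: "subst v (Const c) = C c"
  by (simp add: Const_def)

lemma mpoly_eval_simps [simp]:
  "mpoly_eval v (p + q) = mpoly_eval v p + mpoly_eval v q"
  "mpoly_eval v (p - q) = mpoly_eval v p - mpoly_eval v q"
  "mpoly_eval v (- p) = - mpoly_eval v p"
  "mpoly_eval v (p * q) = mpoly_eval v p * mpoly_eval v q"
  "mpoly_eval v 0 = 0" "mpoly_eval v 1 = 1"
  "mpoly_eval v (p ^ k) = mpoly_eval v p ^ k"
  "mpoly_eval v (sum f A) = (\<Sum>a\<in>A. mpoly_eval v (f a))"
  "mpoly_eval v (prod f B) = (\<Prod>a\<in>B. mpoly_eval v (f a))"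
  "mpoly_eval v (mpoly_scale c p) = c * mpoly_eval v p"
  "mpoly_eval v (Var i) = v i" "mpoly_eval v (Const c) = c"
  by (simp_all add: mpoly_eval_eq_subst ev.subst_add ev.subst_diff ev.subst_uminus ev.subst_mult
      ev.subst_power ev.subst_sum ev.subst_prod ev.subst_scale)

lemma mpoly_eval_cong:
  "p \<in> carrier (coord_ring n) \<Longrightarrow> (\<And>i. i \<le> n \<Longrightarrow> v i = w i) \<Longrightarrow> mpoly_eval v p = mpoly_eval w p"
  unfolding mpoly_eval_eq_subst by (rule ev.subst_cong)

subsection \<open>Forms\<close>

lemma total_degree_superset:
  "finite A \<Longrightarrow> Poly_Mapping.keys t \<subseteq> A \<Longrightarrow> total_degree t = (\<Sum>i\<in>A. Poly_Mapping.lookup t i)"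
  unfolding total_degree_def by (rule sum.mono_neutral_left) (auto simp: in_keys_iff)

lemma total_degree_add: "total_degree (s + t) = total_degree s + total_degree t"
proof -
  let ?A = "Poly_Mapping.keys s \<union> Poly_Mapping.keys t"
  have "total_degree (s + t) = (\<Sum>i\<in>?A. Poly_Mapping.lookup (s + t) i)"
    by (rule total_degree_superset) (use Poly_Mapping.keys_add[of s t] in auto)
  also have "\<dots> = total_degree s + total_degree t"
    by (simp add: total_degree_superset[of ?A] lookup_add sum.distrib)
  finally show ?thesis .
qed

lemma total_degree_single [simp]: "total_degree (Poly_Mapping.single i k) = k"
  by (simp add: total_degree_def)

definition monomials :: "nat \<Rightarrow> nat \<Rightarrow> (nat \<Rightarrow>\<^sub>0 nat) set" where
  "monomials n d = {t. Poly_Mapping.keys t \<subseteq> {..n} \<and> total_degree t = d}"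

lemma forms_eq: "forms n d = {p. Poly_Mapping.keys p \<subseteq> monomials n d}"
  by (auto simp: forms_def coord_ring_def monomials_def)

lemma monomials_add: "s \<in> monomials n d \<Longrightarrow> t \<in> monomials n e \<Longrightarrow> s + t \<in> monomials n (d + e)"
  using Poly_Mapping.keys_add[of s t] by (auto simp: monomials_def total_degree_add)

text \<open>Stars and bars: exponent vectors correspond to lists of length n + 1 with sum d.\<close>

lemma card_monomials: "finite (monomials n d)" "card (monomials n d) = (d + n) choose n"
proof -
  let ?f = "\<lambda>t. map (Poly_Mapping.lookup t) [0..<Suc n]"
  let ?L = "{l :: nat list. length l = Suc n \<and> sum_list l = d}"
  have deg: "total_degree t = (\<Sum>i<Suc n. Poly_Mapping.lookup t i)" if "Poly_Mapping.keys t \<subseteq> {..n}" for t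
    using that by (intro total_degree_superset) auto
  have bij: "bij_betw ?f (monomials n d) ?L"
  proof (rule bij_betw_byWitness[where f' = Poly_Mapping.nth])
    show "\<forall>t\<in>monomials n d. Poly_Mapping.nth (?f t) = t"
    proof
      fix t assume "t \<in> monomials n d"
      then have "Poly_Mapping.lookup t i = 0" if "i > n" for i
        using that by (auto simp: monomials_def not_in_keys_iff_lookup_eq_zero [symmetric])
      then show "Poly_Mapping.nth (?f t) = t"
        by (intro poly_mapping_eqI) (auto simp: nth_default_def simp del: upt_Suc)
    qed
    show "\<forall>l\<in>?L. ?f (Poly_Mapping.nth l) = l"
      by (auto intro!: nth_equalityI simp: nth_default_def simp del: upt_Suc)
    show "?f ` monomials n d \<subseteq> ?L"
      by (auto simp: monomials_def deg interv_sum_list_conv_sum_set_nat atLeast0LessThan simp del: upt_Suc)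
    show "Poly_Mapping.nth ` ?L \<subseteq> monomials n d"
    proof
      fix t assume "t \<in> Poly_Mapping.nth ` ?L"
      then obtain l where l: "length l = Suc n" "sum_list l = d" "t = Poly_Mapping.nth l" by blast
      have "Poly_Mapping.keys t \<subseteq> {..n}"
        using l by (auto simp: in_keys_iff nth_default_def simp del: keys_nth split: if_splits)
      moreover have "(\<Sum>i<Suc n. Poly_Mapping.lookup t i) = sum_list l"
        using l by (auto simp: sum_list_sum_nth nth_default_def atLeast0LessThan intro!: sum.cong)
      ultimately show "t \<in> monomials n d" using l by (simp add: monomials_def deg)
    qed
  qed
  have card: "card ?L = (d + n) choose n"
    using card_length_sum_list[of "Suc n" d] binomial_symmetric[of n "d + n"] by simp
  then show "card (monomials n d) = (d + n) choose n"
    using bij_betw_same_card[OF bij] by simp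
  \<comment> \<open>Infinite sets have cardinality 0, so the positive count also yields
    finiteness.\<close>
  moreover have "(d + n) choose n > 0" by simp
  ultimately show "finite (monomials n d)" by (intro card_ge_0_finite) simp
qed

interpretation mp: vector_space "mpoly_scale :: 'k::field \<Rightarrow> _"
  by (rule vector_space_mpoly_scale)

lemma mpoly_scale_eq: "mpoly_scale c p = Const c * p"
  by (simp add: mpoly_scale_def Const_def)

lemma lookup_mpoly_scale [simp]: "Poly_Mapping.lookup (mpoly_scale c p) t = c * Poly_Mapping.lookup p t"
proof -
  have "mpoly_scale c p = Poly_Mapping.map ((*) c) p"
    by (simp add: mpoly_scale_def mult_map_scale_conv_mult)
  then show ?thesis by (simp add: Poly_Mapping.map.rep_eq when_def)
qed

lemma forms_iff: "p \<in> forms n d \<longleftrightarrow> (\<forall>t. t \<notin> monomials n d \<longrightarrow> Poly_Mapping.lookup p t = 0)"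
  by (auto simp: forms_eq in_keys_iff)

lemma subspace_forms: "mp.subspace (forms n d :: 'k::field mpoly set)"
  by (auto simp: mp.subspace_def forms_iff lookup_add)

lemma forms_0 [simp]: "0 \<in> forms n d"
  by (simp add: forms_iff)

lemma forms_add: "p \<in> forms n d \<Longrightarrow> q \<in> forms n d \<Longrightarrow> p + q \<in> forms n d"
  by (simp add: forms_iff lookup_add)

lemma forms_diff: "p \<in> forms n d \<Longrightarrow> q \<in> forms n d \<Longrightarrow> p - q \<in> forms n d"
  by (simp add: forms_iff lookup_minus)

lemma forms_sum: "(\<And>a. a \<in> A \<Longrightarrow> f a \<in> forms n d) \<Longrightarrow> sum f A \<in> forms n d"
  by (induct A rule: infinite_finite_induct) (simp_all add: forms_add)

lemma forms_mult: "p \<in> forms n d \<Longrightarrow> q \<in> forms n e \<Longrightarrow> p * q \<in> forms n (d + e)"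
  using Poly_Mapping.keys_mult[of p q] monomials_add[of _ n d _ e] unfolding forms_eq by blast

lemma forms_Var: "i \<le> n \<Longrightarrow> Var i \<in> forms n 1"
  by (auto simp: forms_eq Var_def monomials_def)

lemma forms_Var_Suc_0 [simp]: "i \<le> n \<Longrightarrow> Var i \<in> forms n (Suc 0)"
  using forms_Var by simp

lemma forms_Const: "Const c \<in> forms n 0"
  by (auto simp: forms_eq Const_def monomials_def total_degree_def)

lemma forms_1: "1 \<in> forms n 0"
  using forms_Const[of 1 n] by (simp add: Const_def)

lemma forms_Const_mult: "p \<in> forms n d \<Longrightarrow> Const c * p \<in> forms n d"
  using forms_mult[OF forms_Const[of c n]] by fastforce

lemma forms_power: "p \<in> forms n d \<Longrightarrow> p ^ k \<in> forms n (k * d)"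
  by (induct k) (simp_all add: forms_1 forms_mult)

lemma forms_prod: "(\<And>a. a \<in> A \<Longrightarrow> f a \<in> forms n (g a)) \<Longrightarrow> prod f A \<in> forms n (sum g A)"
  by (induct A rule: infinite_finite_induct) (simp_all add: forms_1 forms_mult)

lemma forms_carrier: "p \<in> forms n d \<Longrightarrow> p \<in> carrier (coord_ring n)"
  by (simp add: forms_def)

lemma forms_span: "forms n d \<subseteq> mp.span ((\<lambda>t. Poly_Mapping.single t 1) ` monomials n d :: 'k::field mpoly set)"
proof
  fix p :: "'k mpoly" assume p: "p \<in> forms n d"
  have "p = (\<Sum>t\<in>Poly_Mapping.keys p. mpoly_scale (Poly_Mapping.lookup p t) (Poly_Mapping.single t 1))"
    using poly_mapping_sum_single[of p] by (simp add: mpoly_scale_def mult_single)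
  also have "\<dots> \<in> mp.span ((\<lambda>t. Poly_Mapping.single t 1) ` monomials n d)"
    using p by (intro mp.span_sum mp.span_scale mp.span_base) (auto simp: forms_eq)
  finally show "p \<in> mp.span ((\<lambda>t. Poly_Mapping.single t 1) ` monomials n d)" .
qed

lemma dim_forms: "mpoly_dim (forms n d :: 'k::field mpoly set) = (d + n) choose n"
proof -
  let ?m = "\<lambda>t. Poly_Mapping.single t (1 :: 'k)"
  let ?B = "?m ` monomials n d"
  have inj: "inj_on ?m (monomials n d)" by (rule inj_onI) (metis keys_single singleton_inject one_neq_zero)
  have "mp.independent ?B"
  proof (rule mp.independent_if_scalars_zero)
    fix f x assume f: "(\<Sum>x\<in>?B. mpoly_scale (f x) x) = 0" and "x \<in> ?B"
    then obtain s where s: "s \<in> monomials n d" "x = ?m s" by blast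
    have "Poly_Mapping.lookup (\<Sum>t\<in>monomials n d. mpoly_scale (f (?m t)) (?m t)) s = 0"
      using f by (simp add: sum.reindex[OF inj])
    then show "f x = 0"
      using s card_monomials(1)[of n d]
      by (simp add: lookup_sum lookup_single when_def if_distrib [of "(*) _"] cong: if_cong)
  qed (simp add: card_monomials)
  moreover have "?B \<subseteq> forms n d" by (auto simp: forms_eq)
  ultimately show ?thesis
    using mp.basis_card_eq_dim[of ?B "forms n d"] forms_span card_image[OF inj] card_monomials(2) by metis
qed

subsection \<open>Points where a form does not vanish\<close>

lemma sum_digits_less:
  fixes a :: "nat \<Rightarrow> nat"
  assumes "\<And>i. i < n \<Longrightarrow> a i < B"
  shows "(\<Sum>i<n. a i * B ^ i) < B ^ n"
  using assms
proof (induct n)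
  case (Suc n)
  have "(\<Sum>i<n. a i * B ^ i) < B ^ n" using Suc by simp
  moreover have "(a n + 1) * B ^ n \<le> B * B ^ n" using Suc.prems[of n] by (intro mult_right_mono) auto
  ultimately show ?case by simp
qed simp

text \<open>The top digit is the quotient by \<open>B ^ n\<close>, the lower part being smaller than
  \<open>B ^ n\<close>. This separates the monomials in the Kronecker substitution.\<close>

lemma digits_unique:
  fixes a b :: "nat \<Rightarrow> nat"
  assumes "\<And>i. i < n \<Longrightarrow> a i < B" "\<And>i. i < n \<Longrightarrow> b i < B"
    and "(\<Sum>i<n. a i * B ^ i) = (\<Sum>i<n. b i * B ^ i)" and "i < n"
  shows "a i = b i"
  using assms
proof (induct n arbitrary: i)
  case (Suc n)
  have a: "(\<Sum>i<n. a i * B ^ i) < B ^ n" and b: "(\<Sum>i<n. b i * B ^ i) < B ^ n"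
    using Suc.prems by (simp_all add: sum_digits_less)
  have eq: "(\<Sum>i<n. a i * B ^ i) + a n * B ^ n = (\<Sum>i<n. b i * B ^ i) + b n * B ^ n"
    using Suc.prems(3) by simp
  have nz: "B ^ n \<noteq> 0" using a by linarith
  have "a n = ((\<Sum>i<n. a i * B ^ i) + a n * B ^ n) div B ^ n"
    unfolding div_mult_self1[OF nz] using a by simp
  also have "\<dots> = b n" unfolding eq div_mult_self1[OF nz] using b by simp
  finally have "a n = b n" .
  with eq have "(\<Sum>i<n. a i * B ^ i) = (\<Sum>i<n. b i * B ^ i)" by simp
  then have "a i = b i" if "i < n" using that by (intro Suc.hyps) (simp_all add: Suc.prems)
  then show ?case using Suc.prems(4) \<open>a n = b n\<close> less_Suc_eq by blast
qed simp

interpretation poly_hom: coeff_hom "\<lambda>c :: 'k::comm_ring_1. [:c:]"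
  by unfold_locales (simp_all add: one_pCons)

lemma poly_subst:
  fixes p :: "'k::comm_ring_1 mpoly"
  shows "poly (poly_hom.subst v p) s = mpoly_eval (\<lambda>i. poly (v i) s) p"
  unfolding mpoly_eval_eq_subst
  by (rule poly_hom.subst_comp[of "\<lambda>q. poly q s"]) (unfold_locales, simp_all)

text \<open>Kronecker substitution: a large power of one variable for each further variable separates
  the monomials.\<close>

lemma nonvanishing_vector:
  fixes f :: "'k::{idom,ring_char_0} mpoly"
  assumes f: "f \<in> carrier (coord_ring n)" "f \<noteq> 0"
  shows "\<exists>v. (\<forall>i>n. v i = 0) \<and> mpoly_eval v f \<noteq> 0"
proof -
  define B where "B = Suc (Max (insert 0 (\<Union>t\<in>Poly_Mapping.keys f. Poly_Mapping.lookup t ` {..n})))"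
  have B: "Poly_Mapping.lookup t i < B" if "t \<in> Poly_Mapping.keys f" "i \<le> n" for t i
    unfolding B_def less_Suc_eq_le using that by (intro Max_ge) auto
  define code where "code t = (\<Sum>i<Suc n. Poly_Mapping.lookup t i * B ^ i)" for t :: "nat \<Rightarrow>\<^sub>0 nat"
  have keys: "Poly_Mapping.keys t \<subseteq> {..n}" if "t \<in> Poly_Mapping.keys f" for t
    using f(1) that by (simp add: coord_ring_def)
  have inj: "s = t" if s: "s \<in> Poly_Mapping.keys f" and t: "t \<in> Poly_Mapping.keys f" and st: "code s = code t" for s t
  proof (rule poly_mapping_eqI)
    fix i
    show "Poly_Mapping.lookup s i = Poly_Mapping.lookup t i"
    proof (cases "i \<le> n")
      case True
      show ?thesis
        by (rule digits_unique[of "Suc n" _ B]) (use True B s t st in \<open>auto simp: code_def\<close>)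
    next
      case False
      then have "i \<notin> Poly_Mapping.keys s" "i \<notin> Poly_Mapping.keys t" using keys s t by auto
      then show ?thesis by (simp add: in_keys_iff)
    qed
  qed
  define X where "X i = monom (1 :: 'k) (B ^ i)" for i
  have mono: "mono_eval X t = monom 1 (code t)" if "t \<in> Poly_Mapping.keys f" for t
  proof -
    have "mono_eval X t = (\<Prod>i<Suc n. X i ^ Poly_Mapping.lookup t i)"
      using keys[OF that] by (intro mono_eval_superset) auto
    also have "\<dots> = (\<Prod>i<Suc n. monom 1 (Poly_Mapping.lookup t i * B ^ i))"
      by (simp add: X_def monom_power mult.commute)
    also have "\<dots> = monom 1 (code t)"
      unfolding code_def by (induct n) (simp_all add: mult_monom)
    finally show ?thesis .
  qed
  obtain t where t: "t \<in> Poly_Mapping.keys f" using f(2) by (metis keys_eq_empty ex_in_conv)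
  have "coeff (poly_hom.subst X f) (code t)
      = (\<Sum>s\<in>Poly_Mapping.keys f. coeff ([:Poly_Mapping.lookup f s:] * monom 1 (code s)) (code t))"
    unfolding poly_hom.subst_def coeff_sum by (intro sum.cong refl) (simp only: mono)
  also have "\<dots> = (\<Sum>s\<in>Poly_Mapping.keys f. if s = t then Poly_Mapping.lookup f s else 0)"
    by (intro sum.cong refl) (use inj t in auto)
  also have "\<dots> = Poly_Mapping.lookup f t" using t by simp
  also have "\<dots> \<noteq> 0" using t by (simp add: in_keys_iff)
  finally have "poly_hom.subst X f \<noteq> 0" by force
  then obtain s where "poly (poly_hom.subst X f) s \<noteq> 0" using poly_all_0_iff_0 by blast
  then have "mpoly_eval (\<lambda>i. poly (X i) s) f \<noteq> 0" by (simp add: poly_subst)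
  moreover have "mpoly_eval (\<lambda>i. if i \<le> n then poly (X i) s else 0) f = mpoly_eval (\<lambda>i. poly (X i) s) f"
    using f(1) by (rule mpoly_eval_cong) simp
  ultimately show ?thesis
    by (intro exI[of _ "\<lambda>i. if i \<le> n then poly (X i) s else 0"]) simp
qed

lemma Var_nonzero [simp]: "(Var i :: 'k::comm_ring_1 mpoly) \<noteq> 0"
  unfolding Var_def by (metis keys_single keys_zero insert_not_empty zero_neq_one)

lemma nonvanishing_point:
  fixes f :: "'k::field_char_0 mpoly"
  assumes f: "f \<in> forms n d" "f \<noteq> 0"
  shows "\<exists>v\<in>homog_coords n. mpoly_eval v f \<noteq> 0"
proof -
  \<comment> \<open>The factor \<open>Var 0\<close> forces the vector found to be nonzero, which a
    constant \<open>f\<close> would not do.\<close>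
  have "f * Var 0 \<in> carrier (coord_ring n)" "f * Var 0 \<noteq> 0"
    using forms_carrier[OF forms_mult[OF f(1) forms_Var[of 0 n]]] f(2) by auto
  then obtain v where "\<forall>i>n. v i = 0" "mpoly_eval v (f * Var 0) \<noteq> 0"
    using nonvanishing_vector by blast
  then show ?thesis by (intro bexI[of _ v]) (auto simp: homog_coords_def)
qed

lemma form_eq_0I:
  fixes f :: "'k::field_char_0 mpoly"
  assumes "f \<in> forms n d" "\<And>v. v \<in> homog_coords n \<Longrightarrow> mpoly_eval v f = 0"
  shows "f = 0"
  using nonvanishing_point[OF assms(1)] assms(2) by blast

subsection \<open>Points and their ideals\<close>

definition proj_point :: "nat \<Rightarrow> (nat \<Rightarrow> 'k::field) \<Rightarrow> (nat \<Rightarrow> 'k) set" where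
  "proj_point n v = proportional n `` {v}"

text \<open>The space [I_Z]_d written with chosen coordinate vectors;
  \<open>graded_part_point_ideal\<close> proves the agreement.\<close>

definition vanishing_forms :: "nat \<Rightarrow> nat \<Rightarrow> (nat \<Rightarrow> 'k) set \<Rightarrow> 'k::field mpoly set" where
  "vanishing_forms n d S = {f \<in> forms n d. \<forall>v\<in>S. mpoly_eval v f = 0}"

lemma proj_space_eq: "proj_space n = proj_point n ` homog_coords n"
  by (auto simp: proj_space_def proj_point_def quotient_def)

lemma proj_point_eq_iff:
  "v \<in> homog_coords n \<Longrightarrow> w \<in> homog_coords n \<Longrightarrow>
    proj_point n v = proj_point n w \<longleftrightarrow> (\<exists>c. c \<noteq> 0 \<and> w = (\<lambda>i. c * v i))"
  unfolding proj_point_def using eq_equiv_class_iff[OF equiv_proportional, of v n w]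
  by (simp add: proportional_def)

interpretation coord_ring: cring "coord_ring n :: 'k::comm_ring_1 mpoly ring"
  by (rule cring_coord_ring)

lemma coord_ring_simps [simp]:
  "x \<otimes>\<^bsub>coord_ring n\<^esub> y = x * y" "x \<oplus>\<^bsub>coord_ring n\<^esub> y = x + y"
  "\<zero>\<^bsub>coord_ring n\<^esub> = 0" "\<one>\<^bsub>coord_ring n\<^esub> = 1"
  by (simp_all add: coord_ring_def)

lemma ideal_coord_ringI:
  fixes I :: "'k::comm_ring_1 mpoly set"
  assumes "I \<subseteq> carrier (coord_ring n)" "0 \<in> I" "\<And>p q. p \<in> I \<Longrightarrow> q \<in> I \<Longrightarrow> p + q \<in> I"
    and "\<And>p q. p \<in> I \<Longrightarrow> q \<in> carrier (coord_ring n) \<Longrightarrow> q * p \<in> I"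
  shows "ideal I (coord_ring n)"
proof (rule idealI)
  show "ring (coord_ring n :: 'k mpoly ring)" by unfold_locales
  have m1: "- 1 \<in> carrier (coord_ring n :: 'k mpoly ring)"
    using coord_ring.one_closed[of n] by (simp add: coord_ring_def)
  show "subgroup I (add_monoid (coord_ring n))"
  proof (rule group.subgroupI)
    show "Group.group (add_monoid (coord_ring n :: 'k mpoly ring))"
      by (rule coord_ring.a_group)
    fix a assume a: "a \<in> I"
    have "- a \<in> I" using assms(4)[OF a m1] by simp
    moreover have "inv\<^bsub>add_monoid (coord_ring n)\<^esub> a = - a"
      using a \<open>- a \<in> I\<close> assms(1) by (intro group.inv_equality[OF coord_ring.a_group]) auto
    ultimately show "inv\<^bsub>add_monoid (coord_ring n)\<^esub> a \<in> I" by simp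
  qed (use assms in auto)
qed (use assms in \<open>auto simp: mult.commute\<close>)

lemma ideal_vanishing:
  "ideal {p \<in> carrier (coord_ring n). \<forall>v\<in>S. mpoly_eval v p = 0} (coord_ring n :: 'k::field mpoly ring)"
  using coord_ring.m_closed[of _ n] coord_ring.a_closed[of _ n] coord_ring.zero_closed[of n]
  by (intro ideal_coord_ringI) auto

lemma point_ideal_generators:
  "{f \<in> (\<Union>e. forms n e). \<forall>P\<in>Z. vanishes_at f P} \<subseteq> carrier (coord_ring n)"
  by (auto intro: forms_carrier)

lemma ideal_point_ideal: "ideal (point_ideal n Z) (coord_ring n :: 'k::field mpoly ring)"
  unfolding point_ideal_def using coord_ring.genideal_ideal[OF point_ideal_generators] .

lemma form_in_point_ideal:
  "f \<in> forms n e \<Longrightarrow> v \<in> homog_coords n \<Longrightarrow> mpoly_eval v f = 0 \<Longrightarrow> f \<in> point_ideal n {proj_point n v}"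
  unfolding point_ideal_def proj_point_def
  using coord_ring.genideal_self[OF point_ideal_generators, of n "{proportional n `` {v}}"] vanishes_at_iff[of f n e v]
  by blast

text \<open>All polynomials vanishing at the chosen vectors form an ideal, homogeneous or not, and
  it contains the generators.\<close>

lemma point_ideal_vanishes:
  assumes "f \<in> point_ideal n (proj_point n ` S)" "S \<subseteq> homog_coords n" "v \<in> S"
  shows "f \<in> carrier (coord_ring n)" "mpoly_eval v f = 0"
proof -
  have "point_ideal n (proj_point n ` S) \<subseteq> {p \<in> carrier (coord_ring n). \<forall>v\<in>S. mpoly_eval v p = 0}"
    unfolding point_ideal_def
  proof (rule coord_ring.genideal_minimal[OF ideal_vanishing], intro subsetI CollectI conjI ballI)
    fix p v assume p: "p \<in> {f \<in> (\<Union>e. forms n e). \<forall>P\<in>proj_point n ` S. vanishes_at f P}"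
    then obtain e where e: "p \<in> forms n e" by blast
    then show "p \<in> carrier (coord_ring n)" by (rule forms_carrier)
    assume v: "v \<in> S"
    then have "vanishes_at p (proj_point n v)" using p by blast
    then show "mpoly_eval v p = 0"
      using vanishes_at_iff[OF e, of v] v assms(2) by (auto simp: proj_point_def)
  qed
  then show "f \<in> carrier (coord_ring n)" "mpoly_eval v f = 0" using assms by auto
qed

lemma graded_part_point_ideal:
  assumes "S \<subseteq> homog_coords n"
  shows "graded_part n d (point_ideal n (proj_point n ` S)) = vanishing_forms n d S"
proof (rule subset_antisym; rule subsetI)
  fix f assume "f \<in> graded_part n d (point_ideal n (proj_point n ` S))"
  then show "f \<in> vanishing_forms n d S"
    using point_ideal_vanishes[OF _ assms] by (auto simp: graded_part_def vanishing_forms_def)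
next
  fix f assume f: "f \<in> vanishing_forms n d S"
  then have "f \<in> {f \<in> (\<Union>e. forms n e). \<forall>P\<in>proj_point n ` S. vanishes_at f P}"
    using vanishes_at_iff[of f n d] assms by (auto simp: vanishing_forms_def proj_point_def)
  then show "f \<in> graded_part n d (point_ideal n (proj_point n ` S))"
    using f coord_ring.genideal_self[OF point_ideal_generators, of n "proj_point n ` S"]
    unfolding graded_part_def point_ideal_def vanishing_forms_def by blast
qed

lemma ideal_power_0 [simp]: "ideal_power n I 0 = carrier (coord_ring n)"
  by (simp add: ideal_power_def nat_pow_def ideals_set_def)

lemma ideal_power_Suc [simp]: "ideal_power n I (Suc m) = ideal_prod (coord_ring n) (ideal_power n I m) I"
  by (simp add: ideal_power_def nat_pow_def ideals_set_def)

lemma ideal_ideal_power: "ideal I (coord_ring n) \<Longrightarrow> ideal (ideal_power n I m) (coord_ring n)"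
  by (induct m) (simp_all add: coord_ring.oneideal coord_ring.ideal_prod_is_ideal)

lemma ideal_power_mult: "p \<in> ideal_power n I m \<Longrightarrow> q \<in> I \<Longrightarrow> p * q \<in> ideal_power n I (Suc m)"
  using ideal_prod.prod[of p "ideal_power n I m" q I "coord_ring n"] by simp

lemma prod_in_ideal_power:
  "finite A \<Longrightarrow> (\<And>a. a \<in> A \<Longrightarrow> f a \<in> I) \<Longrightarrow> prod f A \<in> ideal_power n I (card A)"
proof (induct A rule: finite_induct)
  case empty
  then show ?case using coord_ring.one_closed[of n] by simp
next
  case (insert a A)
  then have "prod f A * f a \<in> ideal_power n I (Suc (card A))" by (intro ideal_power_mult) auto
  then show ?case using insert by (simp add: mult.commute del: ideal_power_Suc)
qed

lemma ideal_power_induct [consumes 1, case_names mult add]: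
  assumes "p \<in> ideal_power n I (Suc m)"
    and "\<And>p q. p \<in> ideal_power n I m \<Longrightarrow> q \<in> I \<Longrightarrow> Q (p * q)"
    and "\<And>p q. Q p \<Longrightarrow> Q q \<Longrightarrow> Q (p + q)"
  shows "Q p"
proof -
  have "p \<in> ideal_prod (coord_ring n) (ideal_power n I m) I" using assms(1) by simp
  then show ?thesis by (induct rule: ideal_prod.induct) (use assms(2,3) in auto)
qed

lemma finite_proj_space_repr:
  assumes "finite Z" "Z \<subseteq> proj_space n"
  obtains S where "finite S" "S \<subseteq> homog_coords n" "Z = proj_point n ` S" "inj_on (proj_point n) S"
  using assms subset_image_inj[of Z "proj_point n" "homog_coords n"] finite_image_iff
  unfolding proj_space_eq by metis

text \<open>A nonempty open set contains the complement of a single hypersurface G = 0. Further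
  conditions on the point are imposed later by multiplying \<open>G\<close> by other
  polynomials.\<close>

lemma for_general_pointE:
  fixes Q :: "(nat \<Rightarrow> 'k::field_char_0) set \<Rightarrow> bool"
  assumes "for_general_point n Q"
  obtains e G where "G \<in> forms n e" "G \<noteq> 0"
    "\<And>v. v \<in> homog_coords n \<Longrightarrow> mpoly_eval v G \<noteq> 0 \<Longrightarrow> Q (proj_point n v)"
proof -
  obtain F where F: "F \<subseteq> (\<Union>e. forms n e)"
    and ne: "proj_space n - {P \<in> proj_space n. \<forall>f\<in>F. vanishes_at f P} \<noteq> {}"
    and Q: "\<And>P. P \<in> proj_space n - {P \<in> proj_space n. \<forall>f\<in>F. vanishes_at f P} \<Longrightarrow> Q P"
    using assms unfolding for_general_point_def zariski_open_def by blast
  obtain P G where P: "P \<in> proj_space n" "G \<in> F" "\<not> vanishes_at G P" using ne by blast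
  obtain e where e: "G \<in> forms n e" using F P(2) by blast
  have "G \<noteq> 0" using P(3) by (auto simp: vanishes_at_def)
  moreover have "Q (proj_point n v)" if v: "v \<in> homog_coords n" "mpoly_eval v G \<noteq> 0" for v
  proof (rule Q)
    have "\<not> vanishes_at G (proj_point n v)"
      using vanishes_at_iff[OF e v(1)] v(2) by (simp add: proj_point_def)
    moreover have "proj_point n v \<in> proj_space n" using v(1) by (simp add: proj_space_eq)
    ultimately show "proj_point n v \<in> proj_space n - {P \<in> proj_space n. \<forall>f\<in>F. vanishes_at f P}"
      using P(2) by blast
  qed
  ultimately show ?thesis using that e by blast
qed

lemma for_general_pointI:
  fixes Q :: "(nat \<Rightarrow> 'k::field_char_0) set \<Rightarrow> bool"
  assumes G: "G \<in> forms n e" "G \<noteq> 0"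
    and Q: "\<And>v. v \<in> homog_coords n \<Longrightarrow> mpoly_eval v G \<noteq> 0 \<Longrightarrow> Q (proj_point n v)"
  shows "for_general_point n Q"
proof -
  define U where "U = proj_space n - {P \<in> proj_space n. \<forall>f\<in>{G}. vanishes_at f P}"
  have U: "proj_point n v \<in> U \<longleftrightarrow> mpoly_eval v G \<noteq> 0" if "v \<in> homog_coords n" for v
    using that vanishes_at_iff[OF G(1) that] by (auto simp: U_def proj_point_def proj_space_eq)
  have "zariski_open n U"
    unfolding zariski_open_def U_def using G(1) by (intro exI[of _ "{G}"]) blast
  moreover have "U \<noteq> {}" using nonvanishing_point[OF G] U by blast
  moreover have "\<forall>P\<in>U. Q P"
  proof
    fix P assume P: "P \<in> U"
    then obtain v where "v \<in> homog_coords n" "P = proj_point n v"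
      by (auto simp: U_def proj_space_eq)
    then show "Q P" using P U Q by blast
  qed
  ultimately show ?thesis unfolding for_general_point_def by blast
qed

lemma vanishing_forms_subset: "vanishing_forms n d S \<subseteq> forms n d"
  by (auto simp: vanishing_forms_def)

lemma subspace_vanishing_forms: "mp.subspace (vanishing_forms n d S :: 'k::field mpoly set)"
  using subspace_forms[of n d] by (auto simp: mp.subspace_def vanishing_forms_def)

section \<open>Existence of unexpected hypersurfaces\<close>

subsection \<open>A sufficient condition\<close>

lemma finite_spanning_set_forms:
  obtains B where "finite B" "forms n d \<subseteq> mp.span (B :: 'k::field mpoly set)"
  using forms_span[of n d] card_monomials(1)[of n d] that by blast

lemma subspace_vanishing_power:
  assumes "ideal I (coord_ring n)"
  shows "mp.subspace (vanishing_forms n d S \<inter> ideal_power n I m :: 'k::field mpoly set)"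
proof -
  interpret J: ideal "ideal_power n I m" "coord_ring n" by (rule ideal_ideal_power[OF assms])
  have "mp.subspace (ideal_power n I m)"
    unfolding mp.subspace_def mpoly_scale_eq
    using J.zero_closed J.a_closed J.I_l_closed[OF _ forms_carrier[OF forms_Const]] by auto
  then show ?thesis using subspace_vanishing_forms by (rule mp.subspace_inter[rotated])
qed

lemma admits_unexpected_iff:
  assumes "S \<subseteq> homog_coords n"
  shows "admits_unexpected n d m (proj_point n ` S) \<longleftrightarrow>
    for_general_point n (\<lambda>P. int (mpoly_dim (vanishing_forms n d S \<inter> ideal_power n (point_ideal n {P}) m))
      > max 0 (int (mpoly_dim (vanishing_forms n d S)) - int ((m - 1 + n) choose n)))"
proof -
  have "graded_part n d (point_ideal n (proj_point n ` S) \<inter> ideal_power n (point_ideal n {P}) m)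
      = vanishing_forms n d S \<inter> ideal_power n (point_ideal n {P}) m" for P
    using graded_part_point_ideal[OF assms, of d] by (auto simp: graded_part_def)
  then show ?thesis unfolding admits_unexpected_def graded_part_point_ideal[OF assms] by simp
qed

lemma dim_pos:
  assumes "mp.subspace W" "W \<subseteq> forms n d" "f \<in> W" "f \<noteq> 0"
  shows "mpoly_dim (W :: 'k::field mpoly set) > 0"
proof -
  obtain B where "finite B" "forms n d \<subseteq> mp.span (B :: 'k mpoly set)"
    by (rule finite_spanning_set_forms)
  then have "mpoly_dim {0 :: 'k mpoly} < mpoly_dim W"
    using assms by (intro mp.subspace_dim_less[of W B _ f]) (auto simp: mp.subspace_0)
  then show ?thesis by simp
qed

text \<open>The dimension bound makes the right side of the inequality 0, so one nonzero form
  suffices; bound and form both persist when the degree is raised.\<close>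

definition strongly_unexpected :: "nat \<Rightarrow> nat \<Rightarrow> nat \<Rightarrow> (nat \<Rightarrow> 'k::field) set \<Rightarrow> bool" where
  "strongly_unexpected n d m S \<longleftrightarrow> finite S \<and> S \<subseteq> homog_coords n \<and>
    mpoly_dim (vanishing_forms n d S) \<le> (m - 1 + n) choose n \<and>
    (\<exists>e G. G \<in> forms n e \<and> G \<noteq> 0 \<and> (\<forall>v\<in>homog_coords n. mpoly_eval v G \<noteq> 0 \<longrightarrow>
      (\<exists>f\<in>vanishing_forms n d S. f \<noteq> 0 \<and> f \<in> ideal_power n (point_ideal n {proj_point n v}) m)))"

lemma strongly_unexpected_imp:
  fixes S :: "(nat \<Rightarrow> 'k::field_char_0) set"
  assumes "strongly_unexpected n d m S"
  shows "\<exists>Z :: (nat \<Rightarrow> 'k) set set. finite Z \<and> Z \<subseteq> proj_space n \<and> admits_unexpected n d m Z"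
proof (intro exI conjI)
  show "finite (proj_point n ` S)" "proj_point n ` S \<subseteq> proj_space n"
    using assms by (auto simp: strongly_unexpected_def proj_space_eq)
  obtain e G where G: "G \<in> forms n e" "G \<noteq> 0"
    and f: "\<And>v. v \<in> homog_coords n \<Longrightarrow> mpoly_eval v G \<noteq> 0 \<Longrightarrow>
      \<exists>f\<in>vanishing_forms n d S. f \<noteq> 0 \<and> f \<in> ideal_power n (point_ideal n {proj_point n v}) m"
    using assms unfolding strongly_unexpected_def by blast
  have S: "S \<subseteq> homog_coords n" using assms by (simp add: strongly_unexpected_def)
  show "admits_unexpected n d m (proj_point n ` S)"
    unfolding admits_unexpected_iff[OF S]
  proof (rule for_general_pointI[OF G])
    fix v :: "nat \<Rightarrow> 'k" assume "v \<in> homog_coords n" "mpoly_eval v G \<noteq> 0"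
    then obtain f where "f \<in> vanishing_forms n d S \<inter> ideal_power n (point_ideal n {proj_point n v}) m" "f \<noteq> 0"
      using f by blast
    then have "mpoly_dim (vanishing_forms n d S \<inter> ideal_power n (point_ideal n {proj_point n v}) m) > 0"
      by (intro dim_pos[of _ n d f] subspace_vanishing_power ideal_point_ideal)
        (auto simp: vanishing_forms_def)
    moreover have "mpoly_dim (vanishing_forms n d S) \<le> (m - 1 + n) choose n"
      using assms by (simp add: strongly_unexpected_def)
    ultimately show "max 0 (int (mpoly_dim (vanishing_forms n d S)) - int (m - 1 + n choose n))
        < int (mpoly_dim (vanishing_forms n d S \<inter> ideal_power n (point_ideal n {proj_point n v}) m))"
      by linarith
  qed
qed

text \<open>Take \<open>T\<close> with the fewest forms vanishing on it, measured by dimension: a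
  further point of \<open>Y\<close> imposing a condition would lower the dimension. Infinite sets
  can thus be used in place of finite ones.\<close>

lemma finite_points_suffice:
  fixes Y :: "(nat \<Rightarrow> 'k::field) set"
  obtains T where "finite T" "T \<subseteq> Y" "vanishing_forms n d T = vanishing_forms n d Y"
proof -
  obtain B where B: "finite B" "forms n d \<subseteq> mp.span (B :: 'k mpoly set)"
    by (rule finite_spanning_set_forms)
  obtain T where T: "finite T \<and> T \<subseteq> Y"
    and min: "\<And>T'. finite T' \<and> T' \<subseteq> Y \<Longrightarrow> mpoly_dim (vanishing_forms n d T) \<le> mpoly_dim (vanishing_forms n d T')"
    using ex_has_least_nat[of "\<lambda>T. finite T \<and> T \<subseteq> Y" "{}" "\<lambda>T. mpoly_dim (vanishing_forms n d T)"] by auto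
  have "mpoly_eval y f = 0" if f: "f \<in> vanishing_forms n d T" and y: "y \<in> Y" for f y
  proof (rule ccontr)
    assume ne: "mpoly_eval y f \<noteq> 0"
    have "mpoly_dim (vanishing_forms n d (insert y T)) < mpoly_dim (vanishing_forms n d T)"
      using f ne B vanishing_forms_subset[of n d T]
      by (intro mp.subspace_dim_less[of _ B _ f] subspace_vanishing_forms) (auto simp: vanishing_forms_def)
    then show False using min[of "insert y T"] T y by auto
  qed
  then have "vanishing_forms n d T = vanishing_forms n d Y"
    using T by (auto simp: vanishing_forms_def)
  then show ?thesis using that T by blast
qed

subsection \<open>Raising the degree\<close>

interpretation const_hom: coeff_hom "Const :: 'k::comm_ring_1 \<Rightarrow> _"
  by unfold_locales (simp_all add: Const_def single_add mult_single)

lemma mpoly_eval_const_subst: "mpoly_eval v (const_hom.subst X p) = mpoly_eval (\<lambda>i. mpoly_eval v (X i)) p"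
  unfolding mpoly_eval_eq_subst[of _ p]
  by (rule const_hom.subst_comp) (unfold_locales, simp_all)

lemma monomials_SucE:
  assumes "t \<in> monomials n (Suc d)"
  obtains i t' where "i \<le> n" "t' \<in> monomials n d" "t = Poly_Mapping.single i 1 + t'"
proof -
  have "t \<noteq> 0" using assms by (auto simp: monomials_def total_degree_def)
  then obtain i where i: "i \<in> Poly_Mapping.keys t" by (metis keys_eq_empty ex_in_conv)
  define t' where "t' = t - Poly_Mapping.single i 1"
  have t: "t = Poly_Mapping.single i 1 + t'"
    using i by (intro poly_mapping_eqI) (auto simp: t'_def lookup_add lookup_minus lookup_single in_keys_iff when_def)
  moreover have "Poly_Mapping.keys t' \<subseteq> Poly_Mapping.keys t"
    by (auto simp: t'_def in_keys_iff lookup_minus)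
  then have "t' \<in> monomials n d"
    using assms arg_cong[OF t, of total_degree] by (auto simp: monomials_def total_degree_add)
  moreover have "i \<le> n" using i assms by (auto simp: monomials_def)
  ultimately show ?thesis using that by blast
qed

lemma single_add_monomial:
  "Poly_Mapping.single (Poly_Mapping.single i 1 + t) 1 = Var i * Poly_Mapping.single t (1 :: 'k::comm_ring_1)"
  by (simp add: Var_def mult_single)

lemma forms_const_subst:
  assumes "p \<in> forms n d" "\<And>i. i \<le> n \<Longrightarrow> X i \<in> forms n 1"
  shows "const_hom.subst X p \<in> forms n d"
  unfolding const_hom.subst_def
proof (intro forms_sum forms_Const_mult)
  fix t assume "t \<in> Poly_Mapping.keys p"
  then have t: "t \<in> monomials n d" using assms(1) by (auto simp: forms_eq)
  have "(\<Prod>i\<in>Poly_Mapping.keys t. X i ^ Poly_Mapping.lookup t i)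
      \<in> forms n (\<Sum>i\<in>Poly_Mapping.keys t. Poly_Mapping.lookup t i * 1)"
    using t assms(2) by (intro forms_prod forms_power) (auto simp: monomials_def)
  then show "mono_eval X t \<in> forms n d"
    using t by (simp add: mono_eval_def monomials_def total_degree_def)
qed

text \<open>Division by the linear form \<open>Var 0 - R\<close>, whose remainder is the result of
  substituting \<open>R\<close> for \<open>Var 0\<close>.\<close>

lemma hyperplane_substitution:
  fixes R :: "'k::field mpoly"
  assumes p: "p \<in> forms n (Suc d)" and R: "R \<in> forms n 1"
  defines "X \<equiv> (\<lambda>i. if i = 0 then R else Var i)"
  shows "\<exists>g\<in>forms n d. p - const_hom.subst X p = (Var 0 - R) * g"
proof -
  let ?m = "\<lambda>t. Poly_Mapping.single t (1 :: 'k)"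
  let ?s = "const_hom.subst X"
  have X: "X i \<in> forms n 1" if "i \<le> n" for i using that R by (simp add: X_def forms_Var)
  \<comment> \<open>In degree 0 the truncated \<open>d - 1\<close> leaves no room for a quotient;
    the clause g = 0 then keeps \<open>Var i * g\<close> in the right degree.\<close>
  have mono: "\<exists>g\<in>forms n (d - 1). (d = 0 \<longrightarrow> g = 0) \<and> ?m t - ?s (?m t) = (Var 0 - R) * g"
    if "t \<in> monomials n d" for t d
    using that
  proof (induct d arbitrary: t)
    case 0
    then have "t = 0" by (auto simp: monomials_def total_degree_def in_keys_iff intro!: poly_mapping_eqI)
    then have "?m t = 1" by simp
    then have "?m t - ?s (?m t) = 0" by (simp del: const_hom.subst_single)
    then show ?case by (auto simp del: const_hom.subst_single)
  next
    case (Suc d)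
    from \<open>t \<in> monomials n (Suc d)\<close> obtain i t' where
      t: "i \<le> n" "t' \<in> monomials n d" "t = Poly_Mapping.single i 1 + t'" by (rule monomials_SucE)
    obtain g where g: "g \<in> forms n (d - 1)" "d = 0 \<longrightarrow> g = 0" "?m t' - ?s (?m t') = (Var 0 - R) * g"
      using Suc.hyps[OF t(2)] by blast
    define h where "h = (if i = 0 then ?s (?m t') else 0)"
    have mt: "?m t = Var i * ?m t'" using single_add_monomial t(3) by simp
    have "?m t' \<in> forms n d" using t(2) by (simp add: forms_eq)
    then have h: "h \<in> forms n d"
      using forms_const_subst[of "?m t'" n d X] X by (simp add: h_def del: const_hom.subst_single)
    have "Var i * g \<in> forms n d"
      using forms_mult[OF forms_Var[OF t(1)] g(1)] g(2) by (cases "d = 0") auto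
    then have "Var i * g + h \<in> forms n d" using h by (rule forms_add)
    moreover have "(Var i - X i) * ?s (?m t') = (Var 0 - R) * h"
      by (simp add: X_def h_def)
    then have "?m t - ?s (?m t) = (Var 0 - R) * (Var i * g + h)"
    proof -
      assume 1: "(Var i - X i) * ?s (?m t') = (Var 0 - R) * h"
      have "?m t - ?s (?m t) = Var i * (?m t' - ?s (?m t')) + (Var i - X i) * ?s (?m t')"
        unfolding mt const_hom.subst_mult const_hom.subst_Var by (simp only: right_diff_distrib left_diff_distrib) simp
      also have "\<dots> = (Var 0 - R) * (Var i * g + h)"
        unfolding 1 g(3) by (simp only: distrib_left mult.left_commute)
      finally show ?thesis .
    qed
    ultimately show ?case by auto
  qed
  have "\<exists>g\<in>forms n d. ?m t - ?s (?m t) = (Var 0 - R) * g" if "t \<in> Poly_Mapping.keys p" for t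
    using mono[of t "Suc d"] that p by (auto simp: forms_eq simp del: const_hom.subst_single)
  then obtain g where g: "\<And>t. t \<in> Poly_Mapping.keys p \<Longrightarrow> g t \<in> forms n d"
    "\<And>t. t \<in> Poly_Mapping.keys p \<Longrightarrow> ?m t - ?s (?m t) = (Var 0 - R) * g t" by metis
  let ?g = "\<Sum>t\<in>Poly_Mapping.keys p. Const (Poly_Mapping.lookup p t) * g t"
  have p_eq: "p = (\<Sum>t\<in>Poly_Mapping.keys p. Const (Poly_Mapping.lookup p t) * ?m t)"
    using poly_mapping_sum_single[of p] by (simp add: Const_def mult_single)
  have "?s p = (\<Sum>t\<in>Poly_Mapping.keys p. Const (Poly_Mapping.lookup p t) * ?s (?m t))"
    by (subst p_eq) (simp add: const_hom.subst_sum const_hom.subst_mult del: const_hom.subst_single)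
  then have "p - ?s p = (\<Sum>t\<in>Poly_Mapping.keys p. Const (Poly_Mapping.lookup p t) * (?m t - ?s (?m t)))"
    by (subst (1) p_eq) (simp add: sum_subtractf right_diff_distrib del: const_hom.subst_single)
  also have "\<dots> = (Var 0 - R) * ?g"
    by (simp add: g(2) sum_distrib_left mult.left_commute cong: sum.cong del: const_hom.subst_single)
  finally show ?thesis using g(1) by (intro bexI[of _ ?g] forms_sum forms_Const_mult)
qed

lemma vanishing_on_hyperplane_imp_multiple:
  fixes f :: "'k::field_char_0 mpoly"
  assumes f: "f \<in> forms n (Suc d)"
    and van: "\<And>v. v \<in> homog_coords n \<Longrightarrow> v 0 = (\<Sum>i=1..n. c i * v i) \<Longrightarrow> mpoly_eval v f = 0"
  shows "\<exists>g\<in>forms n d. f = (Var 0 - (\<Sum>i=1..n. Const (c i) * Var i)) * g"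
proof -
  define R where "R = (\<Sum>i=1..n. Const (c i) * Var i)"
  define X where "X = (\<lambda>i. if i = 0 then R else Var i)"
  have R: "R \<in> forms n 1"
    unfolding R_def by (intro forms_sum forms_Const_mult forms_Var) auto
  have "const_hom.subst X f = 0"
  proof (rule form_eq_0I[of _ n "Suc d"])
    show "const_hom.subst X f \<in> forms n (Suc d)"
      using f by (rule forms_const_subst) (use R in \<open>simp add: X_def\<close>)
    fix v :: "nat \<Rightarrow> 'k" assume v: "v \<in> homog_coords n"
    define w where "w i = mpoly_eval v (X i)" for i
    have w0: "w 0 = (\<Sum>i=1..n. c i * v i)" and wi: "i > 0 \<Longrightarrow> w i = v i" for i
      by (simp_all add: w_def X_def R_def)
    \<comment> \<open>The substituted vector may be 0 and so no projective point; there
      \<open>f\<close> vanishes because its degree is positive.\<close>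
    have "mpoly_eval w f = 0"
    proof (cases "\<exists>i. w i \<noteq> 0")
      case True
      have "w i = 0" if "i > n" for i using that v wi[of i] by (auto simp: homog_coords_def)
      then have "w \<in> homog_coords n" using True by (auto simp: homog_coords_def)
      moreover have "w 0 = (\<Sum>i=1..n. c i * w i)" unfolding w0 by (intro sum.cong) (auto simp: wi)
      ultimately show ?thesis by (rule van)
    next
      case False
      then have "w = (\<lambda>i. 0 * v i)" by auto
      then show ?thesis using mpoly_eval_form_scale[OF f, of 0 v] by simp
    qed
    moreover have "w = (\<lambda>i. mpoly_eval v (X i))" by (rule ext) (simp add: w_def)
    ultimately show "mpoly_eval v (const_hom.subst X f) = 0"
      by (simp add: mpoly_eval_const_subst)
  qed
  moreover have "\<exists>g\<in>forms n d. f - const_hom.subst X f = (Var 0 - R) * g"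
    unfolding X_def by (rule hyperplane_substitution[OF f R])
  ultimately have "\<exists>g\<in>forms n d. f = (Var 0 - R) * g" by (metis diff_zero)
  then show ?thesis unfolding R_def .
qed

text \<open>The coefficients lie on the moment curve: each \<open>v\<close> is a nonzero coefficient
  vector of a polynomial in \<tau> and excludes only its finitely many roots.\<close>

lemma hyperplane_avoiding:
  fixes S :: "(nat \<Rightarrow> 'k::field_char_0) set"
  assumes "finite S" "S \<subseteq> homog_coords n"
  obtains \<tau> where "\<And>v. v \<in> S \<Longrightarrow> (\<Sum>i\<le>n. \<tau> ^ i * v i) \<noteq> 0"
proof -
  define q where "q v = (\<Sum>i\<le>n. monom (v i) i)" for v :: "nat \<Rightarrow> 'k"
  have "q v \<noteq> 0" if "v \<in> S" for v
  proof -
    have "v \<in> homog_coords n" using that assms(2) by blast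
    then have v: "\<forall>i>n. v i = 0" "\<exists>i. v i \<noteq> 0" by (simp_all add: homog_coords_def)
    then obtain i where i: "v i \<noteq> 0" by blast
    then have "i \<le> n" using v(1) not_le by blast
    with i have "coeff (q v) i \<noteq> 0" by (simp add: q_def coeff_sum coeff_monom)
    then show ?thesis by (metis coeff_0)
  qed
  then have "prod q S \<noteq> 0" using assms(1) by simp
  then obtain \<tau> where "poly (prod q S) \<tau> \<noteq> 0" using poly_all_0_iff_0 by blast
  then have "\<And>v. v \<in> S \<Longrightarrow> poly (q v) \<tau> \<noteq> 0" using assms(1) unfolding poly_prod by (simp add: prod_zero_iff)
  then show ?thesis using that[of \<tau>] by (simp add: q_def poly_sum poly_monom mult.commute)
qed

lemma strongly_unexpected_Suc:
  fixes S :: "(nat \<Rightarrow> 'k::field_char_0) set"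
  assumes su: "strongly_unexpected n d m S"
  shows "\<exists>S' :: (nat \<Rightarrow> 'k) set. strongly_unexpected n (Suc d) m S'"
proof -
  have S: "finite S" "S \<subseteq> homog_coords n" using su by (auto simp: strongly_unexpected_def)
  obtain \<tau> where \<tau>: "\<And>v. v \<in> S \<Longrightarrow> (\<Sum>i\<le>n. \<tau> ^ i * v i) \<noteq> 0"
    using hyperplane_avoiding[OF S] by blast
  \<comment> \<open>The equation of the hyperplane is solved for \<open>Var 0\<close>, whose
    coefficient \<tau>^0 is 1.\<close>
  define c where "c i = - (\<tau> ^ i)" for i
  define l where "l = Var 0 - (\<Sum>i=1..n. Const (c i) * Var i)"
  have l_form: "l \<in> forms n 1"
    unfolding l_def by (intro forms_diff forms_sum forms_Const_mult forms_Var) auto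
  have l_eval: "mpoly_eval v l = v 0 - (\<Sum>i=1..n. c i * v i)" for v
    by (simp add: l_def)
  have l_eval': "mpoly_eval v l = (\<Sum>i\<le>n. \<tau> ^ i * v i)" for v
    by (simp add: l_eval c_def sum_negf atMost_atLeast0 sum.atLeast_Suc_atMost)
  have "mpoly_eval (\<lambda>i. if i = 0 then 1 else 0) l = 1"
    by (simp add: l_eval)
  then have l_nz: "l \<noteq> 0" by force
  have l_scale: "l * mpoly_scale a g = mpoly_scale a (l * g)" for a g
    by (simp add: mpoly_scale_eq mult.left_commute)
  define H where "H = {v \<in> homog_coords n. mpoly_eval v l = 0}"
  obtain T where T: "finite T" "T \<subseteq> H" "vanishing_forms n (Suc d) T = vanishing_forms n (Suc d) H"
    by (rule finite_points_suffice)
  define S' where "S' = S \<union> T"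
  obtain B where B: "finite B" "forms n d \<subseteq> mp.span (B :: 'k mpoly set)"
    by (rule finite_spanning_set_forms)
  let ?V = "vanishing_forms n d S"
  obtain C where C: "C \<subseteq> ?V" "mp.independent C" "?V \<subseteq> mp.span C" "card C = mpoly_dim ?V"
    by (rule mp.basis_exists)
  have finC: "finite C"
    using mp.independent_span_bound[OF B(1) C(2)] C(1) B(2) vanishing_forms_subset[of n d S] by blast
  \<comment> \<open>Vanishing on \<open>T\<close> forces the factor \<open>l\<close>; as
    \<open>l\<close> has no zero in \<open>S\<close>, the cofactor vanishes on \<open>S\<close>. So
    \<open>l\<close> times a basis spans and the dimension does not grow.\<close>
  have "vanishing_forms n (Suc d) S' \<subseteq> mp.span ((\<lambda>g. l * g) ` C)"
  proof
    fix f assume f: "f \<in> vanishing_forms n (Suc d) S'"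
    then have "f \<in> vanishing_forms n (Suc d) H"
      unfolding T(3)[symmetric] by (auto simp: S'_def vanishing_forms_def)
    then have "mpoly_eval v f = 0" if "v \<in> homog_coords n" "v 0 = (\<Sum>i=1..n. c i * v i)" for v
      using that by (simp add: vanishing_forms_def H_def l_eval)
    then obtain g where g: "g \<in> forms n d" "f = l * g"
      using vanishing_on_hyperplane_imp_multiple[of f n d c] f unfolding l_def by (auto simp: vanishing_forms_def)
    have "mpoly_eval v g = 0" if "v \<in> S" for v
      using f that \<tau>[OF that] by (auto simp: vanishing_forms_def S'_def g(2) l_eval')
    then have "g \<in> mp.span C" using g(1) C(3) by (auto simp: vanishing_forms_def)
    moreover have "mp.span C \<subseteq> {g. l * g \<in> mp.span ((\<lambda>g. l * g) ` C)}"
    proof (rule mp.span_minimal)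
      show "C \<subseteq> {g. l * g \<in> mp.span ((\<lambda>g. l * g) ` C)}" by (auto intro: mp.span_base)
      show "mp.subspace {g. l * g \<in> mp.span ((\<lambda>g. l * g) ` C)}"
        by (auto simp: mp.subspace_def distrib_left mp.span_zero mp.span_add l_scale mp.span_scale)
    qed
    ultimately show "f \<in> mp.span ((\<lambda>g. l * g) ` C)" unfolding g(2) by blast
  qed
  then have "mpoly_dim (vanishing_forms n (Suc d) S') \<le> card ((\<lambda>g. l * g) ` C)"
    using finC by (intro mp.dim_le_card) auto
  also have "\<dots> \<le> mpoly_dim ?V" unfolding C(4)[symmetric] using finC by (rule card_image_le)
  also have "\<dots> \<le> (m - 1 + n) choose n" using su by (simp add: strongly_unexpected_def)
  finally have dim: "mpoly_dim (vanishing_forms n (Suc d) S') \<le> (m - 1 + n) choose n" .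
  have ex: "\<exists>f\<in>vanishing_forms n (Suc d) S'. f \<noteq> 0 \<and> f \<in> ideal_power n (point_ideal n {P}) m"
    if P: "\<exists>f\<in>?V. f \<noteq> 0 \<and> f \<in> ideal_power n (point_ideal n {P}) m" for P
  proof -
    obtain f where f: "f \<in> ?V" "f \<noteq> 0" "f \<in> ideal_power n (point_ideal n {P}) m" using P by blast
    have "l * f \<in> ideal_power n (point_ideal n {P}) m"
      using ideal.I_l_closed[OF ideal_ideal_power[OF ideal_point_ideal] f(3) forms_carrier[OF l_form]] by simp
    moreover have "l * f \<in> vanishing_forms n (Suc d) S'"
      using f(1) forms_mult[OF l_form, of f d] T(2) by (auto simp: vanishing_forms_def S'_def H_def)
    ultimately show ?thesis using f(2) l_nz by (intro bexI[of _ "l * f"]) auto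
  qed
  obtain e G where "G \<in> forms n e" "G \<noteq> 0"
    "\<forall>v\<in>homog_coords n. mpoly_eval v G \<noteq> 0 \<longrightarrow>
      (\<exists>f\<in>?V. f \<noteq> 0 \<and> f \<in> ideal_power n (point_ideal n {proj_point n v}) m)"
    using su unfolding strongly_unexpected_def by auto
  moreover have "S' \<subseteq> homog_coords n" "finite S'" using S T by (auto simp: S'_def H_def)
  ultimately have "strongly_unexpected n (Suc d) m S'"
    unfolding strongly_unexpected_def using dim ex
    by (intro conjI exI[of _ e] exI[of _ G]) simp_all
  then show ?thesis ..
qed

lemma strongly_unexpected_raise:
  fixes S :: "(nat \<Rightarrow> 'k::field_char_0) set"
  assumes "strongly_unexpected n d m S" "d \<le> d'"
  shows "\<exists>S' :: (nat \<Rightarrow> 'k) set. strongly_unexpected n d' m S'"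
  using assms(2,1)
proof (induct d' arbitrary: S rule: dec_induct)
  case (step k)
  then show ?case using strongly_unexpected_Suc by blast
qed blast

subsection \<open>Coefficients of forms\<close>

lemma mpoly_eval_forms:
  "f \<in> forms n d \<Longrightarrow> mpoly_eval v f = (\<Sum>t\<in>monomials n d. Poly_Mapping.lookup f t * mono_eval v t)"
  unfolding mpoly_eval_eq_subst by (rule ev.subst_superset) (simp_all add: card_monomials forms_eq)

lemma prod_monom: "(\<Prod>i\<in>A. monom (a i) (e i)) = monom (\<Prod>i\<in>A. a i :: 'k::comm_ring_1) (\<Sum>i\<in>A. e i)"
  by (induct A rule: infinite_finite_induct) (simp_all add: mult_monom)

lemma mono_eval_monom:
  "mono_eval (\<lambda>i. monom (a i :: 'k::comm_ring_1) (e i)) t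
    = monom (mono_eval a t) (\<Sum>i\<in>Poly_Mapping.keys t. e i * Poly_Mapping.lookup t i)"
  by (simp add: mono_eval_def monom_power prod_monom mult.commute)

text \<open>All variables except x_j are fixed; coefficient \<open>r\<close> collects the monomials
  of exponent \<open>r\<close> in x_j.\<close>

lemma coeff_subst_monom:
  assumes "f \<in> forms n d"
  shows "coeff (poly_hom.subst (\<lambda>i. monom (a i) (if i = j then 1 else 0)) f) r
    = (\<Sum>t | t \<in> monomials n d \<and> Poly_Mapping.lookup t j = r. Poly_Mapping.lookup f t * mono_eval a t)"
proof -
  have e: "(\<Sum>i\<in>Poly_Mapping.keys t. (if i = j then 1 else 0) * Poly_Mapping.lookup t i) = Poly_Mapping.lookup t j" for t :: "nat \<Rightarrow>\<^sub>0 nat"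
    by (simp add: if_distrib [of "\<lambda>x. x * _"] in_keys_iff cong: if_cong)
  have "poly_hom.subst (\<lambda>i. monom (a i) (if i = j then 1 else 0)) f
      = (\<Sum>t\<in>monomials n d. [:Poly_Mapping.lookup f t:] * monom (mono_eval a t) (Poly_Mapping.lookup t j))"
    by (subst poly_hom.subst_superset[of "monomials n d"])
      (use assms in \<open>simp_all only: card_monomials forms_eq mem_Collect_eq mono_eval_monom e\<close>)
  then have "coeff (poly_hom.subst (\<lambda>i. monom (a i) (if i = j then 1 else 0)) f) r
      = (\<Sum>t\<in>monomials n d. if Poly_Mapping.lookup t j = r then Poly_Mapping.lookup f t * mono_eval a t else 0)"
    by (simp add: coeff_sum if_distrib cong: if_cong)
  also have "\<dots> = (\<Sum>t | t \<in> monomials n d \<and> Poly_Mapping.lookup t j = r. Poly_Mapping.lookup f t * mono_eval a t)"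
    using card_monomials(1) by (simp add: sum.inter_filter)
  finally show ?thesis .
qed

lemma monomials_divisibleE:
  assumes "t \<in> monomials n (k + d)" "k \<le> Poly_Mapping.lookup t j"
  obtains t' where "t' \<in> monomials n d" "t = Poly_Mapping.single j k + t'"
proof -
  define t' where "t' = t - Poly_Mapping.single j k"
  have t: "t = Poly_Mapping.single j k + t'"
    using assms(2) by (intro poly_mapping_eqI) (auto simp: t'_def lookup_add lookup_minus lookup_single when_def)
  moreover have "Poly_Mapping.keys t' \<subseteq> Poly_Mapping.keys t"
    by (auto simp: t'_def in_keys_iff lookup_minus)
  then have "t' \<in> monomials n d"
    using assms arg_cong[OF t, of total_degree] by (auto simp: monomials_def total_degree_add)
  ultimately show ?thesis using that by blast
qed

lemma monomials_0 [simp]: "monomials n 0 = {0}"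
  by (auto simp: monomials_def total_degree_def in_keys_iff intro!: poly_mapping_eqI)

lemma monomials_1E:
  assumes "t \<in> monomials n 1"
  obtains i where "i \<le> n" "t = Poly_Mapping.single i 1"
proof -
  have "t \<in> monomials n (Suc 0)" using assms by simp
  then obtain i t' where "i \<le> n" "t' \<in> monomials n 0" "t = Poly_Mapping.single i 1 + t'"
    by (rule monomials_SucE)
  then show ?thesis using that by simp
qed

lemma single_in_monomials: "i \<le> n \<Longrightarrow> Poly_Mapping.single i d \<in> monomials n d"
  by (simp add: monomials_def)

definition basis_vec :: "nat \<Rightarrow> nat \<Rightarrow> 'k::field" where
  "basis_vec i j = (if j = i then 1 else 0)"

lemma basis_vec_homog [simp]: "i \<le> n \<Longrightarrow> basis_vec i \<in> homog_coords n"
  by (auto simp: basis_vec_def homog_coords_def)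

lemma mpoly_eval_basis_vec:
  assumes f: "f \<in> forms n d" and i: "i \<le> n"
  shows "mpoly_eval (basis_vec i) f = Poly_Mapping.lookup f (Poly_Mapping.single i d)"
proof -
  have "Poly_Mapping.lookup f t * mono_eval (basis_vec i) t = (if t = Poly_Mapping.single i d then Poly_Mapping.lookup f t else 0)"
    if t: "t \<in> monomials n d" for t
  proof (cases "Poly_Mapping.keys t \<subseteq> {i}")
    case True
    then have "t = Poly_Mapping.single i (Poly_Mapping.lookup t i)"
      by (intro poly_mapping_eqI) (auto simp: lookup_single when_def in_keys_iff)
    moreover have "total_degree t = d" using t by (simp add: monomials_def)
    ultimately have "t = Poly_Mapping.single i d" by (metis total_degree_single)
    then show ?thesis by (simp add: basis_vec_def)
  next
    case False
    then obtain j where j: "j \<in> Poly_Mapping.keys t" "j \<noteq> i" by blast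
    then have "mono_eval (basis_vec i :: nat \<Rightarrow> 'a) t = 0"
      unfolding mono_eval_def by (intro prod_zero) (auto simp: basis_vec_def in_keys_iff)
    moreover have "t \<noteq> Poly_Mapping.single i d" using j by (auto simp: in_keys_iff lookup_single when_def)
    ultimately show ?thesis by simp
  qed
  then have "mpoly_eval (basis_vec i) f = (\<Sum>t\<in>monomials n d. if t = Poly_Mapping.single i d then Poly_Mapping.lookup f t else 0)"
    unfolding mpoly_eval_forms[OF f] by (intro sum.cong) auto
  also have "\<dots> = Poly_Mapping.lookup f (Poly_Mapping.single i d)"
    using i by (simp add: card_monomials single_in_monomials)
  finally show ?thesis .
qed

text \<open>Both constructions bound the dimension by exhibiting such a determining set
  \<open>I\<close> of monomials.\<close>

lemma dim_le_card_coefficients: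
  fixes W :: "'k::field mpoly set"
  assumes "finite I" "mp.subspace W" "W \<subseteq> forms n d"
    and "\<And>f. f \<in> W \<Longrightarrow> (\<And>t. t \<in> I \<Longrightarrow> Poly_Mapping.lookup f t = 0) \<Longrightarrow> f = 0"
  shows "mpoly_dim W \<le> card I"
proof -
  obtain B where B: "finite B" "forms n d \<subseteq> mp.span (B :: 'k mpoly set)"
    by (rule finite_spanning_set_forms)
  show ?thesis
    by (rule mp.dim_le_card_functionals[where \<phi> = "\<lambda>t f. Poly_Mapping.lookup f t" and B = B])
      (use assms B in \<open>auto simp: lookup_add\<close>)
qed

lemma poly_eq_0_of_roots:
  fixes p :: "'k::field poly"
  assumes "A \<subseteq> {x. poly p x = 0}" "\<And>r. r \<ge> card A \<Longrightarrow> coeff p r = 0"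
  shows "p = 0"
proof (rule ccontr)
  assume "p \<noteq> 0"
  then have "card A \<le> card {x. poly p x = 0}" using assms(1) poly_roots_finite by (intro card_mono) auto
  also have "\<dots> \<le> degree p" using card_poly_roots_bound[OF \<open>p \<noteq> 0\<close>] .
  finally show False using assms(2) \<open>p \<noteq> 0\<close> by (metis leading_coeff_0_iff)
qed

subsection \<open>Cones in dimension at least three\<close>

text \<open>The part \<open>g\<close> of \<open>f\<close> free of x_0 takes at v the value of
  \<open>f\<close> at v with x_0 set to 0. As \<open>l\<close> ignores x_0, \<open>g * l\<close>
  vanishes everywhere; \<open>l00\<close> ensures that the truncated vector is nonzero wherever
  \<open>l\<close> is.\<close>

lemma vanishing_on_coordinate_hyperplane:
  fixes f :: "'k::field_char_0 mpoly"
  assumes f: "f \<in> forms n d" and l: "l \<in> forms n e" "l \<noteq> 0"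
    and van: "\<And>v. v \<in> homog_coords n \<Longrightarrow> v 0 = 0 \<Longrightarrow> mpoly_eval v l \<noteq> 0 \<Longrightarrow> mpoly_eval v f = 0"
    and l0: "\<And>v w. (\<And>i. i > 0 \<Longrightarrow> v i = w i) \<Longrightarrow> mpoly_eval v l = mpoly_eval w l"
    and l00: "mpoly_eval (\<lambda>_. 0) l = 0"
    and t: "Poly_Mapping.lookup t 0 = 0"
  shows "Poly_Mapping.lookup f t = 0"
proof -
  let ?K = "{t \<in> monomials n d. Poly_Mapping.lookup t 0 = 0}"
  define g where "g = (\<Sum>t\<in>?K. Poly_Mapping.single t (Poly_Mapping.lookup f t))"
  have fin: "finite ?K" using card_monomials(1) by simp
  have g: "g \<in> forms n d" unfolding g_def by (intro forms_sum) (auto simp: forms_eq)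
  have "g * l = 0"
  proof (rule form_eq_0I[OF forms_mult[OF g l(1)]])
    fix v :: "nat \<Rightarrow> 'k" assume v: "v \<in> homog_coords n"
    define w where "w = v(0 := 0)"
    have "mpoly_eval v g = (\<Sum>t\<in>?K. Poly_Mapping.lookup f t * mono_eval v t)"
      by (simp add: g_def mpoly_eval_eq_subst ev.subst_sum)
    also have "\<dots> = (\<Sum>t\<in>?K. Poly_Mapping.lookup f t * mono_eval w t)"
      by (intro sum.cong refl arg_cong2[where f = "(*)"] mono_eval_cong) (auto simp: w_def in_keys_iff)
    also have "\<dots> = (\<Sum>t\<in>monomials n d. Poly_Mapping.lookup f t * mono_eval w t)"
    proof (rule sum.mono_neutral_left)
      show "\<forall>t\<in>monomials n d - ?K. Poly_Mapping.lookup f t * mono_eval w t = 0"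
      proof
        fix t assume t: "t \<in> monomials n d - ?K"
        then have "mono_eval w t = 0"
          unfolding mono_eval_def by (intro prod_zero) (auto simp: w_def in_keys_iff intro!: bexI[of _ 0])
        then show "Poly_Mapping.lookup f t * mono_eval w t = 0" by simp
      qed
    qed (auto simp: card_monomials)
    also have "\<dots> = mpoly_eval w f" using mpoly_eval_forms[OF f] by simp
    finally have vg: "mpoly_eval v g = mpoly_eval w f" .
    show "mpoly_eval v (g * l) = 0"
    proof (cases "mpoly_eval v l = 0")
      case False
      have wl: "mpoly_eval w l \<noteq> 0" using l0[of v w] False by (simp add: w_def)
      then have "w \<noteq> (\<lambda>_. 0)" using l00 by auto
      then have "w \<in> homog_coords n" using v by (auto simp: w_def homog_coords_def fun_eq_iff)
      then have "mpoly_eval w f = 0" using van[of w] wl by (simp add: w_def)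
      then show ?thesis by (simp add: vg)
    qed simp
  qed
  then have "g = 0" using l(2) by simp
  then have "Poly_Mapping.lookup g t = 0" by simp
  moreover have "Poly_Mapping.lookup g t = (if t \<in> ?K then Poly_Mapping.lookup f t else 0)"
    using fin by (simp add: g_def lookup_sum lookup_single when_def)
  ultimately show ?thesis using t f by (cases "t \<in> monomials n d") (auto simp: forms_iff)
qed

lemma strongly_unexpected_cone:
  assumes n: "n \<ge> 3" and m: "m \<ge> 2"
  shows "\<exists>S :: (nat \<Rightarrow> 'k::field_char_0) set. strongly_unexpected n m m S"
proof -
  \<comment> \<open>The m - 1 subspaces x_0 = x_1 - j x_2 = 0, distinct in characteristic 0. The
    m-th codimension-two subspace is x_(n-1) = x_n = 0.\<close>
  define Y :: "(nat \<Rightarrow> 'k) set" where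
    "Y = {v \<in> homog_coords n. v 0 = 0 \<and> (\<exists>j\<in>{1..m - 1}. v 1 = of_nat j * v 2)}"
  obtain T where T: "finite T" "T \<subseteq> Y" "vanishing_forms n m T = vanishing_forms n m Y"
    by (rule finite_points_suffice)
  \<comment> \<open>\<open>u 0\<close> is the coordinate point e_0, and \<open>u i\<close> is e_0 +
    e_i otherwise. Together with e_1 they lie on x_(n-1) = x_n = 0; for e_1 this needs n \<ge>
    3.\<close>
  define u :: "nat \<Rightarrow> nat \<Rightarrow> 'k" where "u i = (\<lambda>j. if j = 0 \<or> j = i then 1 else 0)" for i
  define S where "S = T \<union> insert (basis_vec 1) (u ` {0..n - 2})"
  let ?mon = "\<lambda>i. Poly_Mapping.single i (m - 1) :: nat \<Rightarrow>\<^sub>0 nat"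
  let ?x = "\<lambda>i. Poly_Mapping.single i 1 :: nat \<Rightarrow>\<^sub>0 nat"
  define R where "R = ?mon ` {0..n - 2}"
  \<comment> \<open>If the n - 1 coefficients of x_1^(m-1) x_i with i \<ge> 2 vanish, then f = x_0
    q. The n - 1 points \<open>u i\<close> account for the pure powers x_i^(m-1) with i \<le> n - 2
    in q, so these are left out of \<open>I\<close> and the two counts balance.\<close>
  define I where "I = (+) (?x 0) ` (monomials n (m - 1) - R) \<union> (\<lambda>i. ?mon 1 + ?x i) ` {2..n}"
  have S: "finite S" "S \<subseteq> homog_coords n"
    using T n by (auto simp: S_def Y_def u_def homog_coords_def basis_vec_def)
  have finI: "finite I" by (auto simp: I_def card_monomials)
  have inj: "inj_on ?mon A" for A :: "nat set"
    using m by (intro inj_onI) (metis keys_single singleton_inject diff_is_0_eq not_less_eq_eq numeral_2_eq_2 One_nat_def)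
  have R: "R \<subseteq> monomials n (m - 1)" by (auto simp: R_def single_in_monomials)
  have "card I \<le> card (monomials n (m - 1) - R) + card {2..n}"
    unfolding I_def by (intro order_trans[OF card_Un_le] add_mono card_image_le) (auto simp: card_monomials)
  also have "card (monomials n (m - 1) - R) = card (monomials n (m - 1)) - card R"
    using R by (intro card_Diff_subset) (simp_all add: R_def)
  also have "card R = n - 1" unfolding R_def card_image[OF inj] using n by simp
  also have "card (monomials n (m - 1)) - (n - 1) + card {2..n} = card (monomials n (m - 1))"
  proof -
    have "n - 1 \<le> card (monomials n (m - 1))"
      using card_mono[OF card_monomials(1) R] \<open>card R = n - 1\<close> by simp
    then show ?thesis using n by simp
  qed
  finally have cardI: "card I \<le> (m - 1 + n) choose n" by (simp add: card_monomials)
  have zero: "f = 0" if f: "f \<in> vanishing_forms n m S" and coeffs: "\<And>t. t \<in> I \<Longrightarrow> Poly_Mapping.lookup f t = 0" for f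
  proof -
    have form: "f \<in> forms n m" using f by (simp add: vanishing_forms_def)
    have "f \<in> vanishing_forms n m Y"
      unfolding T(3)[symmetric] using f by (auto simp: S_def vanishing_forms_def)
    then have Y: "mpoly_eval v f = 0" if "v \<in> Y" for v using that by (simp add: vanishing_forms_def)
    have x1: "Poly_Mapping.lookup f (Poly_Mapping.single 1 m) = 0"
      using f mpoly_eval_basis_vec[OF form, of 1] n by (simp add: vanishing_forms_def S_def)
    \<comment> \<open>As a polynomial in x_1, the restriction of \<open>f\<close> to x_0 = 0 has the
      m - 1 roots j v_2, while its coefficients from degree m - 1 on vanish.\<close>
    have van: "mpoly_eval v f = 0" if v: "v \<in> homog_coords n" "v 0 = 0" "v 2 \<noteq> 0" for v
    proof -
      define a where "a = v(1 := 1)"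
      define p where "p = poly_hom.subst (\<lambda>i. monom (a i) (if i = 1 then 1 else 0)) f"
      have p: "poly p s = mpoly_eval (v(1 := s)) f" for s
      proof -
        have "(\<lambda>i. poly (monom (a i) (if i = 1 then 1 else 0)) s) = v(1 := s)"
          by (rule ext) (simp add: a_def poly_monom)
        then show ?thesis by (simp add: p_def poly_subst)
      qed
      have "p = 0"
      proof (rule poly_eq_0_of_roots)
        let ?A = "(\<lambda>j. of_nat j * v 2) ` {1..m - 1}"
        have "inj_on (\<lambda>j. of_nat j * v 2) {1..m - 1}" using v(3) by (intro inj_onI) simp
        then have card: "card ?A = m - 1" by (simp add: card_image)
        have "v(1 := of_nat j * v 2) \<in> Y" if "j \<in> {1..m - 1}" for j
          using that v n by (auto simp: Y_def homog_coords_def intro!: bexI[of _ j] exI[of _ 2])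
        then show "?A \<subseteq> {x. poly p x = 0}" using Y by (auto simp: p)
        fix r assume r: "r \<ge> card ?A"
        have "Poly_Mapping.lookup f t * mono_eval a t = 0"
          if t: "t \<in> monomials n m" "Poly_Mapping.lookup t 1 = r" for t
        proof -
          have "t \<in> monomials n ((m - 1) + 1)" "m - 1 \<le> Poly_Mapping.lookup t 1"
            using t m r card by simp_all
          then obtain t' where "t' \<in> monomials n 1" "t = ?mon 1 + t'" by (rule monomials_divisibleE)
          then obtain i where i: "i \<le> n" "t = ?mon 1 + ?x i" by (metis monomials_1E)
          consider "i = 0" | "i = 1" | "i \<ge> 2" by linarith
          then show ?thesis
          proof cases
            case 1
            then show ?thesis using i v(2) by (simp add: mono_eval_add a_def)
          next
            case 2
            then have "t = Poly_Mapping.single 1 m" using i m by (simp flip: single_add)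
            then show ?thesis using x1 by simp
          next
            case 3
            then show ?thesis using i coeffs[of t] by (simp add: I_def)
          qed
        qed
        then show "coeff p r = 0"
          unfolding p_def coeff_subst_monom[OF form] by (intro sum.neutral) blast
      qed
      then show ?thesis using p[of "v 1"] by simp
    qed
    have x0: "Poly_Mapping.lookup f t = 0" if "Poly_Mapping.lookup t 0 = 0" for t
      using n by (intro vanishing_on_coordinate_hyperplane[OF form forms_Var[of 2 n]] van that) auto
    have keys: "t \<in> (+) (?x 0) ` R" if t: "t \<in> Poly_Mapping.keys f" for t
    proof -
      have nz: "Poly_Mapping.lookup f t \<noteq> 0" using t by (simp add: in_keys_iff)
      then have "Poly_Mapping.lookup t 0 \<ge> 1" using x0[of t] by (cases "Poly_Mapping.lookup t 0") auto
      moreover have "t \<in> monomials n (1 + (m - 1))" using t form m by (auto simp: forms_eq)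
      ultimately obtain t' where t': "t' \<in> monomials n (m - 1)" "t = ?x 0 + t'"
        by (metis monomials_divisibleE)
      then have "t' \<in> R" using nz coeffs[of t] by (auto simp: I_def)
      then show ?thesis using t' by blast
    qed
    have inj2: "inj_on (\<lambda>i. ?x 0 + ?mon i) {0..n - 2}"
      using inj[of "{0..n - 2}"] by (simp add: inj_on_def)
    have eval: "mpoly_eval v f = (\<Sum>i\<in>{0..n - 2}. Poly_Mapping.lookup f (?x 0 + ?mon i) * (v 0 * v i ^ (m - 1)))" for v
    proof -
      have "mpoly_eval v f = (\<Sum>t\<in>(\<lambda>i. ?x 0 + ?mon i) ` {0..n - 2}. Poly_Mapping.lookup f t * mono_eval v t)"
        unfolding mpoly_eval_eq_subst using keys by (intro ev.subst_superset) (auto simp: R_def)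
      then show ?thesis unfolding sum.reindex[OF inj2] by (simp add: mono_eval_add)
    qed
    \<comment> \<open>Treated first, because every \<open>u k\<close> also sees the monomial
      x_0^m.\<close>
    have u0: "Poly_Mapping.lookup f (?x 0 + ?mon 0) = 0"
    proof -
      have "mpoly_eval (u 0) f = 0" using f by (simp add: vanishing_forms_def S_def)
      moreover have "(\<Sum>i\<in>{0..n - 2}. Poly_Mapping.lookup f (?x 0 + ?mon i) * (u 0 0 * u 0 i ^ (m - 1)))
          = (\<Sum>i\<in>{0..n - 2}. if i = 0 then Poly_Mapping.lookup f (?x 0 + ?mon i) else 0)"
        using m by (intro sum.cong) (auto simp: u_def)
      ultimately show ?thesis unfolding eval by simp
    qed
    have "Poly_Mapping.lookup f (?x 0 + ?mon k) = 0" if k: "k \<in> {0..n - 2}" for k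
    proof -
      have "mpoly_eval (u k) f = 0" using f k by (simp add: vanishing_forms_def S_def)
      moreover have "(\<Sum>i\<in>{0..n - 2}. Poly_Mapping.lookup f (?x 0 + ?mon i) * (u k 0 * u k i ^ (m - 1)))
          = (\<Sum>i\<in>{0..n - 2}. if i = k then Poly_Mapping.lookup f (?x 0 + ?mon i) else 0)"
        using m u0 by (intro sum.cong) (auto simp: u_def)
      ultimately show ?thesis using k unfolding eval by simp
    qed
    then have "Poly_Mapping.lookup f t = 0" if "t \<in> Poly_Mapping.keys f" for t
      using keys[OF that] by (auto simp: R_def)
    then show ?thesis by (intro poly_mapping_eqI) (metis in_keys_iff lookup_zero)
  qed
  have dim: "mpoly_dim (vanishing_forms n m S) \<le> (m - 1 + n) choose n"
    using dim_le_card_coefficients[OF finI subspace_vanishing_forms vanishing_forms_subset zero] cardI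
    by (rule order_trans)
  \<comment> \<open>\<open>h v\<close> is the hyperplane through v and x_(n-1) = x_n = 0, and
    \<open>l v j\<close> the one through v and x_0 = x_1 - j x_2 = 0; v_n \<noteq> 0 and v_0
    \<noteq> 0 make them nonzero.\<close>
  define h where "h v = Const (v n) * Var (n - 1) - Const (v (n - 1)) * Var n" for v :: "nat \<Rightarrow> 'k"
  define l where "l v j = Const (v 1 - of_nat j * v 2) * Var 0 - Const (v 0) * (Var 1 - Const (of_nat j) * Var 2)"
    for v :: "nat \<Rightarrow> 'k" and j :: nat
  have ex: "\<exists>f\<in>vanishing_forms n m S. f \<noteq> 0 \<and> f \<in> ideal_power n (point_ideal n {proj_point n v}) m"
    if v: "v \<in> homog_coords n" "mpoly_eval v (Var 0 * Var n) \<noteq> 0" for v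
  proof (intro bexI conjI)
    let ?f = "(\<Prod>j\<in>{1..m - 1}. l v j) * h v"
    have h: "h v \<in> forms n 1" unfolding h_def by (intro forms_diff forms_Const_mult forms_Var) auto
    have l: "l v j \<in> forms n 1" for j
      unfolding l_def using n by (intro forms_diff forms_Const_mult forms_Var) auto
    have "(\<Prod>j\<in>{1..m - 1}. l v j) \<in> forms n (\<Sum>j\<in>{1..m - 1}. 1)"
      using l by (intro forms_prod) auto
    then have "?f \<in> forms n ((m - 1) + 1)" using h by (intro forms_mult) simp_all
    then have form: "?f \<in> forms n m" using m by simp
    have "mpoly_eval s ?f = 0" if s: "s \<in> S" for s
    proof (cases "s \<in> T")
      case True
      then obtain j where "s 0 = 0" "j \<in> {1..m - 1}" "s 1 = of_nat j * s 2" using T(2) by (auto simp: Y_def)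
      then have "mpoly_eval s (l v j) = 0" "j \<in> {1..m - 1}" by (simp_all add: l_def)
      then show ?thesis by (auto intro!: prod_zero)
    next
      case False
      then have "s (n - 1) = 0" "s n = 0" using s n by (auto simp: S_def u_def basis_vec_def)
      then show ?thesis by (simp add: h_def)
    qed
    then show "?f \<in> vanishing_forms n m S" using form by (simp add: vanishing_forms_def)
    have "mpoly_eval (basis_vec (n - 1)) (h v) \<noteq> 0" using v(2) n by (auto simp: h_def basis_vec_def)
    then have "h v \<noteq> 0" by auto
    moreover have "mpoly_eval (basis_vec 1) (l v j) \<noteq> 0" for j using v(2) by (auto simp: l_def basis_vec_def)
    then have "l v j \<noteq> 0" for j by (metis mpoly_eval_simps(5))
    ultimately show "?f \<noteq> 0" by simp
    have P: "h v \<in> point_ideal n {proj_point n v}" "l v j \<in> point_ideal n {proj_point n v}" for j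
      using h l v(1) by (auto intro!: form_in_point_ideal simp: h_def l_def mult.commute)
    have "(\<Prod>j\<in>{1..m - 1}. l v j) \<in> ideal_power n (point_ideal n {proj_point n v}) (card {1..m - 1})"
      using P(2) by (intro prod_in_ideal_power) auto
    then have "?f \<in> ideal_power n (point_ideal n {proj_point n v}) (Suc (m - 1))"
      using P(1) by (intro ideal_power_mult) simp_all
    then show "?f \<in> ideal_power n (point_ideal n {proj_point n v}) m" using m by simp
  qed
  have "Var 0 * Var n \<in> forms n (1 + 1)" "(Var 0 * Var n :: 'k mpoly) \<noteq> 0"
    by (intro forms_mult forms_Var) simp_all
  then have "strongly_unexpected n m m S"
    unfolding strongly_unexpected_def using S dim ex by (intro conjI exI[of _ "1 + 1"] exI[of _ "Var 0 * Var n"]) blast+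
  then show ?thesis ..
qed

subsection \<open>Plane curves from the full monomial arrangements\<close>

text \<open>In characteristic 0, z^t - 1 has no root in common with its derivative t z^(t-1), so its
  t roots are distinct.\<close>

lemma card_roots_of_unity:
  assumes "t > 0"
  shows "finite {z :: 'k::{alg_closed_field,field_char_0}. z ^ t = 1}"
    and "card {z :: 'k. z ^ t = 1} = t"
proof -
  define p :: "'k poly" where "p = monom 1 t - 1"
  have deg: "degree p = t"
    using assms degree_add_eq_left[of "- 1" "monom (1 :: 'k) t"] by (simp add: p_def degree_monom_eq)
  then have nz: "p \<noteq> 0" using assms by auto
  have roots: "{z. poly p z = 0} = {z. z ^ t = 1}" by (simp add: p_def poly_monom)
  have "rsquarefree p"
    unfolding rsquarefree_roots
  proof (intro allI notI, elim conjE)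
    fix a assume a: "poly p a = 0" "poly (pderiv p) a = 0"
    then have "a ^ t = 1" "of_nat t * a ^ (t - 1) = 0"
      by (simp_all add: p_def poly_monom pderiv_diff pderiv_monom)
    then show False using assms by (auto simp: power_0_left)
  qed
  then have ord: "Polynomial.order a p \<le> 1" for a unfolding rsquarefree_def by (metis le_refl zero_le)
  obtain A where A: "size A = degree p" "p = smult (lead_coeff p) (\<Prod>x\<in>#A. [:-x, 1:])"
    using alg_closed_imp_factorization[OF nz] by blast
  have "proots p = proots (\<Prod>x\<in>#A. [:-x, 1:])"
    using A(2) nz by (metis leading_coeff_0_iff proots_smult)
  also have "\<dots> = A"
  proof -
    have "(\<Prod>x\<in>#B. [:-x, 1:]) \<noteq> 0 \<and> proots (\<Prod>x\<in>#B. [:-x, 1:]) = B" for B :: "'k multiset"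
      by (induct B) (simp_all add: proots_mult del: mult_pCons_left)
    then show ?thesis by blast
  qed
  finally have A_eq: "proots p = A" .
  have "count A a = (if a \<in> set_mset A then 1 else 0)" for a
    using ord[of a] nz by (auto simp: A_eq[symmetric] order_root le_antisym Suc_le_eq)
  then have "A = mset_set (set_mset A)" by (intro multiset_eqI) (simp add: count_mset_set')
  then have "card (set_mset A) = t" using A(1) deg by (metis size_mset_set)
  moreover have "set_mset A = {z. z ^ t = 1}" using roots nz by (simp flip: A_eq)
  ultimately show "finite {z :: 'k. z ^ t = 1}" "card {z :: 'k. z ^ t = 1} = t"
    by (metis finite_set_mset, simp)
qed

lemma index3_cases:
  assumes "k < (3::nat)"
  shows "(k = 0 \<and> (k + 1) mod 3 = 1 \<and> (k + 2) mod 3 = 2) \<or>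
    (k = 1 \<and> (k + 1) mod 3 = 2 \<and> (k + 2) mod 3 = 0) \<or>
    (k = 2 \<and> (k + 1) mod 3 = 0 \<and> (k + 2) mod 3 = 1)"
proof -
  consider "k = 0" | "k = 1" | "k = 2" using assms by linarith
  then show ?thesis by cases simp_all
qed

lemma sum3: "(\<Sum>i<3. c i) = c 0 + c 1 + c (2 :: nat)" for c :: "nat \<Rightarrow> 'a::comm_monoid_add"
proof -
  have "{..<3 :: nat} = {0, 1, 2}" by auto
  then show ?thesis by (simp add: add.assoc)
qed

lemma strongly_unexpected_monomial_arrangement:
  assumes t: "t \<ge> 2"
  shows "\<exists>S :: (nat \<Rightarrow> 'k::{alg_closed_field,field_char_0}) set. strongly_unexpected 2 (t + 2) (t + 1) S"
proof -
  \<comment> \<open>\<open>w i z\<close> is e_i - z e_(i+1) with cyclic indices. One orientation of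
    each pair suffices, as the t-th roots of unity are closed under inversion.\<close>
  define w :: "nat \<Rightarrow> 'k \<Rightarrow> nat \<Rightarrow> 'k" where
    "w i z = (\<lambda>j. if j = i then 1 else if j = (i + 1) mod 3 then - z else 0)" for i z
  define Z where "Z = {z :: 'k. z ^ t = 1}"
  have Z: "finite Z" "card Z = t" "0 \<notin> Z"
    using card_roots_of_unity[of t, where 'k = 'k] t by (auto simp: Z_def power_0_left)
  define S where "S = basis_vec ` {..<3} \<union> (\<lambda>(i, z). w i z) ` ({..<3} \<times> Z)"
  let ?x = "\<lambda>i. Poly_Mapping.single i 1 :: nat \<Rightarrow>\<^sub>0 nat"
  \<comment> \<open>One monomial for each coordinate line: there \<open>f\<close> is a binary form
    with t + 3 coefficients, and two vertices and t further points leave one coefficient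
    free.\<close>
  define e where "e i = ?x i + Poly_Mapping.single ((i + 1) mod 3) (t + 1)" for i
  define I where "I = (+) (?x 0 + ?x 1 + ?x 2) ` monomials 2 (t - 1) \<union> e ` {..<3}"
  have w: "w i z \<in> homog_coords 2" if "i < 3" for i z
  proof -
    have "(i + 1) mod 3 < 3" by simp
    then have "w i z j = 0" if "j > 2" for j using that \<open>i < 3\<close> by (auto simp: w_def)
    moreover have "w i z i \<noteq> 0" by (simp add: w_def)
    ultimately show ?thesis by (auto simp: homog_coords_def)
  qed
  have S: "finite S" "S \<subseteq> homog_coords 2"
    using Z w by (auto simp: S_def)
  have finI: "finite I" by (simp add: I_def card_monomials)
  have "card I \<le> card (monomials 2 (t - 1)) + 3"
    unfolding I_def using card_image_le[of "{..<3::nat}" e]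
    by (intro order_trans[OF card_Un_le] add_mono card_image_le) (auto simp: card_monomials)
  also have "\<dots> = ((t + 1) choose 2) + 3" using t by (simp add: card_monomials)
  \<comment> \<open>This comes down to 3 \<le> t + 1, hence to t \<ge> 2.\<close>
  also have "\<dots> \<le> (t + 2) choose 2"
  proof -
    have "(t + 2) choose 2 = ((t + 1) choose 2) + (t + 1)"
      using choose_reduce_nat[of "t + 2" 2] by (simp add: numeral_2_eq_2)
    then show ?thesis using t by simp
  qed
  finally have cardI: "card I \<le> (t + 1 - 1 + 2) choose 2" by simp
  have zero: "f = 0" if f: "f \<in> vanishing_forms 2 (t + 2) S" and coeffs: "\<And>s. s \<in> I \<Longrightarrow> Poly_Mapping.lookup f s = 0" for f
  proof -
    have form: "f \<in> forms 2 (t + 2)" using f by (simp add: vanishing_forms_def)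
    have pure: "Poly_Mapping.lookup f (Poly_Mapping.single i (t + 2)) = 0" if "i < 3" for i
      using mpoly_eval_basis_vec[OF form, of i] f that by (auto simp: vanishing_forms_def S_def)
    have "Poly_Mapping.lookup f s = 0" if s: "s \<in> monomials 2 (t + 2)" for s
    proof (cases "\<forall>k<3. Poly_Mapping.lookup s k \<ge> 1")
      case True
      define s' where "s' = s - (?x 0 + ?x 1 + ?x 2)"
      have s_eq: "s = ?x 0 + ?x 1 + ?x 2 + s'"
        using True[THEN spec, of 0] True[THEN spec, of 1] True[THEN spec, of 2]
        by (intro poly_mapping_eqI) (auto simp: s'_def lookup_add lookup_minus lookup_single when_def)
      moreover have "Poly_Mapping.keys s' \<subseteq> Poly_Mapping.keys s"
        by (auto simp: s'_def in_keys_iff lookup_minus)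
      then have "s' \<in> monomials 2 (t - 1)"
        using s arg_cong[OF s_eq, of total_degree] t by (auto simp: monomials_def total_degree_add)
      ultimately show ?thesis using coeffs by (auto simp: I_def)
    next
      case False
      then obtain k where k: "k < 3" "Poly_Mapping.lookup s k = 0" by auto
      define i where "i = (k + 1) mod 3"
      define j where "j = (k + 2) mod 3"
      have ij: "i < 3" "j < 3" "i \<noteq> j" "k \<noteq> i" "k \<noteq> j" "j = (i + 1) mod 3" "{0, 1, 2} = {i, j, k}"
        using index3_cases[OF k(1)] unfolding i_def j_def by auto
      \<comment> \<open>The restriction of \<open>f\<close> to the line x_k = 0, with x_i = 1 and
        x_j as the unknown.\<close>
      define a where "a = (\<lambda>l. if l = k then 0 else 1 :: 'k)"
      define p where "p = poly_hom.subst (\<lambda>l. monom (a l) (if l = j then 1 else 0)) f"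
      have mono: "q = Poly_Mapping.single i (t + 2 - r) + Poly_Mapping.single j r \<and> r \<le> t + 2"
        if q: "q \<in> monomials 2 (t + 2)" "Poly_Mapping.lookup q j = r" "Poly_Mapping.lookup q k = 0" for q r
      proof -
        have "{..2::nat} = {i, j, k}" unfolding ij(7)[symmetric] by auto
        then have sub: "Poly_Mapping.keys q \<subseteq> {i, j, k}" using q(1) by (simp add: monomials_def)
        then have "total_degree q = (\<Sum>l\<in>{i, j, k}. Poly_Mapping.lookup q l)"
          by (intro total_degree_superset) auto
        then have deg: "Poly_Mapping.lookup q i + r = t + 2" using q ij by (auto simp: monomials_def)
        have "q = Poly_Mapping.single i (t + 2 - r) + Poly_Mapping.single j r"
        proof (rule poly_mapping_eqI)
          fix l
          show "Poly_Mapping.lookup q l = Poly_Mapping.lookup (Poly_Mapping.single i (t + 2 - r) + Poly_Mapping.single j r) l"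
            using sub deg q(2,3) ij(3-5)
            by (cases "l \<in> {i, j, k}") (auto simp: lookup_add lookup_single when_def in_keys_iff)
        qed
        then show ?thesis using deg by simp
      qed
      have coeff: "coeff p r = Poly_Mapping.lookup f (Poly_Mapping.single i (t + 2 - r) + Poly_Mapping.single j r)"
        if "r \<le> t + 2" for r
      proof -
        let ?q = "Poly_Mapping.single i (t + 2 - r) + Poly_Mapping.single j r"
        have q: "?q \<in> monomials 2 (t + 2)" "Poly_Mapping.lookup ?q j = r"
          using that ij(1-3) monomials_add[OF single_in_monomials single_in_monomials, of i 2 j "t + 2 - r" r]
          by (auto simp: lookup_add lookup_single when_def)
        have "coeff p r = (\<Sum>q\<in>{?q}. Poly_Mapping.lookup f q * mono_eval a q)"
          unfolding p_def coeff_subst_monom[OF form]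
        proof (rule sum.mono_neutral_right)
          show "\<forall>q\<in>{q \<in> monomials 2 (t + 2). Poly_Mapping.lookup q j = r} - {?q}. Poly_Mapping.lookup f q * mono_eval a q = 0"
          proof
            fix q assume "q \<in> {q \<in> monomials 2 (t + 2). Poly_Mapping.lookup q j = r} - {?q}"
            then have "Poly_Mapping.lookup q k \<noteq> 0" using mono[of q r] by auto
            then have "mono_eval a q = 0" unfolding mono_eval_def
              by (intro prod_zero bexI[of _ k]) (auto simp: a_def in_keys_iff)
            then show "Poly_Mapping.lookup f q * mono_eval a q = 0" by simp
          qed
        qed (use q card_monomials(1) in auto)
        also have "\<dots> = Poly_Mapping.lookup f ?q"
          using ij(4,5) by (simp add: mono_eval_add a_def)
        finally show ?thesis .
      qed
      have w_ij: "w i z l = (if l = i then 1 else if l = j then - z else 0)" for z l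
        unfolding w_def ij(6)[symmetric] by (rule refl)
      have eval: "poly p x = mpoly_eval (w i (- x)) f" for x
      proof -
        have "mpoly_eval (\<lambda>l. poly (monom (a l) (if l = j then 1 else 0)) x) f = mpoly_eval (w i (- x)) f"
        proof (rule mpoly_eval_cong)
          show "f \<in> carrier (coord_ring 2)" using form by (rule forms_carrier)
          fix l :: nat assume "l \<le> 2"
          then have "l \<in> {0, 1, 2}" by auto
          then have "l \<in> {i, j, k}" unfolding ij(7) .
          then show "poly (monom (a l) (if l = j then 1 else 0)) x = w i (- x) l"
            using ij(3-5) by (auto simp: a_def w_ij poly_monom)
        qed
        then show ?thesis by (simp add: p_def poly_subst)
      qed
      have "p = 0"
      proof (rule poly_eq_0_of_roots)
        let ?A = "insert 0 (uminus ` Z)"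
        have "0 \<notin> uminus ` Z" "finite (uminus ` Z)" "card (uminus ` Z) = t"
          using Z by (auto simp: card_image)
        then have card: "card ?A = t + 1" by simp
        have "poly p (- z) = 0" if "z \<in> Z" for z
          using f ij(1) that by (auto simp: eval vanishing_forms_def S_def)
        moreover have "coeff p 0 = 0" using coeff[of 0] pure[OF ij(1)] by simp
        then have "poly p 0 = 0" by (simp add: poly_0_coeff_0)
        ultimately show "?A \<subseteq> {x. poly p x = 0}" by auto
        fix r assume "r \<ge> card ?A"
        then consider "r = t + 1" | "r = t + 2" | "r > t + 2" using card by linarith
        then show "coeff p r = 0"
        proof cases
          case 1
          then show ?thesis using coeff[of r] coeffs[of "e i"] ij(1,6) by (simp add: I_def e_def)
        next
          case 2
          then show ?thesis using coeff[of r] pure[OF ij(2)] by simp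
        next
          case 3
          then have "{q \<in> monomials 2 (t + 2). Poly_Mapping.lookup q j = r} \<subseteq> {q. Poly_Mapping.lookup q k \<noteq> 0}"
            using mono[of _ r] by auto
          then have "mono_eval a q = 0" if "q \<in> {q \<in> monomials 2 (t + 2). Poly_Mapping.lookup q j = r}" for q
            using that unfolding mono_eval_def
            by (intro prod_zero bexI[of _ k]) (auto simp: a_def in_keys_iff)
          then show ?thesis unfolding p_def coeff_subst_monom[OF form] by (intro sum.neutral) simp
        qed
      qed
      then show ?thesis using mono[OF s refl k(2)] coeff[of "Poly_Mapping.lookup s j"] by simp
    qed
    then show ?thesis
      using form by (intro poly_mapping_eqI) (auto simp: forms_iff)
  qed
  have dim: "mpoly_dim (vanishing_forms 2 (t + 2) S) \<le> (t + 1 - 1 + 2) choose 2"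
    using dim_le_card_coefficients[OF finI subspace_vanishing_forms vanishing_forms_subset zero] cardI
    by (rule order_trans)
  define L where "L v i = Const (v ((i + 1) mod 3)) * Var ((i + 2) mod 3) - Const (v ((i + 2) mod 3)) * Var ((i + 1) mod 3)"
    for v :: "nat \<Rightarrow> 'k" and i :: nat
  define F where "F v = (\<Sum>i<3. Var i * L v i ^ (t + 1))" for v
  have ex: "\<exists>f\<in>vanishing_forms 2 (t + 2) S. f \<noteq> 0 \<and> f \<in> ideal_power 2 (point_ideal 2 {proj_point 2 v}) (t + 1)"
    if v: "v \<in> homog_coords 2" "mpoly_eval v (Var 2) \<noteq> 0" for v
  proof (intro bexI conjI)
    have "(k + 1) mod 3 \<le> 2" "(k + 2) mod 3 \<le> 2" for k :: nat
      by (simp_all add: less_Suc_eq_le[symmetric])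
    then have L: "L v i \<in> forms 2 1" for i
      unfolding L_def by (intro forms_diff forms_Const_mult forms_Var)
    have "Var i * L v i ^ (t + 1) \<in> forms 2 (1 + (t + 1) * 1)" if "i < 3" for i
      using that L by (intro forms_mult forms_power forms_Var) auto
    then have form: "F v \<in> forms 2 (t + 2)" unfolding F_def by (intro forms_sum) auto
    have eval: "mpoly_eval u (F v) = u 0 * (v 1 * u 2 - v 2 * u 1) ^ (t + 1) + u 1 * (v 2 * u 0 - v 0 * u 2) ^ (t + 1)
        + u 2 * (v 0 * u 1 - v 1 * u 0) ^ (t + 1)" for u
      unfolding F_def sum3 L_def by (simp add: numeral_2_eq_2)
    \<comment> \<open>At e_i - z e_j, with k the third index, the two surviving summands are (z
      v_k)^(t+1) and - z v_k^(t+1); they cancel because z^(t+1) = z.\<close>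
    have zt: "(z * x) ^ (t + 1) = z * x ^ (t + 1)" if "z \<in> Z" for x z
      using that by (simp add: Z_def power_mult_distrib)
    have "mpoly_eval s (F v) = 0" if s: "s \<in> S" for s
    proof -
      from s consider i where "i < 3" "s = basis_vec i" | i z where "i < 3" "z \<in> Z" "s = w i z"
        by (auto simp: S_def)
      then show ?thesis
      proof cases
        case 1
        then have "i = 0 \<or> i = 1 \<or> i = 2" by linarith
        then show ?thesis using 1 by (auto simp: eval basis_vec_def)
      next
        case 2
        then have "i = 0 \<or> i = 1 \<or> i = 2" by linarith
        then show ?thesis
          using 2 zt[OF 2(2), of "v 0"] zt[OF 2(2), of "v 1"] zt[OF 2(2), of "v 2"]
          by (auto simp: eval w_def mult.commute simp del: power_Suc power_add)
      qed
    qed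
    then show "F v \<in> vanishing_forms 2 (t + 2) S" using form by (simp add: vanishing_forms_def)
    \<comment> \<open>The factor arises at the point (1, 2, 0). The simpler point (1, 1, 0) would
      give (-1)^(t+1) + 1, which is 0 for even t.\<close>
    have "(of_int ((-2) ^ (t + 1) + 2) :: 'k) \<noteq> 0"
    proof -
      have "(-2 :: int) ^ (t + 1) \<noteq> -2"
      proof
        assume "(-2 :: int) ^ (t + 1) = -2"
        then have "\<bar>(-2 :: int) ^ (t + 1)\<bar> = \<bar>-2\<bar>" by (simp only:)
        then have "(2 :: int) ^ (t + 1) = 2" by (simp only: power_abs abs_minus_cancel abs_numeral)
        then have "(2 :: int) ^ t = 1" by simp
        then show False using one_less_power[of "2 :: int" t] t by simp
      qed
      then show ?thesis unfolding of_int_eq_0_iff by linarith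
    qed
    moreover have "mpoly_eval (\<lambda>i. if i = 0 then 1 else if i = 1 then 2 else 0) (F v)
        = of_int ((-2) ^ (t + 1) + 2) * v 2 ^ (t + 1)"
    proof -
      have "(- (v 2 * 2)) ^ (t + 1) = (-2) ^ (t + 1) * v 2 ^ (t + 1)"
        by (simp only: power_mult_distrib[symmetric]) (simp add: mult.commute)
      then show ?thesis by (simp add: eval distrib_right del: power_Suc)
    qed
    ultimately show "F v \<noteq> 0" using v(2) by auto
    let ?I = "point_ideal 2 {proj_point 2 v}"
    interpret J: ideal "ideal_power 2 ?I (t + 1)" "coord_ring 2 :: 'k mpoly ring"
      by (intro ideal_ideal_power ideal_point_ideal)
    have "L v i \<in> ?I" for i
      using L v(1) by (rule form_in_point_ideal) (simp add: L_def mult.commute)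
    then have "L v i ^ (t + 1) \<in> ideal_power 2 ?I (t + 1)" for i
      using prod_in_ideal_power[of "{..<t + 1}" "\<lambda>_. L v i" ?I 2] by simp
    then have i: "Var i * L v i ^ (t + 1) \<in> ideal_power 2 ?I (t + 1)" if "i < 3" for i
      using J.I_l_closed[OF _ forms_carrier[OF forms_Var[of i 2]]] that by simp
    show "F v \<in> ideal_power 2 ?I (t + 1)"
      unfolding F_def sum3 using i[of 0] i[of 1] i[of 2] J.a_closed by (simp del: power_Suc ideal_power_Suc)
  qed
  have "strongly_unexpected 2 (t + 2) (t + 1) S"
    unfolding strongly_unexpected_def using S dim ex
    by (intro conjI exI[of _ 1] exI[of _ "Var 2"]) (simp_all add: forms_Var del: ideal_power_Suc)
  then show ?thesis ..
qed

lemma exists_strongly_unexpected: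
  assumes "(n = 2 \<and> d > m \<and> m > 2) \<or> (n \<ge> 3 \<and> d \<ge> m \<and> m \<ge> 2)"
  shows "\<exists>S :: (nat \<Rightarrow> 'k::{alg_closed_field,field_char_0}) set. strongly_unexpected n d m S"
  using assms
proof
  assume a: "n = 2 \<and> d > m \<and> m > 2"
  then have "m - 1 + 2 = Suc m" "m - 1 + 1 = m" "m - 1 \<ge> 2" by auto
  then obtain S :: "(nat \<Rightarrow> 'k) set" where "strongly_unexpected 2 (Suc m) m S"
    using strongly_unexpected_monomial_arrangement[of "m - 1"] by metis
  then show ?thesis using a strongly_unexpected_raise[of 2 "Suc m" m S d] by auto
next
  assume a: "n \<ge> 3 \<and> d \<ge> m \<and> m \<ge> 2"
  then obtain S :: "(nat \<Rightarrow> 'k) set" where "strongly_unexpected n m m S"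
    using strongly_unexpected_cone[of n m] by auto
  then show ?thesis using a strongly_unexpected_raise by blast
qed

section \<open>Non-existence in the remaining cases\<close>

subsection \<open>Vanishing order at a point\<close>

text \<open>The coefficient homomorphism is left general: the bound is needed both on lines and for
  the total degree of a dehomogenized form.\<close>

lemma degree_subst_le:
  fixes C :: "'a::comm_ring_1 \<Rightarrow> 'c::comm_ring_1 poly"
  assumes C: "coeff_hom C" "\<And>c. degree (C c) = 0" and Y: "\<And>i. i \<le> n \<Longrightarrow> degree (Y i) \<le> 1"
    and f: "f \<in> forms n d"
  shows "degree (coeff_hom.subst C Y f) \<le> d"
proof -
  interpret coeff_hom C by fact
  have "degree (C (Poly_Mapping.lookup f t) * mono_eval Y t) \<le> d" if t: "t \<in> Poly_Mapping.keys f" for t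
  proof -
    have tm: "t \<in> monomials n d" using t f by (auto simp: forms_eq)
    have "degree (mono_eval Y t) \<le> (\<Sum>i\<in>Poly_Mapping.keys t. degree (Y i ^ Poly_Mapping.lookup t i))"
      unfolding mono_eval_def by (rule order_trans[OF degree_prod_sum_le]) simp_all
    also have "\<dots> \<le> (\<Sum>i\<in>Poly_Mapping.keys t. 1 * Poly_Mapping.lookup t i)"
    proof (rule sum_mono)
      fix i assume "i \<in> Poly_Mapping.keys t"
      then have "degree (Y i) \<le> 1" using tm Y by (auto simp: monomials_def)
      then show "degree (Y i ^ Poly_Mapping.lookup t i) \<le> 1 * Poly_Mapping.lookup t i"
        by (intro order_trans[OF degree_power_le] mult_right_mono) auto
    qed
    also have "\<dots> = d" using tm by (simp add: monomials_def total_degree_def)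
    finally show ?thesis using degree_mult_le[of "C (Poly_Mapping.lookup f t)" "mono_eval Y t"] C(2) by simp
  qed
  then show ?thesis unfolding subst_def by (intro degree_sum_le) auto
qed

abbreviation line_poly :: "(nat \<Rightarrow> 'k) \<Rightarrow> (nat \<Rightarrow> 'k) \<Rightarrow> 'k::comm_ring_1 mpoly \<Rightarrow> 'k poly" where
  "line_poly v x f \<equiv> poly_hom.subst (\<lambda>i. [:v i, x i:]) f"

lemma poly_line_poly: "poly (line_poly v x f) s = mpoly_eval (\<lambda>i. v i + s * x i) f"
  by (simp add: poly_subst)

lemma degree_line_poly_le: "f \<in> forms n d \<Longrightarrow> degree (line_poly v x f) \<le> d"
  by (rule degree_subst_le) (unfold_locales, simp_all)

lemma point_ideal_dvd_line_poly:
  fixes f :: "'k::field mpoly"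
  assumes "v \<in> homog_coords n" "f \<in> point_ideal n {proj_point n v}"
  shows "[:0, 1:] dvd line_poly v x f"
proof -
  have "mpoly_eval v f = 0"
    using point_ideal_vanishes(2)[of f n "{v}" v] assms by simp
  then have "poly (line_poly v x f) 0 = 0" unfolding poly_line_poly by simp
  then show ?thesis using poly_eq_0_iff_dvd[of "line_poly v x f" 0] by simp
qed

text \<open>Each factor from the ideal of the point vanishes at parameter 0, so m factors give a
  zero of order m on every line through it.\<close>

lemma ideal_power_dvd_line_poly:
  fixes f :: "'k::field mpoly"
  assumes v: "v \<in> homog_coords n" and "f \<in> ideal_power n (point_ideal n {proj_point n v}) m"
  shows "[:0, 1:] ^ m dvd line_poly v x f"
  using assms(2)
proof (induct m arbitrary: f)
  case (Suc m)
  from \<open>f \<in> ideal_power n _ (Suc m)\<close> show ?case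
  proof (induct rule: ideal_power_induct)
    case (mult p q)
    then show ?case
      using mult_dvd_mono[OF Suc.hyps[OF mult(1)] point_ideal_dvd_line_poly[OF v mult(2)]]
      by (simp only: poly_hom.subst_mult power_Suc2)
  next
    case (add p q)
    then show ?case by (simp only: poly_hom.subst_add dvd_add)
  qed
qed simp

text \<open>On the line from v to any w, the restriction has degree at most d but a zero of order m
  > d, so it is 0; parameter 1 gives w.\<close>

lemma ideal_power_small_degree:
  fixes f :: "'k::field_char_0 mpoly"
  assumes v: "v \<in> homog_coords n" and f: "f \<in> forms n d" "f \<in> ideal_power n (point_ideal n {proj_point n v}) m"
    and "d < m"
  shows "f = 0"
proof (rule form_eq_0I[OF f(1)])
  fix w :: "nat \<Rightarrow> 'k"
  have "line_poly v (\<lambda>i. w i - v i) f = 0"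
  proof (rule ccontr)
    assume nz: "line_poly v (\<lambda>i. w i - v i) f \<noteq> 0"
    have "degree ([:0, 1 :: 'k:] ^ m) \<le> degree (line_poly v (\<lambda>i. w i - v i) f)"
      using ideal_power_dvd_line_poly[OF v f(2)] nz by (rule dvd_imp_degree_le)
    then have "m \<le> d" using degree_line_poly_le[OF f(1), of v "\<lambda>i. w i - v i"]
      by (simp add: degree_power_eq)
    then show False using assms(4) by simp
  qed
  then show "mpoly_eval w f = 0" using poly_line_poly[of v "\<lambda>i. w i - v i" f 1] by simp
qed

text \<open>On v + s x the form has degree at most m and a zero of order m, hence equals c s^m. By
  homogeneity v and x can be exchanged, and the form is constant along x + s v.\<close>

lemma ideal_power_cone:
  fixes f :: "'k::field_char_0 mpoly"
  assumes v: "v \<in> homog_coords n" and f: "f \<in> forms n m" "f \<in> ideal_power n (point_ideal n {proj_point n v}) m"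
  shows "mpoly_eval (\<lambda>i. x i + t * v i) f = mpoly_eval x f"
proof -
  obtain q where q: "line_poly v x f = [:0, 1:] ^ m * q"
    using ideal_power_dvd_line_poly[OF v f(2)] by (rule dvdE)
  have "degree q = 0"
  proof (cases "q = 0")
    case False
    then have "degree (line_poly v x f) = m + degree q"
      unfolding q by (subst degree_mult_eq) (simp_all add: degree_power_eq)
    then show ?thesis using degree_line_poly_le[OF f(1), of v x] by simp
  qed simp
  then obtain c where c: "q = [:c:]" by (rule degree_eq_zeroE)
  have eq: "mpoly_eval (\<lambda>i. v i + s * x i) f = c * s ^ m" for s
    unfolding poly_line_poly[symmetric] q c by simp
  have nz: "poly (line_poly x v f) s = c" if "s \<noteq> 0" for s
  proof -
    have "(\<lambda>i. x i + s * v i) = (\<lambda>i. s * (v i + inverse s * x i))"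
      using that by (auto simp: algebra_simps)
    then have "poly (line_poly x v f) s = s ^ m * (c * inverse s ^ m)"
      unfolding poly_line_poly by (simp add: mpoly_eval_form_scale[OF f(1)] eq)
    then show ?thesis using that by (simp add: power_inverse)
  qed
  \<comment> \<open>The exchange says nothing about s = 0; multiplying by s makes the identity hold
    there as well.\<close>
  have "[:0, 1:] * (line_poly x v f - [:c:]) = 0"
    unfolding poly_all_0_iff_0[symmetric] using nz by auto
  then have "line_poly x v f = [:c:]" by simp
  then have "poly (line_poly x v f) s = c" for s by simp
  from this[of t] this[of 0] show ?thesis unfolding poly_line_poly by simp
qed

lemma no_unexpected_small_degree:
  fixes S :: "(nat \<Rightarrow> 'k::field_char_0) set"
  assumes S: "S \<subseteq> homog_coords n" and "d < m"
  shows "\<not> admits_unexpected n d m (proj_point n ` S)"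
proof
  assume "admits_unexpected n d m (proj_point n ` S)"
  then obtain e G where G: "G \<in> forms n e" "G \<noteq> 0" and
    dim: "\<And>v. v \<in> homog_coords n \<Longrightarrow> mpoly_eval v G \<noteq> 0 \<Longrightarrow>
      int (mpoly_dim (vanishing_forms n d S \<inter> ideal_power n (point_ideal n {proj_point n v}) m))
      > max 0 (int (mpoly_dim (vanishing_forms n d S)) - int ((m - 1 + n) choose n))"
    unfolding admits_unexpected_iff[OF S] by (rule for_general_pointE) blast
  obtain v where v: "v \<in> homog_coords n" "mpoly_eval v G \<noteq> 0" using nonvanishing_point[OF G] by blast
  have "vanishing_forms n d S \<inter> ideal_power n (point_ideal n {proj_point n v}) m \<subseteq> {0}"
    using ideal_power_small_degree[OF v(1) _ _ assms(2)] by (auto simp: vanishing_forms_def)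
  then have "mpoly_dim (vanishing_forms n d S \<inter> ideal_power n (point_ideal n {proj_point n v}) m) \<le> card ({} :: 'k mpoly set)"
    by (intro mp.dim_le_card) auto
  then show False using dim[OF v] by simp
qed

text \<open>The expected drop is binom(n, n) = 1, and a nonzero member of the system does not vanish
  at a general point.\<close>

lemma no_unexpected_multiplicity_one:
  fixes S :: "(nat \<Rightarrow> 'k::field_char_0) set"
  assumes S: "S \<subseteq> homog_coords n"
  shows "\<not> admits_unexpected n d 1 (proj_point n ` S)"
proof
  let ?V = "vanishing_forms n d S"
  let ?W = "\<lambda>v. ?V \<inter> ideal_power n (point_ideal n {proj_point n v}) 1"
  assume "admits_unexpected n d 1 (proj_point n ` S)"
  then obtain e G where G: "G \<in> forms n e" "G \<noteq> 0" and
    dim: "\<And>v. v \<in> homog_coords n \<Longrightarrow> mpoly_eval v G \<noteq> 0 \<Longrightarrow>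
      int (mpoly_dim (?W v)) > max 0 (int (mpoly_dim ?V) - int ((1 - 1 + n) choose n))"
    unfolding admits_unexpected_iff[OF S] by (rule for_general_pointE) blast
  obtain B where B: "finite B" "forms n d \<subseteq> mp.span (B :: 'k mpoly set)"
    by (rule finite_spanning_set_forms)
  show False
  proof (cases "?V \<subseteq> {0}")
    case True
    obtain v where v: "v \<in> homog_coords n" "mpoly_eval v G \<noteq> 0" using nonvanishing_point[OF G] by blast
    have "mpoly_dim (?W v) \<le> card ({} :: 'k mpoly set)" using True by (intro mp.dim_le_card) auto
    then show False using dim[OF v] by simp
  next
    case False
    then obtain g where g: "g \<in> ?V" "g \<noteq> 0" by blast
    then have "G * g \<in> forms n (e + d)" "G * g \<noteq> 0"
      using G by (auto simp: vanishing_forms_def intro: forms_mult)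
    then obtain v where v: "v \<in> homog_coords n" "mpoly_eval v (G * g) \<noteq> 0"
      using nonvanishing_point by blast
    have "g \<notin> ?W v"
    proof
      assume "g \<in> ?W v"
      then have "[:0, 1:] ^ 1 dvd line_poly v v g" using ideal_power_dvd_line_poly[OF v(1)] by blast
      then have "poly (line_poly v v g) 0 = 0" using poly_eq_0_iff_dvd[of "line_poly v v g" 0] by simp
      then show False using v(2) unfolding poly_line_poly by simp
    qed
    then have "mpoly_dim (?W v) < mpoly_dim ?V"
      using g B vanishing_forms_subset[of n d S]
      by (intro mp.subspace_dim_less[of _ B _ g] subspace_vanishing_power ideal_point_ideal) auto
    then show False using dim[OF v(1)] v(2) by simp
  qed
qed

subsection \<open>Plane curves that are unions of lines through a point\<close>

definition det3 :: "(nat \<Rightarrow> 'k) \<Rightarrow> (nat \<Rightarrow> 'k) \<Rightarrow> (nat \<Rightarrow> 'k::comm_ring_1) \<Rightarrow> 'k" where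
  "det3 u v w = (u 1 * v 2 - u 2 * v 1) * w 0 + (u 2 * v 0 - u 0 * v 2) * w 1 + (u 0 * v 1 - u 1 * v 0) * w 2"

text \<open>The line joining u and v, its coefficients being their cross product.\<close>

definition line_form :: "(nat \<Rightarrow> 'k) \<Rightarrow> (nat \<Rightarrow> 'k) \<Rightarrow> 'k::comm_ring_1 mpoly" where
  "line_form u v = Const (u 1 * v 2 - u 2 * v 1) * Var 0 + Const (u 2 * v 0 - u 0 * v 2) * Var 1
    + Const (u 0 * v 1 - u 1 * v 0) * Var 2"

lemma mpoly_eval_line_form [simp]: "mpoly_eval w (line_form u v) = det3 u v w"
  by (simp add: line_form_def det3_def)

lemma line_form_forms: "line_form u v \<in> forms 2 1"
  unfolding line_form_def by (intro forms_add forms_Const_mult forms_Var) simp_all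

lemma homog_coords_2_eqI:
  assumes "u \<in> homog_coords 2" "v \<in> homog_coords 2" "c * u 0 = v 0" "c * u 1 = v 1" "c * u 2 = v (2::nat)"
  shows "v = (\<lambda>i. c * u i)"
proof
  fix i :: nat
  consider "i = 0" | "i = 1" | "i = 2" | "i > 2" by linarith
  then show "v i = c * u i" using assms by cases (auto simp: homog_coords_def)
qed

lemma line_form_nonzero:
  fixes u v :: "nat \<Rightarrow> 'k::field"
  assumes u: "u \<in> homog_coords 2" and v: "v \<in> homog_coords 2" and "proj_point 2 u \<noteq> proj_point 2 v"
  shows "line_form u v \<noteq> 0"
proof
  assume "line_form u v = 0"
  then have "mpoly_eval w (line_form u v) = 0" for w by simp
  then have z: "det3 u v w = 0" for w by simp
  have c: "u 1 * v 2 = u 2 * v 1" "u 2 * v 0 = u 0 * v 2" "u 0 * v 1 = u 1 * v 0"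
    using z[of "basis_vec 0"] z[of "basis_vec 1"] z[of "basis_vec 2"] by (simp_all add: det3_def basis_vec_def)
  obtain i where i: "u i \<noteq> 0" using u by (auto simp: homog_coords_def)
  then have "\<not> i > 2" using u by (auto simp: homog_coords_def)
  then have i3: "i = 0 \<or> i = 1 \<or> i = 2" by linarith
  have v_eq: "v = (\<lambda>j. v i / u i * u j)"
    by (rule homog_coords_2_eqI[OF u v]) (use i i3 c in \<open>auto simp: field_simps\<close>)
  have "v i / u i \<noteq> 0"
  proof
    assume "v i / u i = 0"
    then have "v j = 0" for j using fun_cong[OF v_eq, of j] by (simp only: mult_zero_left)
    then show False using v by (simp add: homog_coords_def)
  qed
  then show False using assms(3) proj_point_eq_iff[OF u v] v_eq by blast
qed

text \<open>Join \<open>u\<close> to one of two coordinate points, at least one of which differs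
  from it.\<close>

lemma line_through_point:
  fixes u :: "nat \<Rightarrow> 'k::field"
  assumes "u \<in> homog_coords 2"
  obtains l where "l \<in> forms 2 1" "l \<noteq> 0" "mpoly_eval u l = 0"
proof -
  obtain i :: nat where i: "i \<le> 2" "proj_point 2 u \<noteq> proj_point 2 (basis_vec i)"
  proof -
    have "proj_point 2 (basis_vec 0) \<noteq> (proj_point 2 (basis_vec 1) :: (nat \<Rightarrow> 'k) set)"
      by (subst proj_point_eq_iff) (auto simp: basis_vec_def fun_eq_iff)
    then show ?thesis using that[of 0] that[of 1] by fastforce
  qed
  then have "line_form u (basis_vec i) \<noteq> 0" using assms by (intro line_form_nonzero) auto
  moreover have "mpoly_eval u (line_form u (basis_vec i)) = 0" by (simp add: det3_def algebra_simps)
  ultimately show ?thesis using that line_form_forms by blast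
qed

text \<open>Projection from v keeps the points of \<open>S\<close> apart, so the binary forms
  vanishing on their images have dimension at most m + 1 - card S, or 0. This is not unexpected,
  since dim [I_Z]_m is at least binom(m + 2, 2) - card S and the binomials differ by m + 1.\<close>

lemma no_unexpected_pencil:
  fixes S :: "(nat \<Rightarrow> 'k::field_char_0) set"
  assumes S: "S \<subseteq> homog_coords 2" "finite S" "inj_on (proj_point 2) S" and m: "m > 0"
  shows "\<not> admits_unexpected 2 m m (proj_point 2 ` S)"
proof
  let ?V = "vanishing_forms 2 m S"
  let ?W = "\<lambda>v. ?V \<inter> ideal_power 2 (point_ideal 2 {proj_point 2 v}) m"
  assume "admits_unexpected 2 m m (proj_point 2 ` S)"
  then obtain e G where G: "G \<in> forms 2 e" "G \<noteq> 0" and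
    dim: "\<And>v. v \<in> homog_coords 2 \<Longrightarrow> mpoly_eval v G \<noteq> 0 \<Longrightarrow>
      int (mpoly_dim (?W v)) > max 0 (int (mpoly_dim ?V) - int ((m - 1 + 2) choose 2))"
    unfolding admits_unexpected_iff[OF S(1)] by (rule for_general_pointE) blast
  \<comment> \<open>A linear form through z turns being different from the point z into a
    nonvanishing condition.\<close>
  have "\<forall>z\<in>homog_coords 2. \<exists>l. l \<in> forms 2 1 \<and> l \<noteq> 0 \<and> mpoly_eval z l = (0 :: 'k)"
    by (metis line_through_point)
  then obtain \<Lambda> :: "(nat \<Rightarrow> 'k) \<Rightarrow> 'k mpoly" where
    \<Lambda>: "\<And>z. z \<in> homog_coords 2 \<Longrightarrow> \<Lambda> z \<in> forms 2 1 \<and> \<Lambda> z \<noteq> 0 \<and> mpoly_eval z (\<Lambda> z) = 0"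
    by metis
  have separate: "proj_point 2 w \<noteq> proj_point 2 z"
    if w: "w \<in> homog_coords 2" and z: "z \<in> homog_coords 2" and wz: "mpoly_eval w (\<Lambda> z) \<noteq> 0" for w z
  proof
    assume "proj_point 2 w = proj_point 2 z"
    then obtain c where "w = (\<lambda>i. c * z i)" using proj_point_eq_iff[OF z w] by metis
    then have "mpoly_eval w (\<Lambda> z) = c ^ 1 * mpoly_eval z (\<Lambda> z)"
      using mpoly_eval_form_scale[of "\<Lambda> z" 2 1 c z] \<Lambda>[OF z] by simp
    then show False using wz \<Lambda>[OF z] by simp
  qed
  have "(\<Prod>z\<in>S. \<Lambda> z) \<in> forms 2 (\<Sum>z\<in>S. 1)"
    using \<Lambda> S by (intro forms_prod) blast
  moreover have "(\<Prod>z\<in>S. \<Lambda> z) \<noteq> 0" using \<Lambda> S by auto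
  ultimately obtain B where B: "B \<in> homog_coords 2" "mpoly_eval B (\<Prod>z\<in>S. \<Lambda> z) \<noteq> 0"
    using nonvanishing_point by blast
  then have BS: "proj_point 2 B \<noteq> proj_point 2 z" if "z \<in> S" for z
    using separate[of B z] S that by (auto simp: subset_iff)
  \<comment> \<open>Off these lines, projection from v separates the points of \<open>S\<close> and
    sends none of them to the image of \<open>B\<close>, which is the parameter at infinity. The
    factor \<open>\<Lambda> B\<close> keeps v away from \<open>B\<close> even if \<open>S\<close> is
    empty.\<close>
  let ?P = "{(z, w) \<in> insert B S \<times> insert B S. z \<noteq> w}"
  let ?G = "G * \<Lambda> B * (\<Prod>(z, w)\<in>?P. line_form z w)"
  have P: "line_form z w \<noteq> 0" if "(z, w) \<in> ?P" for z w
  proof (rule line_form_nonzero)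
    show "proj_point 2 z \<noteq> proj_point 2 w"
      using that BS S(3) by (auto simp: inj_on_eq_iff dest: BS)
  qed (use that S B in auto)
  have finP: "finite ?P" by (rule finite_subset[of _ "insert B S \<times> insert B S"]) (use S in auto)
  have P_form: "(\<Prod>(z, w)\<in>?P. line_form z w) \<in> forms 2 (\<Sum>p\<in>?P. 1)"
    unfolding case_prod_beta by (intro forms_prod line_form_forms)
  have P_nz: "(\<Prod>(z, w)\<in>?P. line_form z w) \<noteq> 0"
    using P finP by (auto simp: prod_zero_iff)
  have "?G \<in> forms 2 (e + 1 + (\<Sum>p\<in>?P. 1))"
    by (intro forms_mult G(1) P_form) (use \<Lambda>[OF B(1)] in blast)
  moreover have "?G \<noteq> 0" using G(2) \<Lambda>[OF B(1)] P_nz by simp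
  ultimately obtain v where v: "v \<in> homog_coords 2" "mpoly_eval v ?G \<noteq> 0"
    using nonvanishing_point by blast
  then have v_det: "det3 z w v \<noteq> 0" if "z \<in> insert B S" "w \<in> insert B S" "z \<noteq> w" for z w
    using that finP by (auto simp: prod_zero_iff)
  have vG: "mpoly_eval v G \<noteq> 0" using v(2) by simp
  have "proj_point 2 v \<noteq> proj_point 2 B" using separate[OF v(1) B(1)] v(2) by simp
  then have lBv: "line_form B v \<noteq> 0" using B(1) v(1) by (intro line_form_nonzero) auto
  then obtain A where A: "A \<in> homog_coords 2" "det3 B v A \<noteq> 0"
    using nonvanishing_point[OF line_form_forms lBv] by auto
  define \<delta> where "\<delta> = det3 A B v"
  have \<delta>: "\<delta> \<noteq> 0" "\<delta> = det3 B v A" using A(2) by (simp_all add: \<delta>_def det3_def algebra_simps)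
  have eval: "\<delta> ^ m * mpoly_eval x f = det3 x B v ^ m * poly (line_poly A B f) (det3 A x v / det3 x B v)"
    if f: "f \<in> ?W v" and x: "det3 x B v \<noteq> 0" for f x
  proof -
    have form: "f \<in> forms 2 m" using f by (simp add: vanishing_forms_def)
    let ?a = "det3 x B v" and ?b = "det3 A x v" and ?c = "det3 A B x"
    have "\<delta> ^ m * mpoly_eval x f = mpoly_eval (\<lambda>i. \<delta> * x i) f"
      using mpoly_eval_form_scale[OF form] by simp
    also have "\<dots> = mpoly_eval (\<lambda>i. (?a * A i + ?b * B i) + ?c * v i) f"
    proof (rule mpoly_eval_cong[OF forms_carrier[OF form]])
      \<comment> \<open>Cramer's rule in the basis A, B, v; the component along v can then be
        dropped because f is a cone with vertex v.\<close>
      have cramer: "\<delta> * x 0 = (?a * A 0 + ?b * B 0) + ?c * v 0" "\<delta> * x 1 = (?a * A 1 + ?b * B 1) + ?c * v 1"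
        "\<delta> * x 2 = (?a * A 2 + ?b * B 2) + ?c * v 2"
        by (simp_all add: \<delta>_def det3_def algebra_simps)
      fix i :: nat assume "i \<le> 2"
      then consider "i = 0" | "i = 1" | "i = 2" by linarith
      then show "\<delta> * x i = (?a * A i + ?b * B i) + ?c * v i"
        by cases (simp_all only: cramer)
    qed
    also have "\<dots> = mpoly_eval (\<lambda>i. ?a * A i + ?b * B i) f"
      using f form by (intro ideal_power_cone[OF v(1)]) auto
    also have "(\<lambda>i. ?a * A i + ?b * B i) = (\<lambda>i. ?a * (A i + ?b / ?a * B i))"
      using x by (auto simp: field_simps)
    also have "mpoly_eval \<dots> f = ?a ^ m * mpoly_eval (\<lambda>i. A i + ?b / ?a * B i) f"
      by (rule mpoly_eval_form_scale[OF form])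
    finally show ?thesis unfolding poly_line_poly .
  qed
  have zB: "det3 z B v \<noteq> 0" if "z \<in> S" for z
    using v_det[of z B] that BS[OF that] by auto
  let ?s = "\<lambda>z. det3 A z v / det3 z B v"
  have inj: "inj_on ?s S"
  proof (rule inj_onI, rule ccontr)
    fix z w assume zw: "z \<in> S" "w \<in> S" "?s z = ?s w" "z \<noteq> w"
    have "det3 A z v * det3 w B v - det3 A w v * det3 z B v = 0"
      using zw(3) zB[OF zw(1)] zB[OF zw(2)] by (simp add: field_simps)
    \<comment> \<open>A Pluecker relation; its right side is nonzero because v lies on no line
      joining two points of \<open>S\<close>.\<close>
    moreover have "det3 A z v * det3 w B v - det3 A w v * det3 z B v = - (\<delta> * det3 z w v)"
      by (simp add: \<delta>_def det3_def algebra_simps)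
    ultimately show False using \<delta> v_det[of z w] zw by simp
  qed
  have zero: "f = 0" if f: "f \<in> ?W v" and coeffs: "\<And>k. k \<in> {card S..m} \<Longrightarrow> coeff (line_poly A B f) k = 0" for f
  proof -
    have form: "f \<in> forms 2 m" using f by (simp add: vanishing_forms_def)
    have "line_poly A B f = 0"
    proof (rule poly_eq_0_of_roots)
      show "?s ` S \<subseteq> {x. poly (line_poly A B f) x = 0}"
      proof (intro image_subsetI CollectI)
        fix z assume z: "z \<in> S"
        then have "mpoly_eval z f = 0" using f by (simp add: vanishing_forms_def)
        then show "poly (line_poly A B f) (?s z) = 0"
          using eval[OF f zB[OF z]] zB[OF z] by simp
      qed
      fix r assume "r \<ge> card (?s ` S)"
      then show "coeff (line_poly A B f) r = 0"
        using coeffs[of r] degree_line_poly_le[OF form, of A B]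
        by (cases "r \<le> m") (auto simp: card_image[OF inj] coeff_eq_0)
    qed
    then have "mpoly_eval x f = 0" if "det3 x B v \<noteq> 0" for x
      using eval[OF f that] \<delta> by simp
    moreover have "det3 x B v = det3 B v x" for x by (simp add: det3_def algebra_simps)
    ultimately have "f * line_form B v = 0"
      by (intro form_eq_0I[OF forms_mult[OF form line_form_forms]]) auto
    then show ?thesis using lBv by simp
  qed
  obtain C where C: "finite C" "forms 2 m \<subseteq> mp.span (C :: 'k mpoly set)"
    by (rule finite_spanning_set_forms)
  \<comment> \<open>Given card S roots, the coefficients of degree at least card S determine the
    polynomial; the interval is empty when card S exceeds m.\<close>
  have "mpoly_dim (?W v) \<le> card {card S..m}"
    by (rule mp.dim_le_card_functionals[where \<phi> = "\<lambda>k f. coeff (line_poly A B f) k" and B = C])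
      (use C zero vanishing_forms_subset[of 2 m S] in \<open>auto simp: poly_hom.subst_add poly_hom.subst_scale
        intro!: subspace_vanishing_power ideal_point_ideal\<close>)
  moreover have "mpoly_dim (forms 2 m :: 'k mpoly set) \<le> mpoly_dim ?V + card S"
    unfolding vanishing_forms_def
    by (rule mp.dim_le_kernels(2)[where B = C]) (use C S subspace_forms in auto)
  then have "(m + 2) choose 2 \<le> mpoly_dim ?V + card S" by (simp add: dim_forms)
  moreover have "(m + 2) choose 2 = ((m - 1 + 2) choose 2) + (m + 1)"
    using choose_reduce_nat[of "m + 2" 2] m by (simp add: numeral_2_eq_2)
  moreover have "mpoly_dim (?W v) > 0" "int (mpoly_dim (?W v)) > int (mpoly_dim ?V) - int ((m - 1 + 2) choose 2)"
    using dim[OF v(1) vG] by simp_all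
  moreover have "card {card S..m} = m + 1 - card S" by simp
  ultimately show False by linarith
qed

subsection \<open>Double points in the plane\<close>

lemma poly2_smult [simp]: "poly2 (smult q p) a b = poly q a * poly2 p a b"
  by (simp add: poly2_def)

lemma pderiv_inner_smult_const [simp]: "pderiv_inner (smult [:c:] p) = smult [:c:] (pderiv_inner p)"
  by (rule poly_eqI) (simp add: pderiv_smult)

interpretation aff: coeff_hom "\<lambda>c :: 'k::comm_ring_1. [:[:c:]:]"
  by unfold_locales (simp_all add: one_pCons)

lemma poly2_subst: "poly2 (aff.subst Y f) a b = mpoly_eval (\<lambda>i. poly2 (Y i) a b) f"
  unfolding mpoly_eval_eq_subst
  by (rule aff.subst_comp[of "\<lambda>q. poly2 q a b"]) (unfold_locales, simp_all)

lemma bivariate_expansion: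
  "p = (\<Sum>j\<le>degree p. \<Sum>i\<le>degree (coeff p j). [:[:coeff (coeff p j) i:]:] * [:[:0, 1:]:] ^ i * [:0, 1:] ^ j)"
proof -
  have x: "[:[:c:]:] * [:[:0, 1:]:] ^ i = [:monom c i:]" for c :: 'a and i
  proof -
    have "[:[:0, 1:]:] ^ i = [:monom (1 :: 'a) i:]"
      by (induct i) (simp_all add: one_pCons monom_0 monom_Suc)
    then show ?thesis by (simp add: smult_monom)
  qed
  have y: "[:q:] * [:0, 1:] ^ j = monom q j" for q :: "'a poly" and j
    by (simp add: monom_altdef)
  have sum: "(\<Sum>i\<in>A. monom (f i) j) = monom (\<Sum>i\<in>A. f i) j" for f :: "nat \<Rightarrow> 'a poly" and A j
    by (induct A rule: infinite_finite_induct) (simp_all add: add_monom)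
  show ?thesis
    unfolding x y sum poly_as_sum_of_monoms ..
qed

text \<open>The affine chart in which the line \<open>x_0 + \<tau> x_1 + \<tau>^2 x_2 = 0\<close> is at infinity.\<close>

locale affine_chart =
  fixes \<tau> :: "'k::field_char_0"
begin

text \<open>x_0 is eliminated by setting the linear form at infinity equal to 1.\<close>

definition coord :: "nat \<Rightarrow> 'k poly poly" where
  "coord i = (if i = 0 then 1 - [:[:\<tau>:]:] * [:[:0, 1:]:] - [:[:\<tau> ^ 2:]:] * [:0, 1:]
    else if i = 1 then [:[:0, 1:]:] else if i = 2 then [:0, 1:] else 0)"

definition point :: "'k \<Rightarrow> 'k \<Rightarrow> nat \<Rightarrow> 'k" where
  "point a b i = (if i = 0 then 1 - \<tau> * a - \<tau> ^ 2 * b else if i = 1 then a else if i = 2 then b else 0)"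

definition infinity :: "(nat \<Rightarrow> 'k) \<Rightarrow> 'k" where
  "infinity v = v 0 + \<tau> * v 1 + \<tau> ^ 2 * v 2"

definition infinity_form :: "'k mpoly" where
  "infinity_form = Var 0 + Const \<tau> * Var 1 + Const (\<tau> ^ 2) * Var 2"

definition dehomogenize :: "'k mpoly \<Rightarrow> 'k poly poly" where
  "dehomogenize = aff.subst coord"

lemma dehomogenize_simps:
  "dehomogenize (f + g) = dehomogenize f + dehomogenize g"
  "dehomogenize (f - g) = dehomogenize f - dehomogenize g"
  "dehomogenize (f * g) = dehomogenize f * dehomogenize g"
  "dehomogenize (mpoly_scale c f) = [:[:c:]:] * dehomogenize f"
  "dehomogenize (f ^ k) = dehomogenize f ^ k"
  "dehomogenize (sum h A) = (\<Sum>a\<in>A. dehomogenize (h a))"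
  "dehomogenize (Const c) = [:[:c:]:]"
  "dehomogenize (Var i) = coord i"
  "dehomogenize 0 = 0"
  unfolding dehomogenize_def
  by (simp_all only: aff.subst_add aff.subst_diff aff.subst_mult aff.subst_scale aff.subst_power aff.subst_sum
      aff.subst_Const aff.subst_Var aff.subst_0)

lemma poly2_dehomogenize: "poly2 (dehomogenize f) a b = mpoly_eval (point a b) f"
proof -
  have "(\<lambda>i. poly2 (coord i) a b) = point a b"
    by (rule ext) (simp add: coord_def point_def)
  then show ?thesis by (simp add: dehomogenize_def poly2_subst)
qed

lemma infinity_form_forms: "infinity_form \<in> forms 2 1"
  unfolding infinity_form_def by (intro forms_add forms_Const_mult forms_Var) simp_all

lemma mpoly_eval_infinity_form [simp]: "mpoly_eval v infinity_form = infinity v"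
  by (simp add: infinity_form_def infinity_def)

lemma infinity_form_nonzero: "infinity_form \<noteq> 0"
proof
  assume "infinity_form = 0"
  then have "mpoly_eval (basis_vec 0) infinity_form = 0" by simp
  then show False by (simp add: infinity_def basis_vec_def)
qed

lemma dehomogenize_infinity_form: "dehomogenize infinity_form = 1"
  unfolding infinity_form_def dehomogenize_simps coord_def by simp

lemma point_homog: "point a b \<in> homog_coords 2"
proof -
  have "infinity (point a b) = 1" by (simp add: infinity_def point_def)
  then have "point a b \<noteq> (\<lambda>_. 0)" by (auto simp: infinity_def)
  then show ?thesis by (auto simp: homog_coords_def point_def fun_eq_iff)
qed

lemma mpoly_eval_chart:
  assumes f: "f \<in> forms 2 d" and v: "infinity v \<noteq> 0"
  shows "mpoly_eval v f = infinity v ^ d * poly2 (dehomogenize f) (v 1 / infinity v) (v 2 / infinity v)"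
proof -
  let ?c = "infinity v"
  have "mpoly_eval v f = mpoly_eval (\<lambda>i. ?c * point (v 1 / ?c) (v 2 / ?c) i) f"
  proof (rule mpoly_eval_cong[OF forms_carrier[OF f]])
    fix i :: nat assume "i \<le> 2"
    then consider "i = 0" | "i = 1" | "i = 2" by linarith
    then show "v i = ?c * point (v 1 / ?c) (v 2 / ?c) i"
    proof cases
      case 1
      have "?c * point (v 1 / ?c) (v 2 / ?c) 0 = ?c - \<tau> * v 1 - \<tau> ^ 2 * v 2"
        using v by (simp add: point_def field_simps)
      then show ?thesis using 1 by (simp add: infinity_def)
    qed (use v in \<open>simp_all add: point_def\<close>)
  qed
  then show ?thesis unfolding poly2_dehomogenize mpoly_eval_form_scale[OF f] .
qed

text \<open>The chart misses the line at infinity; multiplying by the equation of this line makes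
  vanishing on the chart sufficient.\<close>

lemma dehomogenize_eq_0_iff:
  assumes f: "f \<in> forms 2 d"
  shows "dehomogenize f = 0 \<longleftrightarrow> f = 0"
proof
  assume z: "dehomogenize f = 0"
  have "f * infinity_form = 0"
  proof (rule form_eq_0I[OF forms_mult[OF f infinity_form_forms]])
    fix v :: "nat \<Rightarrow> 'k"
    show "mpoly_eval v (f * infinity_form) = 0"
      using mpoly_eval_chart[OF f, of v] z by (cases "infinity v = 0") simp_all
  qed
  then show "f = 0" using infinity_form_nonzero by simp
qed (simp add: dehomogenize_simps)

lemma tdeg_dehomogenize:
  assumes "f \<in> forms 2 d"
  shows "tdeg (dehomogenize f) \<le> d"
proof -
  have "blowup (aff.subst coord f) = aff.subst (\<lambda>i. blowup (coord i)) f"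
    by (rule aff.subst_comp) (unfold_locales, simp_all add: blowup_add blowup_mult one_pCons)
  moreover have "degree (blowup (coord i)) \<le> 1" for i
  proof -
    have neg: "blowup (- p) = - blowup p" for p :: "'k poly poly"
      using blowup_add[of p "- p"] by (simp add: eq_neg_iff_add_eq_0 add.commute)
    have diff: "blowup (p - q) = blowup p - blowup q" for p q :: "'k poly poly"
      using blowup_add[of p "- q"] by (simp add: neg)
    have "blowup (1 - [:[:\<tau>:]:] * [:[:0, 1:]:] - [:[:\<tau> ^ 2:]:] * [:0, 1:])
        = 1 - [:[:\<tau>:]:] * [:0, 1:] - [:[:\<tau> ^ 2:]:] * [:0, [:0, 1:]:]"
      by (simp only: diff blowup_mult blowup_const blowup_x blowup_y blowup_1)
    also have "\<dots> = [:1, [:- \<tau>, - (\<tau> ^ 2):]:]"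
      by (simp add: one_pCons)
    finally show ?thesis by (simp add: coord_def blowup_x blowup_y)
  qed
  ultimately show ?thesis
    unfolding tdeg_def dehomogenize_def
    by (simp only:) (rule degree_subst_le[OF _ _ _ assms], unfold_locales, simp_all add: one_pCons)
qed

lemma dehomogenize_surj:
  assumes "tdeg p \<le> d"
  obtains f where "f \<in> forms 2 d" "dehomogenize f = p"
proof
  \<comment> \<open>Each x^i y^j is filled up to degree d by powers of the form at infinity, which
    dehomogenizes to 1. Where i + j exceeds d the coefficient is 0 anyway.\<close>
  define g where "g i j = (if i + j \<le> d then Const (coeff (coeff p j) i) * Var 1 ^ i * Var 2 ^ j * infinity_form ^ (d - i - j) else 0)" for i j
  define f where "f = (\<Sum>j\<le>degree p. \<Sum>i\<le>degree (coeff p j). g i j)"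
  have "g i j \<in> forms 2 d" for i j
  proof (cases "i + j \<le> d")
    case True
    have "Const (coeff (coeff p j) i) * Var 1 ^ i * Var 2 ^ j * infinity_form ^ (d - i - j)
        \<in> forms 2 (0 + i * 1 + j * 1 + (d - i - j) * 1)"
      by (intro forms_mult forms_power forms_Const forms_Var infinity_form_forms) simp_all
    then show ?thesis using True by (simp add: g_def)
  qed (simp add: g_def)
  then show "f \<in> forms 2 d" unfolding f_def by (intro forms_sum)
  have "dehomogenize (g i j) = [:[:coeff (coeff p j) i:]:] * [:[:0, 1:]:] ^ i * [:0, 1:] ^ j" for i j
  proof (cases "i + j \<le> d")
    case True
    then show ?thesis
      by (simp add: g_def dehomogenize_simps dehomogenize_infinity_form coord_def del: mult_pCons_left)
  next
    case False
    then have "coeff (coeff p j) i = 0" using assms by (intro coeff_gt_tdeg) simp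
    then show ?thesis using False by (simp add: g_def dehomogenize_simps)
  qed
  then show "dehomogenize f = p"
    unfolding f_def dehomogenize_simps by (simp only: bivariate_expansion[symmetric])
qed

text \<open>By the product rule, a product of two polynomials vanishing at the point vanishes there
  together with its derivatives; sums inherit this.\<close>

lemma double_point_singular:
  assumes "f \<in> ideal_power 2 (point_ideal 2 {proj_point 2 (point a b)}) 2"
  shows "poly2 (dehomogenize f) a b = 0 \<and> poly2 (pderiv (dehomogenize f)) a b = 0
    \<and> poly2 (pderiv_inner (dehomogenize f)) a b = 0"
proof -
  let ?I = "point_ideal 2 {proj_point 2 (point a b)}"
  have van: "poly2 (dehomogenize p) a b = 0" if "p \<in> ideal_power 2 ?I 1" for p
  proof -
    have "[:0, 1:] ^ 1 dvd line_poly (point a b) (point a b) p"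
      using ideal_power_dvd_line_poly[OF point_homog that] .
    then have "poly (line_poly (point a b) (point a b) p) 0 = 0"
      using poly_eq_0_iff_dvd[of _ "0 :: 'k"] by simp
    then show ?thesis unfolding poly_line_poly poly2_dehomogenize by simp
  qed
  have van': "poly2 (dehomogenize q) a b = 0" if "q \<in> ?I" for q
    using point_ideal_vanishes(2)[of q 2 "{point a b}" "point a b"] that point_homog
    by (simp add: poly2_dehomogenize)
  have "f \<in> ideal_power 2 ?I (Suc 1)" using assms by (simp only: numeral_2_eq_2 One_nat_def)
  then show ?thesis
  proof (induct rule: ideal_power_induct)
    case (mult p q)
    then show ?case
      using van[of p] van'[of q] by (simp add: dehomogenize_simps pderiv_mult pderiv_inner_mult)
  next
    case (add p q)
    then show ?case by (simp add: dehomogenize_simps pderiv_add pderiv_inner_add)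
  qed
qed

end

lemma cramer2:
  fixes \<alpha> \<beta> :: "'a::comm_ring_1"
  assumes "\<alpha> * f1 + \<beta> * g1 = 0" "\<alpha> * f2 + \<beta> * g2 = 0"
  shows "\<alpha> * (f2 * g1 - f1 * g2) = 0" "\<beta> * (f2 * g1 - f1 * g2) = 0"
proof -
  have "\<alpha> * (f2 * g1 - f1 * g2) = (\<alpha> * f2 + \<beta> * g2) * g1 - (\<alpha> * f1 + \<beta> * g1) * g2"
    "\<beta> * (f2 * g1 - f1 * g2) = (\<alpha> * f1 + \<beta> * g1) * f2 - (\<alpha> * f2 + \<beta> * g2) * f1"
    by (simp_all add: algebra_simps)
  then show "\<alpha> * (f2 * g1 - f1 * g2) = 0" "\<beta> * (f2 * g1 - f1 * g2) = 0"
    by (simp_all add: assms)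
qed

text \<open>\<open>J\<close> has the shape of \<open>jacobian3\<close> at a point; where it is
  nonzero, no nontrivial combination is singular.\<close>

lemma cramer3:
  fixes \<alpha> \<beta> \<gamma> :: "'a::comm_ring_1"
  assumes "\<alpha> * p1 + \<beta> * q1 + \<gamma> * r1 = 0" "\<alpha> * p2 + \<beta> * q2 + \<gamma> * r2 = 0"
    "\<alpha> * p3 + \<beta> * q3 + \<gamma> * r3 = 0"
  defines "J \<equiv> p1 * (q3 * r2 - q2 * r3) - p3 * (q1 * r2 - q2 * r1) + p2 * (q1 * r3 - q3 * r1)"
  shows "\<alpha> * J = 0" "\<beta> * J = 0" "\<gamma> * J = 0"
proof -
  let ?e1 = "\<alpha> * p1 + \<beta> * q1 + \<gamma> * r1" and ?e2 = "\<alpha> * p2 + \<beta> * q2 + \<gamma> * r2"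
    and ?e3 = "\<alpha> * p3 + \<beta> * q3 + \<gamma> * r3"
  have "\<alpha> * J = ?e1 * (q3 * r2 - q2 * r3) - ?e3 * (q1 * r2 - q2 * r1) + ?e2 * (q1 * r3 - q3 * r1)"
    "\<beta> * J = - (?e1 * (p3 * r2 - p2 * r3) - ?e3 * (p1 * r2 - p2 * r1) + ?e2 * (p1 * r3 - p3 * r1))"
    "\<gamma> * J = ?e1 * (p3 * q2 - p2 * q3) - ?e3 * (p1 * q2 - p2 * q1) + ?e2 * (p1 * q3 - p3 * q1)"
    by (simp_all add: J_def algebra_simps)
  then show "\<alpha> * J = 0" "\<beta> * J = 0" "\<gamma> * J = 0" by (simp_all add: assms(1-3))
qed

lemma independent_combination3:
  fixes f g h :: "'k::field mpoly"
  assumes "mp.independent C" "{f, g, h} \<subseteq> C" "f \<noteq> g" "f \<noteq> h" "g \<noteq> h"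
    and "mpoly_scale \<alpha> f + mpoly_scale \<beta> g + mpoly_scale \<gamma> h = 0"
  shows "\<alpha> = 0 \<and> \<beta> = 0 \<and> \<gamma> = 0"
proof -
  define u where "u = (\<lambda>x. if x = f then \<alpha> else if x = g then \<beta> else \<gamma>)"
  have "(\<Sum>x\<in>{f, g, h}. mpoly_scale (u x) x) = 0"
    using assms(3-6) by (simp add: u_def add.assoc)
  then have "u x = 0" if "x \<in> {f, g, h}" for x
    using mp.independentD[OF assms(1) _ assms(2) _ that] by simp
  from this[of f] this[of g] this[of h] show ?thesis using assms(3-5) by (simp add: u_def)
qed

text \<open>The expected drop is binom(3, 2) = 3, so \<open>?W v\<close> has to be 0 for dim V \<le>
  2 and of codimension at least 3 otherwise, at some point allowed by \<open>G\<close>. The small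
  dimensions are separate because they offer no three independent forms.\<close>

lemma no_unexpected_double_point:
  fixes S :: "(nat \<Rightarrow> 'k::{alg_closed_field,field_char_0}) set"
  assumes S: "S \<subseteq> homog_coords 2" "finite S"
  shows "\<not> admits_unexpected 2 d 2 (proj_point 2 ` S)"
proof
  let ?V = "vanishing_forms 2 d S"
  let ?W = "\<lambda>v. ?V \<inter> ideal_power 2 (point_ideal 2 {proj_point 2 v}) 2"
  assume "admits_unexpected 2 d 2 (proj_point 2 ` S)"
  then obtain e G where G: "G \<in> forms 2 e" "G \<noteq> 0" and
    dim: "\<And>v. v \<in> homog_coords 2 \<Longrightarrow> mpoly_eval v G \<noteq> 0 \<Longrightarrow>
      int (mpoly_dim (?W v)) > max 0 (int (mpoly_dim ?V) - int ((2 - 1 + 2) choose 2))"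
    unfolding admits_unexpected_iff[OF S(1)] by (rule for_general_pointE) blast
  obtain \<tau> where \<tau>: "\<And>v. v \<in> S \<Longrightarrow> (\<Sum>i\<le>2. \<tau> ^ i * v i) \<noteq> 0"
    using hyperplane_avoiding[OF S(2,1)] by blast
  interpret affine_chart \<tau> .
  have \<tau>': "infinity v \<noteq> 0" if "v \<in> S" for v
    using \<tau>[OF that] by (simp add: infinity_def numeral_2_eq_2)
  define A where "A = (\<lambda>v. (v 1 / infinity v, v 2 / infinity v)) ` S"
  define V' where "V' = {p. tdeg p \<le> d \<and> (\<forall>(x, y)\<in>A. poly2 p x y = 0)}"
  have V_iff: "f \<in> ?V \<longleftrightarrow> dehomogenize f \<in> V'" if f: "f \<in> forms 2 d" for f
    using f \<tau>' mpoly_eval_chart[OF f] tdeg_dehomogenize[OF f]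
    by (auto simp: vanishing_forms_def V'_def A_def)
  obtain B where B: "finite B" "forms 2 d \<subseteq> mp.span (B :: 'k mpoly set)"
    by (rule finite_spanning_set_forms)
  have VB: "?V \<subseteq> mp.span B" using B(2) vanishing_forms_subset[of 2 d S] by blast
  have sW: "mp.subspace (?W v)" for v
    by (intro subspace_vanishing_power ideal_point_ideal)
  have general: "\<exists>a b. mpoly_eval (point a b) G \<noteq> 0 \<and> poly2 q a b \<noteq> 0" if "q \<noteq> 0" for q
  proof -
    have "dehomogenize G * q \<noteq> 0" using that G dehomogenize_eq_0_iff[OF G(1)] by simp
    then obtain a b where "poly2 (dehomogenize G * q) a b \<noteq> 0" using poly2_nonzero by blast
    then show ?thesis by (auto simp: poly2_dehomogenize)
  qed
  obtain C where C: "C \<subseteq> ?V" "mp.independent C" "?V \<subseteq> mp.span C" "card C = mpoly_dim ?V"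
    by (rule mp.basis_exists)
  have form: "c \<in> forms 2 d" if "c \<in> ?V" for c using that by (simp add: vanishing_forms_def)
  consider "card C = 0" | "card C = 1" | "card C = 2" | "card C \<ge> 3" by linarith
  then show False
  proof cases
    case 1
    obtain v where v: "v \<in> homog_coords 2" "mpoly_eval v G \<noteq> 0" using nonvanishing_point[OF G] by blast
    have "mpoly_dim (?W v) \<le> mpoly_dim ?V"
      by (rule mp.dim_le_of_subspace[OF VB B(1) sW]) blast
    then show False using dim[OF v] 1 C(4) by simp
  next
    case 2
    then obtain f where f: "C = {f}" by (auto simp: card_Suc_eq)
    then have "f \<in> ?V" "f \<noteq> 0" using C(1,2) by auto
    then have "dehomogenize f \<noteq> 0" using dehomogenize_eq_0_iff[OF form] by blast
    then obtain a b where ab: "mpoly_eval (point a b) G \<noteq> 0" "poly2 (dehomogenize f) a b \<noteq> 0"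
      using general by blast
    have "f \<notin> ?W (point a b)" using double_point_singular[of f a b] ab(2) by blast
    then have "mpoly_dim (?W (point a b)) < mpoly_dim ?V"
      using \<open>f \<in> ?V\<close> by (intro mp.subspace_dim_less[OF VB B(1) sW]) auto
    then show False using dim[OF point_homog ab(1)] 2 C(4) by simp
  next
    case 3
    then obtain f g where fg: "C = {f, g}" "f \<noteq> g" by (auto simp: card_2_iff)
    have V: "f \<in> ?V" "g \<in> ?V" using C(1) fg by auto
    have g0: "g \<noteq> 0" using C(2) fg(1) mp.dependent_zero[of C] by blast
    let ?f = "dehomogenize f" and ?g = "dehomogenize g"
    have g0': "?g \<noteq> 0" using g0 dehomogenize_eq_0_iff[OF form[OF V(2)]] by simp
    \<comment> \<open>Independent f and g have a nonvanishing Wronskian in x or y; where it is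
      nonzero, no nontrivial combination of them is singular.\<close>
    have "\<not> (pderiv ?f * ?g = ?f * pderiv ?g \<and> pderiv_inner ?f * ?g = ?f * pderiv_inner ?g)"
    proof
      assume "pderiv ?f * ?g = ?f * pderiv ?g \<and> pderiv_inner ?f * ?g = ?f * pderiv_inner ?g"
      then obtain c where "?f = smult [:c:] ?g"
        using wronskian2_zero_imp_smult[OF _ _ g0'] by blast
      then have "dehomogenize (f - mpoly_scale c g) = 0"
        by (simp add: dehomogenize_simps)
      moreover have "f - mpoly_scale c g \<in> forms 2 d"
        using form[OF V(1)] form[OF V(2)] by (simp add: forms_diff mpoly_scale_eq forms_Const_mult)
      ultimately have "f - mpoly_scale c g = 0" using dehomogenize_eq_0_iff by blast
      then have "f = mpoly_scale c g" by simp
      then have "f \<in> mp.span {g}" by (metis mp.span_scale mp.span_base singletonI)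
      moreover have "C - {f} = {g}" using fg by auto
      ultimately have "f \<in> mp.span (C - {f})" by simp
      moreover have "f \<in> C" using fg by simp
      ultimately have "mp.dependent C" unfolding mp.dependent_def by (rule rev_bexI[rotated])
      then show False using C(2) by contradiction
    qed
    then have "pderiv ?f * ?g - ?f * pderiv ?g \<noteq> 0 \<or> pderiv_inner ?f * ?g - ?f * pderiv_inner ?g \<noteq> 0"
      by simp
    then obtain a b where ab: "mpoly_eval (point a b) G \<noteq> 0"
      "poly2 (pderiv ?f * ?g - ?f * pderiv ?g) a b \<noteq> 0 \<or> poly2 (pderiv_inner ?f * ?g - ?f * pderiv_inner ?g) a b \<noteq> 0"
      using general by metis
    have "mpoly_dim (?W (point a b)) + 2 \<le> mpoly_dim (mp.span (insert g (insert f (?W (point a b)))))"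
    proof (rule mp.dim_add2_le[OF VB B(1) subspace_vanishing_forms sW _ V])
      fix \<alpha> \<beta> assume "mpoly_scale \<alpha> f + mpoly_scale \<beta> g \<in> ?W (point a b)"
      then have e: "\<alpha> * poly2 ?f a b + \<beta> * poly2 ?g a b = 0"
        "\<alpha> * poly2 (pderiv ?f) a b + \<beta> * poly2 (pderiv ?g) a b = 0"
        "\<alpha> * poly2 (pderiv_inner ?f) a b + \<beta> * poly2 (pderiv_inner ?g) a b = 0"
        using double_point_singular[of "mpoly_scale \<alpha> f + mpoly_scale \<beta> g" a b]
        by (simp_all add: dehomogenize_simps pderiv_add pderiv_smult pderiv_inner_add)
      note cramer2[OF e(1,2)] cramer2[OF e(1,3)]
      then show "\<alpha> = 0 \<and> \<beta> = 0" using ab(2) by auto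
    qed blast
    also have "\<dots> \<le> mpoly_dim ?V"
      using V by (intro mp.dim_le_of_subspace[OF VB B(1)] mp.span_minimal subspace_vanishing_forms) auto
    finally show False using dim[OF point_homog ab(1)] 3 C(4) by simp
  next
    case 4
    then obtain T where "T \<subseteq> C" "card T = 3" by (metis obtain_subset_with_card_n)
    then obtain f g h where fgh: "{f, g, h} \<subseteq> C" "f \<noteq> g" "f \<noteq> h" "g \<noteq> h"
      by (auto simp: card_3_iff)
    have V: "f \<in> ?V" "g \<in> ?V" "h \<in> ?V" using C(1) fgh(1) by auto
    have indep: "\<alpha> = 0 \<and> \<beta> = 0 \<and> \<gamma> = 0"
      if "[:[:\<alpha>:]:] * dehomogenize f + [:[:\<beta>:]:] * dehomogenize g + [:[:\<gamma>:]:] * dehomogenize h = 0" for \<alpha> \<beta> \<gamma>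
    proof -
      have "dehomogenize (mpoly_scale \<alpha> f + mpoly_scale \<beta> g + mpoly_scale \<gamma> h) = 0"
        unfolding dehomogenize_simps by (rule that)
      moreover have "mpoly_scale \<alpha> f + mpoly_scale \<beta> g + mpoly_scale \<gamma> h \<in> forms 2 d"
        using V form by (simp add: forms_add mpoly_scale_eq forms_Const_mult)
      ultimately have "mpoly_scale \<alpha> f + mpoly_scale \<beta> g + mpoly_scale \<gamma> h = 0"
        using dehomogenize_eq_0_iff by blast
      then show ?thesis by (rule independent_combination3[OF C(2) fgh])
    qed
    have "dehomogenize f \<in> V'" "dehomogenize g \<in> V'" "dehomogenize h \<in> V'"
      using V V_iff form by blast+
    then have "\<exists>p\<in>V'. \<exists>q\<in>V'. \<exists>r\<in>V'. jacobian3 p q r \<noteq> 0"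
      using jacobian3_nonzero_exists[of "dehomogenize f" d A "dehomogenize g" "dehomogenize h"] indep
      unfolding V'_def by blast
    then obtain p q r where pqr: "p \<in> V'" "q \<in> V'" "r \<in> V'" "jacobian3 p q r \<noteq> 0" by blast
    have lift: "\<exists>f. f \<in> ?V \<and> dehomogenize f = p" if "p \<in> V'" for p
    proof -
      have "tdeg p \<le> d" using that by (simp add: V'_def)
      then obtain f where "f \<in> forms 2 d" "dehomogenize f = p" by (rule dehomogenize_surj)
      then show ?thesis using V_iff that by blast
    qed
    obtain f' g' h' where V': "f' \<in> ?V" "g' \<in> ?V" "h' \<in> ?V"
      and deh: "dehomogenize f' = p" "dehomogenize g' = q" "dehomogenize h' = r"
      using lift pqr(1-3) by metis
    obtain a b where ab: "mpoly_eval (point a b) G \<noteq> 0" "poly2 (jacobian3 p q r) a b \<noteq> 0"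
      using general[OF pqr(4)] by blast
    have "mpoly_dim (?W (point a b)) + 3 \<le> mpoly_dim ?V"
    proof (rule mp.dim_add3_le[OF VB B(1) subspace_vanishing_forms sW _ V'])
      fix \<alpha> \<beta> \<gamma> assume "mpoly_scale \<alpha> f' + mpoly_scale \<beta> g' + mpoly_scale \<gamma> h' \<in> ?W (point a b)"
      then have e: "\<alpha> * poly2 p a b + \<beta> * poly2 q a b + \<gamma> * poly2 r a b = 0"
        "\<alpha> * poly2 (pderiv p) a b + \<beta> * poly2 (pderiv q) a b + \<gamma> * poly2 (pderiv r) a b = 0"
        "\<alpha> * poly2 (pderiv_inner p) a b + \<beta> * poly2 (pderiv_inner q) a b + \<gamma> * poly2 (pderiv_inner r) a b = 0"
        using double_point_singular[of "mpoly_scale \<alpha> f' + mpoly_scale \<beta> g' + mpoly_scale \<gamma> h'" a b] deh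
        by (simp_all add: dehomogenize_simps pderiv_add pderiv_smult pderiv_inner_add)
      have "poly2 (jacobian3 p q r) a b = poly2 p a b * (poly2 (pderiv_inner q) a b * poly2 (pderiv r) a b - poly2 (pderiv q) a b * poly2 (pderiv_inner r) a b)
         - poly2 (pderiv_inner p) a b * (poly2 q a b * poly2 (pderiv r) a b - poly2 (pderiv q) a b * poly2 r a b)
         + poly2 (pderiv p) a b * (poly2 q a b * poly2 (pderiv_inner r) a b - poly2 (pderiv_inner q) a b * poly2 r a b)"
        by (simp add: jacobian3_def)
      then show "\<alpha> = 0 \<and> \<beta> = 0 \<and> \<gamma> = 0" using cramer3[OF e] ab(2) by (metis mult_eq_0_iff)
    qed blast
    moreover have "(2 - 1 + 2) choose 2 = (3 :: nat)" by (simp add: numeral_2_eq_2)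
    ultimately show False using dim[OF point_homog ab(1)] by simp
  qed
qed

theorem theorem1p2:
  fixes n d m :: nat
  assumes "n > 1" and "d > 0" and "m > 0"
  shows "(\<exists>Z :: (nat \<Rightarrow> 'k::{alg_closed_field, field_char_0}) set set.
            finite Z \<and> Z \<subseteq> proj_space n \<and> admits_unexpected n d m Z)
         \<longleftrightarrow> (n = 2 \<and> d > m \<and> m > 2) \<or> (n \<ge> 3 \<and> d \<ge> m \<and> m \<ge> 2)"
    (is "?L \<longleftrightarrow> ?R")
proof
  assume ?R
  then have "\<exists>S :: (nat \<Rightarrow> 'k) set. strongly_unexpected n d m S" by (rule exists_strongly_unexpected)
  then show ?L using strongly_unexpected_imp by (elim exE)
next
  assume ?L
  then obtain Z :: "(nat \<Rightarrow> 'k) set set" where Z: "finite Z" "Z \<subseteq> proj_space n" "admits_unexpected n d m Z"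
    by blast
  obtain S where S: "finite S" "S \<subseteq> homog_coords n" "Z = proj_point n ` S" "inj_on (proj_point n) S"
    using finite_proj_space_repr[OF Z(1,2)] .
  have "m \<le> d" using no_unexpected_small_degree[OF S(2), of d m] Z(3) S(3) by fastforce
  moreover have "m \<noteq> 1" using no_unexpected_multiplicity_one[OF S(2), of d] Z(3) S(3) by blast
  moreover have "n = 2 \<Longrightarrow> d \<noteq> m" using no_unexpected_pencil[of S m] S Z(3) assms(3) by blast
  moreover have "n = 2 \<Longrightarrow> m \<noteq> 2" using no_unexpected_double_point[of S d] S Z(3) by blast
  ultimately show ?R using assms by linarith
qed

end
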